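(* Let $a>0$, $\mu>0$, let $V\in X^\gamma L^1[a,\infty)$ be real-valued with a fixed $\gamma<2$, and let $H(R_a)$ be the self-adjoint realization in $L^2[a,\infty)$ of $$H=-\frac{d}{dx}\Bigl(x^2\frac{d}{dx}\,\cdot\Bigr)+x^2\mu^2-\frac14+V(x)$$ with boundary condition $R_af=0$ at $a$. Then the eigenvalue counting function $N(\lambda)$ of $H(R_a)$ satisfies $$N(\lambda)\sim\frac{\sqrt{\lambda}\,\log(\lambda)}{2\,\Gamma(1/2)^2},\qquad\lambda\to\infty.$$
   Context: $X$ denotes multiplication by $x$; $X^\gamma L^1[a,\infty)=\{x^\gamma g(x) : g\in L^1[a,\infty)\}$. The boundary condition is $R_af:=\sin\theta_a\cdot f'(a)+\cos\theta_a\cdot f(a)=0$ with $0\le\theta_a<\pi$. The expression $H$ is in the limit point case at infinity, so $H(R_a)$ is self-adjoint without a boundary condition at infinity; it is bounded below with discrete spectrum. $N(\lambda)$ is the number of eigenvalues of $H(R_a)$, counted with multiplicity, that are at most $\lambda$. The notation $f\sim g$ means $f/g\to1$. *)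

theory Defs
  imports "HOL-Analysis.Analysis" "HOL-Library.Function_Algebras"
    "HOL-Library.Landau_Symbols"
begin

definition XpowL1 :: "real \<Rightarrow> real \<Rightarrow> (real \<Rightarrow> real) set" where
  "XpowL1 \<gamma> a = {V. \<exists>g. g absolutely_integrable_on {a..} \<and> (\<forall>x\<ge>a. V x = x powr \<gamma> * g x)}"

definition abs_cont_on_Icc :: "real \<Rightarrow> real \<Rightarrow> (real \<Rightarrow> complex) \<Rightarrow> bool" where
  "abs_cont_on_Icc b c f \<longleftrightarrow>
     (\<forall>\<epsilon>>0. \<exists>\<delta>>0. \<forall>\<D> T. \<D> division_of T \<and> T \<subseteq> {b..c} \<and> (\<Sum>K\<in>\<D>. Sup K - Inf K) < \<delta> \<longrightarrow>
        (\<Sum>K\<in>\<D>. norm (f (Sup K) - f (Inf K))) < \<epsilon>)"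

definition loc_abs_cont :: "real \<Rightarrow> (real \<Rightarrow> complex) \<Rightarrow> bool" where
  "loc_abs_cont a f \<longleftrightarrow> (\<forall>c\<ge>a. abs_cont_on_Icc a c f)"

definition L2_half_line :: "real \<Rightarrow> (real \<Rightarrow> complex) set" where
  "L2_half_line a = {f. f \<in> borel_measurable (lebesgue_on {a..}) \<and>
                        integrable (lebesgue_on {a..}) (\<lambda>x. (norm (f x))\<^sup>2)}"

text \<open>The derivative along \<open>[a,\<infinity>)\<close>; at the end point it is the one-sided derivative.\<close>

definition hl_deriv :: "real \<Rightarrow> (real \<Rightarrow> complex) \<Rightarrow> real \<Rightarrow> complex" where
  "hl_deriv a f x = vector_derivative f (at x within {a..})"

text \<open>If \<open>x\<^sup>2 f'\<close> is locally absolutely continuous, its derivative exists at almost every \<open>x \<ge> a\<close>,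
  and only there is the value of \<open>H_expr\<close> meaningful.\<close>

definition H_expr :: "real \<Rightarrow> real \<Rightarrow> (real \<Rightarrow> real) \<Rightarrow> (real \<Rightarrow> complex) \<Rightarrow> real \<Rightarrow> complex" where
  "H_expr a \<mu> V f x =
     - hl_deriv a (\<lambda>t. of_real (t\<^sup>2) * hl_deriv a f t) x + of_real (x\<^sup>2 * \<mu>\<^sup>2 - 1/4 + V x) * f x"

definition R_bc :: "real \<Rightarrow> real \<Rightarrow> (real \<Rightarrow> complex) \<Rightarrow> complex" where
  "R_bc a \<theta> f = of_real (sin \<theta>) * hl_deriv a f a + of_real (cos \<theta>) * f a"

text \<open>The domain of \<open>H(R\<^sub>a)\<close> is the maximal domain cut down by the boundary condition at \<open>a\<close>; at
  infinity (limit point case) nothing is imposed. An element of \<open>L\<^sup>2[a,\<infinity>)\<close> in the domain is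
  represented by its unique continuously differentiable representative on \<open>[a,\<infinity>)\<close>, extended by \<open>0\<close>
  to the left of \<open>a\<close>, so that equality of functions is equality in \<open>L\<^sup>2\<close>.\<close>

definition H_dom :: "real \<Rightarrow> real \<Rightarrow> (real \<Rightarrow> real) \<Rightarrow> real \<Rightarrow> (real \<Rightarrow> complex) set" where
  "H_dom a \<mu> V \<theta> = {f. (\<forall>x<a. f x = 0) \<and>
     (\<forall>x\<ge>a. f differentiable (at x within {a..})) \<and>
     loc_abs_cont a (\<lambda>x. of_real (x\<^sup>2) * hl_deriv a f x) \<and>
     f \<in> L2_half_line a \<and> H_expr a \<mu> V f \<in> L2_half_line a \<and>
     R_bc a \<theta> f = 0}"

definition H_eigenspace ::
    "real \<Rightarrow> real \<Rightarrow> (real \<Rightarrow> real) \<Rightarrow> real \<Rightarrow> complex \<Rightarrow> (real \<Rightarrow> complex) set" where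
  "H_eigenspace a \<mu> V \<theta> z =
     {f \<in> H_dom a \<mu> V \<theta>. AE x in lebesgue_on {a..}. H_expr a \<mu> V f x = z * f x}"

definition H_eigenvalue :: "real \<Rightarrow> real \<Rightarrow> (real \<Rightarrow> real) \<Rightarrow> real \<Rightarrow> complex \<Rightarrow> bool" where
  "H_eigenvalue a \<mu> V \<theta> z \<longleftrightarrow> (\<exists>f \<in> H_eigenspace a \<mu> V \<theta> z. f \<noteq> (\<lambda>_. 0))"

interpretation fun_vs: vector_space "\<lambda>(c::complex) (f::real \<Rightarrow> complex) x. c * f x"
  by unfold_locales (auto simp: fun_eq_iff algebra_simps)

text \<open>The multiplicity is the complex dimension of the eigenspace. It is at most two because the
  eigenvalue equation is a second-order linear ordinary differential equation, so the convention that
  \<open>dim\<close> is \<open>0\<close> for infinite-dimensional spaces is never used.\<close>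

definition H_multiplicity :: "real \<Rightarrow> real \<Rightarrow> (real \<Rightarrow> real) \<Rightarrow> real \<Rightarrow> complex \<Rightarrow> nat" where
  "H_multiplicity a \<mu> V \<theta> z = fun_vs.dim (H_eigenspace a \<mu> V \<theta> z)"

text \<open>An infinite set of eigenvalues below some \<open>\<lambda>\<close> would make the sum \<open>0\<close> from there on, so an
  asymptotic equivalence of this function with a positive one also entails finiteness.\<close>

definition H_counting :: "real \<Rightarrow> real \<Rightarrow> (real \<Rightarrow> real) \<Rightarrow> real \<Rightarrow> real \<Rightarrow> nat" where
  "H_counting a \<mu> V \<theta> l =
     (\<Sum>\<nu> | \<nu> \<le> l \<and> H_eigenvalue a \<mu> V \<theta> (of_real \<nu>). H_multiplicity a \<mu> V \<theta> (of_real \<nu>))"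

end

theory Submission
  imports Defs "HOL-Real_Asymp.Real_Asymp"
begin

text \<open>With \<open>v = x f\<close> the eigenvalue equation reads \<open>v'' = (\<mu>\<^sup>2 + (V - 1/4 - l) / x\<^sup>2) v\<close>, and \<open>V / x\<^sup>2\<close>
  is integrable because \<open>\<gamma> < 2\<close>. Its primitive \<open>P\<close> vanishing at infinity is continuous, and in terms of
  \<open>v\<close> and the quasi-derivative \<open>w = v' - P v\<close> the equation is a first order system with continuous
  coefficients in which only \<open>P\<close> occurs. The Pruefer angle of the solution that satisfies the boundary
  condition increases with \<open>l\<close>. Towards infinity it either stays in a repelling sector around
  \<open>3\<pi>/4 + k\<pi>\<close>, and then the solution decays and \<open>l\<close> is an eigenvalue, or it is attracted by some
  \<open>\<pi>/4 + k\<pi>\<close> and the solution grows. Each \<open>k\<close> belongs to at most one \<open>l\<close>, and to exactly one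
  eigenvalue below \<open>l\<close> if the angle passes that sector between spectral parameters \<open>0\<close> and \<open>l\<close>. Hence
  the counting function is the angle divided by \<open>\<pi>\<close> up to a bounded error. Beyond
  \<open>X = 2 \<surd>(l + 1/4) / \<mu>\<close> the angle moves by at most \<open>\<pi>\<close>. On \<open>[a,X]\<close> the angle whose tangent is
  rescaled by \<open>\<surd>(l + 1/4) / (\<mu> x)\<close> has derivative \<open>\<surd>(l + 1/4) / x\<close> up to terms with integral
  \<open>O(\<surd>l)\<close>, which makes it \<open>\<surd>l ln (\<surd>l) + O(\<surd>l)\<close> at \<open>X\<close>.

  That the locally absolutely continuous functions in the domain solve this system rests on two
  facts, both obtained from Vitali coverings: such functions are differentiable almost
  everywhere, and they are constant if the derivative vanishes almost everywhere.\<close>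

section \<open>Vitali coverings by intervals\<close>

text \<open>The obstacle is that \<open>V\<close> is only integrable after weighting: an angle built
  from \<open>v\<close> and \<open>v'\<close> would satisfy an equation with merely integrable
  coefficients. The quasi-derivative removes \<open>V\<close> at the price of a bounded term
  \<open>P^2\<close>, so classical existence and monotonicity arguments apply; null sets enter only
  where the system is compared with the differential expression. The scale \<mu> in the angle turns
  the limit equation at infinity into \<open>\<phi>' = \<mu> cos (2 \<phi>)\<close>, whose zeros,
  the odd multiples of pi/4, are alternately attracting and repelling. The leading term exceeds the
  order \<open>sqrt l\<close> only by a logarithm, so every error \<open>O (sqrt l)\<close> may be
  given away; this is why a rescaled angle with crude bounds can replace a finer asymptotic
  analysis. The logarithm is the integral of \<open>sqrt l / x\<close> up to a turning point of
  order \<open>sqrt l\<close>, and the factor 1/2 comes from \<open>ln (sqrt l) = ln l / 2\<close>.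
  Division by pi counts half-turns, and the square of \<open>Gamma (1/2)\<close> is pi.\<close>

lemma Vitali_finite_intervals:
  fixes S U :: "real set"
  assumes "open U" "U \<in> lmeasurable" "S \<subseteq> U" "0 < \<epsilon>"
    and cov: "\<And>x d. x \<in> S \<Longrightarrow> 0 < d \<Longrightarrow> \<exists>u v. u < v \<and> x \<in> {u..v} \<and> v - u < d \<and> Q u v"
  obtains C B where "finite C" "\<And>K. K \<in> C \<Longrightarrow> \<exists>u v. u < v \<and> K = {u..v} \<and> Q u v \<and> K \<subseteq> U"
    "pairwise disjnt C" "B \<in> lmeasurable" "measure lebesgue B < \<epsilon>" "S - \<Union>C \<subseteq> B"
proof -
  \<comment> \<open>Intervals are rewritten as closed balls around their midpoints. A point of
    \<open>S\<close> may lie anywhere in its interval, also at an end.\<close>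
  define c where "c = (\<lambda>p::real\<times>real. (fst p + snd p) / 2)"
  define r where "r = (\<lambda>p::real\<times>real. (snd p - fst p) / 2)"
  define I where "I = {p. fst p < snd p \<and> Q (fst p) (snd p) \<and> {fst p..snd p} \<subseteq> U}"
  have cb: "cball (c p) (r p) = {fst p..snd p}" for p
    unfolding cball_eq_atLeastAtMost c_def r_def by (simp add: field_simps)
  have rpos: "0 < r p" if "p \<in> I" for p
    using that by (auto simp: I_def r_def)
  have cover: "\<exists>p. p \<in> I \<and> x \<in> cball (c p) (r p) \<and> r p < d" if "x \<in> S" "0 < d" for x d
  proof -
    obtain e where e: "e > 0" "ball x e \<subseteq> U"
      using \<open>x \<in> S\<close> assms(1,3) by (meson open_contains_ball subsetD)
    obtain u v where uv: "u < v" "x \<in> {u..v}" "v - u < min d e" "Q u v"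
      using cov[OF \<open>x \<in> S\<close>, of "min d e"] e \<open>0 < d\<close> by auto
    have "{u..v} \<subseteq> ball x e"
    proof
      fix y assume "y \<in> {u..v}"
      then have "\<bar>x - y\<bar> < e" using uv by (simp add: abs_if)
      then show "y \<in> ball x e" by (simp add: dist_real_def)
    qed
    then have "(u,v) \<in> I"
      using uv e by (auto simp: I_def)
    moreover have "r (u,v) < d"
      using uv by (auto simp: r_def)
    ultimately show ?thesis
      using uv(2) cb[of "(u,v)"] by (intro exI[of _ "(u,v)"]) auto
  qed
  obtain D where D: "countable D" "D \<subseteq> I"
     "pairwise (\<lambda>i j. disjnt (cball (c i) (r i)) (cball (c j) (r j))) D"
     "negligible (S - (\<Union>i \<in> D. cball (c i) (r i)))"
    by (rule Vitali_covering_theorem_cballs[OF rpos cover])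
  let ?K = "\<lambda>p. {fst p..snd p::real}"
  let ?G = "\<Union>i\<in>D. ?K i"
  have neg: "negligible (S - ?G)"
    using D(4) by (simp add: cb)
  have GU: "?G \<subseteq> U"
    using D(2) by (auto simp: I_def)
  have Gm: "?G \<in> sets lebesgue"
    using D(1) by (intro sets.countable_UN') auto
  have G: "?G \<in> lmeasurable"
    using fmeasurableI2[OF assms(2) GU Gm] .
  obtain F where F: "finite F" "F \<subseteq> D" "measure lebesgue (?G - (\<Union>i\<in>F. ?K i)) < \<epsilon>"
  proof (cases "D = {}")
    case True
    then show ?thesis using that[of "{}"] \<open>0 < \<epsilon>\<close> by simp
  next
    case False
    define A where "A n = (\<Union>i\<in>from_nat_into D ` {..n}. ?K i)" for n
    have Asub: "from_nat_into D ` {..n} \<subseteq> D" for n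
      using from_nat_into[OF False] by auto
    have UA: "(\<Union>n. A n) = ?G"
    proof -
      have "D = (\<Union>n. from_nat_into D ` {..n})"
        using image_UN[of "from_nat_into D" "\<lambda>n. {..n}" UNIV] range_from_nat_into[OF False D(1)]
        by (simp add: UN_atMost_UNIV)
      then have "(\<Union>i\<in>D. ?K i) = (\<Union>i\<in>(\<Union>n. from_nat_into D ` {..n}). ?K i)" by simp
      then show ?thesis by (simp only: A_def UN_UN_flatten)
    qed
    have Am: "A n \<in> sets lebesgue" for n
      unfolding A_def by (intro sets.finite_UN) auto
    have "(\<lambda>n. measure lebesgue (A n)) \<longlonglongrightarrow> measure lebesgue (\<Union>n. A n)"
    proof (rule Lim_measure_incseq)
      show "range A \<subseteq> sets lebesgue" using Am by auto
      show "incseq A" unfolding A_def incseq_def by (intro allI impI UN_mono image_mono) auto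
      show "emeasure lebesgue (\<Union>n. A n) \<noteq> \<infinity>"
        unfolding UA using fmeasurableD2[OF G] by (metis infinity_ennreal_def)
    qed
    then have "\<forall>\<^sub>F n in sequentially. measure lebesgue (A n) > measure lebesgue ?G - \<epsilon>"
      unfolding UA using \<open>0 < \<epsilon>\<close> by (intro order_tendstoD) auto
    then obtain n where n: "measure lebesgue (A n) > measure lebesgue ?G - \<epsilon>"
      by (auto simp: eventually_sequentially)
    have "measure lebesgue (?G - A n) = measure lebesgue ?G - measure lebesgue (A n)"
      by (rule measurable_measure_Diff[OF G Am]) (use UA in auto)
    with n show ?thesis
      using that[of "from_nat_into D ` {..n}"] Asub by (auto simp: A_def)
  qed
  \<comment> \<open>\<open>S\<close> need not be measurable, so \<open>B\<close> is a measurable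
    superset of what is left: the null set missed by all selected intervals, together with those
    beyond the finite choice.\<close>
  show thesis
  proof (rule that[of "?K ` F" "(S - ?G) \<union> (?G - (\<Union>i\<in>F. ?K i))"])
    show "finite (?K ` F)" using F by simp
    show "\<exists>u v. u < v \<and> K = {u..v} \<and> Q u v \<and> K \<subseteq> U" if "K \<in> ?K ` F" for K
    proof -
      obtain p where "p \<in> F" "K = ?K p" using \<open>K \<in> ?K ` F\<close> by blast
      then show ?thesis using F(2) D(2) unfolding I_def by blast
    qed
    show "pairwise disjnt (?K ` F)"
    proof (rule pairwiseI)
      fix K L assume "K \<in> ?K ` F" "L \<in> ?K ` F" and ne: "K \<noteq> L"
      then obtain i j where ij: "i \<in> D" "j \<in> D" "K = ?K i" "L = ?K j" using F(2) by (elim imageE) (metis subsetD)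
      then have "i \<noteq> j" using ne by auto
      with D(3) ij show "disjnt K L" unfolding cb pairwise_def by auto
    qed
    have m: "(\<Union>i\<in>F. ?K i) \<in> sets lebesgue"
      using F by (intro sets.finite_UN) auto
    have GF: "?G - (\<Union>i\<in>F. ?K i) \<in> lmeasurable"
      using G m by (intro fmeasurable_Diff) auto
    have N: "S - ?G \<in> null_sets lebesgue"
      using neg by (simp add: negligible_iff_null_sets)
    show "(S - ?G) \<union> (?G - (\<Union>i\<in>F. ?K i)) \<in> lmeasurable"
      using N GF by (intro fmeasurable.Un) (auto simp: fmeasurableI_null_sets)
    have "measure lebesgue ((S - ?G) \<union> (?G - (\<Union>i\<in>F. ?K i))) = measure lebesgue (?G - (\<Union>i\<in>F. ?K i))"
      using N GF by (subst Un_commute) (intro measure_Un_null_set, auto)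
    then show "measure lebesgue ((S - ?G) \<union> (?G - (\<Union>i\<in>F. ?K i))) < \<epsilon>"
      using F(3) by simp
    show "S - \<Union>(?K ` F) \<subseteq> (S - ?G) \<union> (?G - (\<Union>i\<in>F. ?K i))"
      by auto
  qed
qed

lemma division_of_disjoint_intervals:
  assumes "finite C" "\<And>K. K \<in> C \<Longrightarrow> \<exists>u v::real. u < v \<and> K = {u..v}" "pairwise disjnt C"
  shows "C division_of \<Union>C"
proof (rule division_ofI)
  fix K assume "K \<in> C"
  then show "K \<noteq> {}" "\<exists>a b. K = cbox a b" "K \<subseteq> \<Union>C"
    using assms(2)[of K] by auto
next
  fix K L assume "K \<in> C" "L \<in> C" "K \<noteq> L"
  then have "K \<inter> L = {}"
    using assms(3) by (auto simp: pairwise_def disjnt_def)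
  then show "interior K \<inter> interior L = {}"
    using interior_subset by blast
qed (use assms(1) in auto)

lemma division_telescope:
  fixes f :: "real \<Rightarrow> 'a::real_normed_vector"
  assumes "a \<le> b" "q division_of {a..b}"
  shows "(\<Sum>K\<in>q. f (Sup K) - f (Inf K)) = f b - f a"
proof -
  \<comment> \<open>Telescoping is available for tagged divisions; the tags do not enter the sum,
    and the right end point is as good as any.\<close>
  let ?p = "(\<lambda>K. (Sup K, K)) ` q"
  have K: "\<exists>u v. u \<le> v \<and> K = {u..v} \<and> K \<subseteq> {a..b}" if "K \<in> q" for K
    using division_ofD(2,3,4)[OF assms(2) that] by force
  have "?p tagged_division_of {a..b}"
  proof (rule tagged_division_ofI)
    show "finite ?p" using assms(2) by auto
    show "\<Union>{K. \<exists>x. (x,K) \<in> ?p} = {a..b}"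
      using division_ofD(6)[OF assms(2)] by (simp add: image_iff)
  next
    fix x K assume "(x,K) \<in> ?p"
    then have "K \<in> q" "x = Sup K" by auto
    with K[of K] show "x \<in> K" "K \<subseteq> {a..b}" "\<exists>a b. K = cbox a b" by auto
  next
    fix x1 K1 x2 K2 assume "(x1,K1) \<in> ?p" "(x2,K2) \<in> ?p" "(x1,K1) \<noteq> (x2,K2)"
    then show "interior K1 \<inter> interior K2 = {}"
      using division_ofD(5)[OF assms(2), of K1 K2] by auto
  qed
  from additive_tagged_division_1[OF assms(1) this, of f]
  show ?thesis
    by (subst (asm) sum.reindex) (auto simp: inj_on_def)
qed

lemma extend_disjoint_intervals:
  assumes "finite C" "\<And>K. K \<in> C \<Longrightarrow> \<exists>u v::real. u < v \<and> K = {u..v}" "pairwise disjnt C"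
    and "\<Union>C \<subseteq> {a..b}"
  obtains q where "C \<subseteq> q" "q division_of {a..b}"
  using partial_division_extend_interval[of C a b] division_of_disjoint_intervals[OF assms(1-3)]
    assms(4) by auto

lemma measure_disjoint_intervals:
  assumes "finite C" "\<And>K. K \<in> C \<Longrightarrow> \<exists>u v::real. u < v \<and> K = {u..v}" "pairwise disjnt C"
  shows "\<Union>C \<in> lmeasurable" "measure lebesgue (\<Union>C) = (\<Sum>K\<in>C. Sup K - Inf K)"
proof -
  have *: "K \<in> lmeasurable" "measure lebesgue K = Sup K - Inf K" if "K \<in> C" for K
    using assms(2)[OF that] by auto
  show "\<Union>C \<in> lmeasurable"
    using assms(1) * by (intro fmeasurable.finite_Union) auto
  have "measure lebesgue (\<Union>C) = (\<Sum>K\<in>C. measure lebesgue K)"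
    using assms * by (intro measure_negligible_finite_Union)
      (auto simp: pairwise_def disjnt_def)
  then show "measure lebesgue (\<Union>C) = (\<Sum>K\<in>C. Sup K - Inf K)"
    using * by simp
qed

section \<open>Absolutely continuous functions\<close>

text \<open>The body of \<open>abs_cont_on_Icc\<close> for an arbitrary normed target, so that
  complex quasi-derivatives and real functions such as \<open>P\<close> share one theory.\<close>

definition ac_on :: "real \<Rightarrow> real \<Rightarrow> (real \<Rightarrow> 'a::real_normed_vector) \<Rightarrow> bool" where
  "ac_on b c f \<longleftrightarrow>
     (\<forall>\<epsilon>>0. \<exists>\<delta>>0. \<forall>\<D> T. \<D> division_of T \<and> T \<subseteq> {b..c} \<and> (\<Sum>K\<in>\<D>. Sup K - Inf K) < \<delta> \<longrightarrow>
        (\<Sum>K\<in>\<D>. norm (f (Sup K) - f (Inf K))) < \<epsilon>)"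

lemma abs_cont_on_Icc_eq_ac_on: "abs_cont_on_Icc = ac_on"
  by (simp add: fun_eq_iff abs_cont_on_Icc_def ac_on_def)

lemma ac_onD:
  assumes "ac_on b c f" "\<epsilon> > 0"
  obtains \<delta> where "\<delta> > 0" "\<And>\<D>. \<D> division_of \<Union>\<D> \<Longrightarrow> \<Union>\<D> \<subseteq> {b..c} \<Longrightarrow> (\<Sum>K\<in>\<D>. Sup K - Inf K) < \<delta> \<Longrightarrow>
        (\<Sum>K\<in>\<D>. norm (f (Sup K) - f (Inf K))) < \<epsilon>"
  using assms unfolding ac_on_def by metis

lemma division_of_real_elem:
  fixes b c :: real
  assumes "\<D> division_of T" "T \<subseteq> {b..c}" "K \<in> \<D>"
  obtains u v where "u \<le> v" "K = {u..v}" "Inf K = u" "Sup K = v" "b \<le> u" "v \<le> c"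
proof -
  obtain u v where uv: "K = {u..v}" using division_ofD(4)[OF assms(1,3)] by (auto simp: cbox_interval)
  moreover have "K \<noteq> {}" "K \<subseteq> {b..c}" using division_ofD(2,3)[OF assms(1,3)] assms(2) by auto
  ultimately show ?thesis using that[of u v] by auto
qed

text \<open>Extending a finite disjoint family to a division of the whole interval makes absolute
  continuity applicable to the uncovered part.\<close>

lemma ac_on_deriv_zero_imp_eq:
  fixes f :: "real \<Rightarrow> 'a::real_normed_vector"
  assumes ac: "ac_on a b f" and "a \<le> b" and N: "negligible N"
    and der: "\<And>x. a < x \<Longrightarrow> x < b \<Longrightarrow> x \<notin> N \<Longrightarrow> (f has_vector_derivative 0) (at x)"
  shows "f b = f a"
proof -
  \<comment> \<open>The first summand comes from intervals on which the increment is at most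
    \<open>e\<close> times the length, the second from the remainder, which is shorter than
    \<delta>.\<close>
  have "norm (f b - f a) \<le> e * (b - a) + e" if "e > 0" for e
  proof -
    obtain \<delta> where \<delta>: "\<delta> > 0" and ac\<delta>: "\<And>\<D>. \<D> division_of \<Union>\<D> \<Longrightarrow> \<Union>\<D> \<subseteq> {a..b} \<Longrightarrow> (\<Sum>K\<in>\<D>. Sup K - Inf K) < \<delta> \<Longrightarrow>
        (\<Sum>K\<in>\<D>. norm (f (Sup K) - f (Inf K))) < e"
      using ac_onD[OF ac \<open>e > 0\<close>] by blast
    define S where "S = {a<..<b} - N"
    obtain C B where C: "finite C" "\<And>K. K \<in> C \<Longrightarrow> \<exists>u v. u < v \<and> K = {u..v} \<and> norm (f v - f u) \<le> e * (v - u) \<and> K \<subseteq> {a<..<b}"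
      "pairwise disjnt C" "B \<in> lmeasurable" "measure lebesgue B < \<delta>" "S - \<Union>C \<subseteq> B"
    proof (rule Vitali_finite_intervals[of "{a<..<b}" S \<delta> "\<lambda>u v. norm (f v - f u) \<le> e * (v - u)"])
      fix x d :: real assume x: "x \<in> S" and d: "0 < d"
      then have "(f has_derivative (\<lambda>x. 0)) (at x within UNIV)"
        using der[of x] by (auto simp: S_def has_vector_derivative_def)
      then obtain k where k: "k > 0" "\<And>y. norm (y - x) < k \<Longrightarrow> norm (f y - f x) \<le> e * norm (y - x)"
        using \<open>e > 0\<close> unfolding has_derivative_within_alt by (metis UNIV_I diff_zero)
      define h where "h = min d k / 2"
      have h: "0 < h" "h < d" "h < k" using d k by (auto simp: h_def)
      have "norm (f (x + h) - f x) \<le> e * (x + h - x)"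
        using k(2)[of "x + h"] h by simp
      then show "\<exists>u v. u < v \<and> x \<in> {u..v} \<and> v - u < d \<and> norm (f v - f u) \<le> e * (v - u)"
        using h by (intro exI[of _ x] exI[of _ "x + h"]) auto
    qed (use \<delta> in \<open>auto simp: S_def\<close>)
    have Ci: "\<exists>u v. u < v \<and> K = {u..v}" if "K \<in> C" for K
      using C(2)[OF that] by blast
    have "\<Union>C \<subseteq> {a..b}"
      using C(2) by fastforce
    then obtain q where q: "C \<subseteq> q" "q division_of {a..b}"
      using extend_disjoint_intervals[OF C(1) Ci C(3)] by blast
    have fq: "finite q" using q by auto
    note mC = measure_disjoint_intervals[OF C(1) Ci C(3)]
    have "b - a \<le> (\<Sum>K\<in>C. Sup K - Inf K) + measure lebesgue B"
    proof -
      have "{a<..<b} \<subseteq> (\<Union>C \<union> B) \<union> N" using C(6) by (auto simp: S_def)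
      moreover have "N \<in> null_sets lebesgue" using N by (simp add: negligible_iff_null_sets)
      ultimately have "measure lebesgue {a<..<b} \<le> measure lebesgue ((\<Union>C \<union> B) \<union> N)"
        using mC C(4) by (intro measure_mono_fmeasurable fmeasurable.Un) (auto simp: fmeasurableI_null_sets)
      also have "\<dots> = measure lebesgue (\<Union>C \<union> B)"
        using mC C(4) \<open>N \<in> null_sets lebesgue\<close> by (intro measure_Un_null_set) auto
      also have "\<dots> \<le> measure lebesgue (\<Union>C) + measure lebesgue B"
        using mC C(4) by (intro measure_Un_le) auto
      finally show ?thesis using \<open>a \<le> b\<close> mC by simp
    qed
    moreover have "(\<Sum>K\<in>q. Sup K - Inf K) = b - a"
      using division_telescope[OF \<open>a \<le> b\<close> q(2), of "\<lambda>x. x"] .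
    moreover have "(\<Sum>K\<in>q. Sup K - Inf K) = (\<Sum>K\<in>q - C. Sup K - Inf K) + (\<Sum>K\<in>C. Sup K - Inf K)"
      using sum.subset_diff[OF q(1) fq] .
    ultimately have small: "(\<Sum>K\<in>q - C. Sup K - Inf K) < \<delta>"
      using C(5) by linarith
    have qC: "(q - C) division_of \<Union>(q - C)"
      using q(2) division_of_subset by blast
    have "\<Union>(q - C) \<subseteq> {a..b}" using division_ofD(6)[OF q(2)] by auto
    then have 1: "(\<Sum>K\<in>q - C. norm (f (Sup K) - f (Inf K))) < e"
      using ac\<delta>[OF qC] small by blast
    have "(\<Sum>K\<in>C. norm (f (Sup K) - f (Inf K))) \<le> (\<Sum>K\<in>C. e * (Sup K - Inf K))"
    proof (rule sum_mono)
      fix K assume "K \<in> C"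
      with C(2)[OF this] show "norm (f (Sup K) - f (Inf K)) \<le> e * (Sup K - Inf K)" by auto
    qed
    also have "\<dots> = e * measure lebesgue (\<Union>C)" using mC by (simp add: sum_distrib_left)
    also have "\<dots> \<le> e * (b - a)"
    proof -
      have "measure lebesgue (\<Union>C) \<le> measure lebesgue {a..b}"
        using \<open>\<Union>C \<subseteq> {a..b}\<close> mC by (intro measure_mono_fmeasurable) auto
      then show ?thesis using \<open>e > 0\<close> \<open>a \<le> b\<close> by simp
    qed
    finally have 2: "(\<Sum>K\<in>C. norm (f (Sup K) - f (Inf K))) \<le> e * (b - a)" .
    have "norm (f b - f a) = norm (\<Sum>K\<in>q. f (Sup K) - f (Inf K))"
      using division_telescope[OF \<open>a \<le> b\<close> q(2), of f] by simp
    also have "\<dots> \<le> (\<Sum>K\<in>q. norm (f (Sup K) - f (Inf K)))" by (rule norm_sum)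
    also have "\<dots> = (\<Sum>K\<in>q - C. norm (f (Sup K) - f (Inf K))) + (\<Sum>K\<in>C. norm (f (Sup K) - f (Inf K)))"
      using sum.subset_diff[OF q(1) fq] .
    finally show ?thesis using 1 2 by linarith
  qed
  note * = this
  have "norm (f b - f a) \<le> 0"
  proof (rule ccontr)
    assume "\<not> norm (f b - f a) \<le> 0"
    then have p: "norm (f b - f a) > 0" by simp
    define e where "e = norm (f b - f a) / (2 * (b - a + 1))"
    have "e > 0" using p \<open>a \<le> b\<close> by (simp add: e_def)
    have "e * (b - a) + e = e * (b - a + 1)" by (simp add: algebra_simps)
    also have "\<dots> = norm (f b - f a) / 2" using \<open>a \<le> b\<close> by (simp add: e_def field_simps)
    finally show False using *[OF \<open>e > 0\<close>] p by linarith
  qed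
  then show ?thesis by simp
qed

text \<open>Sums, products, linear images and Lipschitz functions are all handled through this
  estimate of increments; two dominating functions are what a product requires, and a zero constant
  switches one of them off.\<close>

lemma ac_on_comparison:
  assumes "ac_on a b f" "ac_on a b h"
    and le: "\<And>x y. x \<in> {a..b} \<Longrightarrow> y \<in> {a..b} \<Longrightarrow> norm (g x - g y) \<le> L * norm (f x - f y) + M * norm (h x - h y)"
  shows "ac_on a b g"
  unfolding ac_on_def
proof (intro allI impI)
  fix e :: real assume "e > 0"
  \<comment> \<open>\<open>L\<close> and \<open>M\<close> may vanish or be negative; positive
    majorants can be divided by when the tolerances are chosen.\<close>
  define L' where "L' = \<bar>L\<bar> + 1"
  define M' where "M' = \<bar>M\<bar> + 1"
  have pos: "L' > 0" "M' > 0" by (auto simp: L'_def M'_def)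
  have le': "norm (g x - g y) \<le> L' * norm (f x - f y) + M' * norm (h x - h y)"
    if "x \<in> {a..b}" "y \<in> {a..b}" for x y
  proof -
    have "L * norm (f x - f y) \<le> L' * norm (f x - f y)" "M * norm (h x - h y) \<le> M' * norm (h x - h y)"
      by (intro mult_right_mono; simp add: L'_def M'_def)+
    with le[OF that] show ?thesis by linarith
  qed
  have e2: "e / (2 * L') > 0" "e / (2 * M') > 0" using pos \<open>e > 0\<close> by auto
  obtain d1 where d1: "d1 > 0" "\<And>\<D>. \<D> division_of \<Union>\<D> \<Longrightarrow> \<Union>\<D> \<subseteq> {a..b} \<Longrightarrow> (\<Sum>K\<in>\<D>. Sup K - Inf K) < d1 \<Longrightarrow>
        (\<Sum>K\<in>\<D>. norm (f (Sup K) - f (Inf K))) < e / (2 * L')"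
    using ac_onD[OF assms(1) e2(1)] by blast
  obtain d2 where d2: "d2 > 0" "\<And>\<D>. \<D> division_of \<Union>\<D> \<Longrightarrow> \<Union>\<D> \<subseteq> {a..b} \<Longrightarrow> (\<Sum>K\<in>\<D>. Sup K - Inf K) < d2 \<Longrightarrow>
        (\<Sum>K\<in>\<D>. norm (h (Sup K) - h (Inf K))) < e / (2 * M')"
    using ac_onD[OF assms(2) e2(2)] by blast
  show "\<exists>\<delta>>0. \<forall>\<D> T. \<D> division_of T \<and> T \<subseteq> {a..b} \<and> (\<Sum>K\<in>\<D>. Sup K - Inf K) < \<delta> \<longrightarrow>
           (\<Sum>K\<in>\<D>. norm (g (Sup K) - g (Inf K))) < e"
  proof (intro exI[of _ "min d1 d2"] conjI allI impI)
    show "min d1 d2 > 0" using d1 d2 by simp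
    fix \<D> T assume *: "\<D> division_of T \<and> T \<subseteq> {a..b} \<and> (\<Sum>K\<in>\<D>. Sup K - Inf K) < min d1 d2"
    then have T: "T = \<Union>\<D>" using division_ofD(6) by blast
    have "(\<Sum>K\<in>\<D>. norm (g (Sup K) - g (Inf K))) \<le>
        (\<Sum>K\<in>\<D>. L' * norm (f (Sup K) - f (Inf K)) + M' * norm (h (Sup K) - h (Inf K)))"
    proof (rule sum_mono)
      fix K assume "K \<in> \<D>"
      then obtain u v where "u \<le> v" "Inf K = u" "Sup K = v" "a \<le> u" "v \<le> b"
        using division_of_real_elem[OF conjunct1[OF *] conjunct1[OF conjunct2[OF *]] \<open>K \<in> \<D>\<close>] by blast
      then show "norm (g (Sup K) - g (Inf K)) \<le> L' * norm (f (Sup K) - f (Inf K)) + M' * norm (h (Sup K) - h (Inf K))"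
        by (intro le') auto
    qed
    also have "\<dots> = L' * (\<Sum>K\<in>\<D>. norm (f (Sup K) - f (Inf K))) + M' * (\<Sum>K\<in>\<D>. norm (h (Sup K) - h (Inf K)))"
      by (simp add: sum.distrib sum_distrib_left)
    also have "\<dots> < L' * (e / (2 * L')) + M' * (e / (2 * M'))"
      using d1(2)[of \<D>] d2(2)[of \<D>] * pos unfolding T by (intro add_strict_mono mult_strict_left_mono) auto
    also have "\<dots> = e" using pos by simp
    finally show "(\<Sum>K\<in>\<D>. norm (g (Sup K) - g (Inf K))) < e" .
  qed
qed

lemma ac_on_id: "ac_on a b (\<lambda>x::real. x)"
  unfolding ac_on_def
proof (intro allI impI)
  fix e :: real assume "e > 0"
  have "(\<Sum>K\<in>\<D>. norm (Sup K - Inf K)) = (\<Sum>K\<in>\<D>. Sup K - Inf K)" if "\<D> division_of T" "T \<subseteq> {a..b}" for \<D> T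
  proof (rule sum.cong)
    fix K assume "K \<in> \<D>"
    then obtain u v where "u \<le> v" "Inf K = u" "Sup K = v"
      using division_of_real_elem[of \<D> T a b K] \<open>\<D> division_of T\<close> \<open>T \<subseteq> {a..b}\<close> by blast
    then show "norm (Sup K - Inf K) = Sup K - Inf K" by simp
  qed simp
  with \<open>e > 0\<close> show "\<exists>\<delta>>0. \<forall>\<D> T. \<D> division_of T \<and> T \<subseteq> {a..b} \<and> (\<Sum>K\<in>\<D>. Sup K - Inf K) < \<delta> \<longrightarrow>
           (\<Sum>K\<in>\<D>. norm (Sup K - Inf K)) < e"
    by (intro exI[of _ e]) auto
qed

lemma ac_on_Lipschitz:
  assumes "\<And>x y. x \<in> {a..b} \<Longrightarrow> y \<in> {a..b} \<Longrightarrow> norm (g x - g y) \<le> L * \<bar>x - y\<bar>"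
  shows "ac_on a b g"
  using assms by (intro ac_on_comparison[OF ac_on_id ac_on_id, of a b g L 0]) auto

lemma ac_on_imp_continuous_on:
  assumes "ac_on a b f"
  shows "continuous_on {a..b} f"
  unfolding continuous_on_iff
proof (intro ballI allI impI)
  fix x e :: real assume x: "x \<in> {a..b}" and "e > 0"
  obtain d where d: "d > 0" "\<And>\<D>. \<D> division_of \<Union>\<D> \<Longrightarrow> \<Union>\<D> \<subseteq> {a..b} \<Longrightarrow> (\<Sum>K\<in>\<D>. Sup K - Inf K) < d \<Longrightarrow>
        (\<Sum>K\<in>\<D>. norm (f (Sup K) - f (Inf K))) < e"
    using ac_onD[OF assms \<open>e > 0\<close>] by blast
  have main: "norm (f v - f u) < e" if "u \<le> v" "u \<in> {a..b}" "v \<in> {a..b}" "v - u < d" for u v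
  proof -
    have "{{u..v}} division_of \<Union>{{u..v}}"
      using division_of_self[of u v] that(1) by simp
    from d(2)[OF this] that show ?thesis by auto
  qed
  show "\<exists>d>0. \<forall>x'\<in>{a..b}. dist x' x < d \<longrightarrow> dist (f x') (f x) < e"
  proof (intro exI[of _ d] conjI ballI impI)
    fix y assume y: "y \<in> {a..b}" "dist y x < d"
    show "dist (f y) (f x) < e"
    proof (cases "x \<le> y")
      case True
      with main[of x y] x y show ?thesis by (auto simp: dist_norm)
    next
      case False
      with main[of y x] x y show ?thesis by (auto simp: dist_norm norm_minus_commute)
    qed
  qed (use d in auto)
qed

lemma ac_on_mult:
  fixes f g :: "real \<Rightarrow> 'a::real_normed_algebra"
  assumes "ac_on a b f" "ac_on a b g"
  shows "ac_on a b (\<lambda>x. f x * g x)"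
proof -
  have "bounded (f ` {a..b})" "bounded (g ` {a..b})"
    using assms[THEN ac_on_imp_continuous_on]
    by (meson compact_Icc compact_continuous_image compact_imp_bounded)+
  then obtain F G where F: "\<And>x. x \<in> {a..b} \<Longrightarrow> norm (f x) \<le> F" and G: "\<And>x. x \<in> {a..b} \<Longrightarrow> norm (g x) \<le> G"
    unfolding bounded_iff by (meson imageI)
  show ?thesis
  proof (rule ac_on_comparison[OF assms, of _ G F])
    fix x y assume xy: "x \<in> {a..b}" "y \<in> {a..b}"
    have "f x * g x - f y * g y = (f x - f y) * g x + f y * (g x - g y)" by (simp add: algebra_simps)
    then have "norm (f x * g x - f y * g y) \<le> norm (f x - f y) * norm (g x) + norm (f y) * norm (g x - g y)"
      by (metis norm_triangle_mono norm_mult_ineq)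
    also have "\<dots> \<le> norm (f x - f y) * G + F * norm (g x - g y)"
      using F[OF xy(2)] G[OF xy(1)] by (intro add_mono mult_left_mono mult_right_mono) auto
    finally show "norm (f x * g x - f y * g y) \<le> G * norm (f x - f y) + F * norm (g x - g y)"
      by (simp add: mult.commute)
  qed
qed

lemma ac_on_add:
  assumes "ac_on a b f" "ac_on a b g"
  shows "ac_on a b (\<lambda>x. f x + g x)"
  by (rule ac_on_comparison[OF assms, of _ 1 1])
     (metis (no_types, lifting) add_diff_add mult_1 norm_triangle_ineq)

lemma ac_on_bounded_linear:
  assumes "bounded_linear T" "ac_on a b f"
  shows "ac_on a b (\<lambda>x. T (f x))"
proof -
  obtain K where K: "\<And>x. norm (T x) \<le> norm x * K"
    using bounded_linear.bounded[OF assms(1)] by blast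
  show ?thesis
  proof (rule ac_on_comparison[OF assms(2) assms(2), of _ K 0])
    fix x y
    have "T (f x) - T (f y) = T (f x - f y)" by (simp add: assms(1) bounded_linear.linear linear_diff)
    then show "norm (T (f x) - T (f y)) \<le> K * norm (f x - f y) + 0 * norm (f x - f y)"
      using K[of "f x - f y"] by (simp add: mult.commute)
  qed
qed

lemma ac_on_diff:
  assumes "ac_on a b f" "ac_on a b g"
  shows "ac_on a b (\<lambda>x. f x - g x)"
  using ac_on_add[OF assms(1) ac_on_bounded_linear[OF bounded_linear_minus[OF bounded_linear_ident] assms(2)]]
  by simp

lemma ac_on_C1:
  fixes f :: "real \<Rightarrow> 'a::real_normed_vector"
  assumes "\<And>x. x \<in> {a..b} \<Longrightarrow> (f has_vector_derivative f' x) (at x within {a..b})"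
    and "continuous_on {a..b} f'"
  shows "ac_on a b f"
proof -
  have "bounded (f' ` {a..b})"
    using assms(2) by (meson compact_Icc compact_continuous_image compact_imp_bounded)
  then obtain F where F: "\<And>x. x \<in> {a..b} \<Longrightarrow> norm (f' x) \<le> F"
    unfolding bounded_iff by (meson imageI)
  show ?thesis
  proof (rule ac_on_Lipschitz)
    fix x y assume xy: "x \<in> {a..b}" "y \<in> {a..b}"
    show "norm (f x - f y) \<le> F * \<bar>x - y\<bar>"
    proof -
      have "norm (f x - f y) \<le> F * norm (x - y)"
      proof (rule differentiable_bound[of "{a..b}" f "\<lambda>x h. h *\<^sub>R f' x"])
        show "(f has_derivative (\<lambda>h. h *\<^sub>R f' z)) (at z within {a..b})" if "z \<in> {a..b}" for z
          using assms(1)[OF that] by (simp add: has_vector_derivative_def)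
        show "onorm (\<lambda>h. h *\<^sub>R f' z) \<le> F" if "z \<in> {a..b}" for z
          using F[OF that] by (intro onorm_le) (simp add: mult.commute[of _ "norm (f' z)"] mult_right_mono)
      qed (use xy in auto)
      then show ?thesis by simp
    qed
  qed
qed

text \<open>Truncation at height \<open>n\<close> changes the integral of the absolute value of
  \<open>U\<close> by less than \<open>e/2\<close>, and the truncated part contributes at most
  \<open>n\<close> times the total length of the intervals.\<close>

lemma ac_on_indefinite_integral:
  fixes U :: "real \<Rightarrow> real"
  assumes "U absolutely_integrable_on {a..b}"
  shows "ac_on a b (\<lambda>x. integral {a..x} U)"
  unfolding ac_on_def
proof (intro allI impI)
  fix e :: real assume "e > 0"
  let ?A = "\<lambda>x. \<bar>U x\<bar>"
  have Ui: "U integrable_on {a..b}" and Aa: "?A absolutely_integrable_on {a..b}"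
    using assms absolutely_integrable_norm[OF assms] by (auto simp: absolutely_integrable_on_def)
  then have A: "?A integrable_on {a..b}" by (auto simp: absolutely_integrable_on_def)
  define T where "T n x = min (?A x) (real n)" for n x
  have "(\<lambda>x. real n) absolutely_integrable_on {a..b}" for n
    by (intro absolutely_integrable_continuous_real continuous_intros)
  then have T: "T n integrable_on {a..b}" for n
    using absolutely_integrable_min_1[OF Aa, of "\<lambda>x. real n"]
    by (auto simp: T_def[abs_def] absolutely_integrable_on_def)
  have lim: "(\<lambda>n. integral {a..b} (T n)) \<longlonglongrightarrow> integral {a..b} ?A"
  proof (rule dominated_convergence(2)[where h = ?A])
    fix x assume "x \<in> {a..b}"
    obtain N where "?A x \<le> real N" using real_arch_simple by blast
    then have "\<forall>\<^sub>F n in sequentially. T n x = ?A x"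
      by (intro eventually_sequentiallyI[of N]) (auto simp: T_def min_def)
    then show "(\<lambda>n. T n x) \<longlonglongrightarrow> ?A x" by (rule tendsto_eventually)
  qed (use T A in \<open>auto simp: T_def\<close>)
  then obtain n where n: "integral {a..b} ?A - integral {a..b} (T n) < e/2"
  proof -
    have "\<forall>\<^sub>F n in sequentially. integral {a..b} ?A - e/2 < integral {a..b} (T n)"
      using order_tendstoD(1)[OF lim, of "integral {a..b} ?A - e/2"] \<open>e > 0\<close> by simp
    then obtain n where "integral {a..b} ?A - e/2 < integral {a..b} (T n)"
      using eventually_happens'[of sequentially] by auto
    then show ?thesis using that[of n] by linarith
  qed
  let ?G = "\<lambda>x. ?A x - T n x"
  have G: "?G integrable_on {a..b}" using A T by (rule integrable_diff)
  have G0: "?G x \<ge> 0" for x by (auto simp: T_def)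
  show "\<exists>\<delta>>0. \<forall>\<D> T. \<D> division_of T \<and> T \<subseteq> {a..b} \<and> (\<Sum>K\<in>\<D>. Sup K - Inf K) < \<delta> \<longrightarrow>
           (\<Sum>K\<in>\<D>. norm (integral {a..Sup K} U - integral {a..Inf K} U)) < e"
  proof (intro exI[of _ "e / (2 * (real n + 1))"] conjI allI impI)
    show "e / (2 * (real n + 1)) > 0" using \<open>e > 0\<close> by simp
    fix \<D> S assume *: "\<D> division_of S \<and> S \<subseteq> {a..b} \<and> (\<Sum>K\<in>\<D>. Sup K - Inf K) < e / (2 * (real n + 1))"
    have "norm (integral {a..Sup K} U - integral {a..Inf K} U) \<le> real n * (Sup K - Inf K) + integral K ?G" if "K \<in> \<D>" for K
    proof -
      obtain u v where uv: "u \<le> v" "K = {u..v}" "Inf K = u" "Sup K = v" "a \<le> u" "v \<le> b"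
        using division_of_real_elem[OF conjunct1[OF *] conjunct1[OF conjunct2[OF *]] \<open>K \<in> \<D>\<close>] by blast
      have sub: "{u..v} \<subseteq> {a..b}" "{a..v} \<subseteq> {a..b}" using uv by auto
      have i: "U integrable_on {u..v}" "?A integrable_on {u..v}" "T n integrable_on {u..v}" "?G integrable_on {u..v}" "U integrable_on {a..v}"
        using integrable_subinterval_real[OF Ui] integrable_subinterval_real[OF A] integrable_subinterval_real[OF T]
          integrable_subinterval_real[OF G] sub by auto
      have "integral {a..v} U - integral {a..u} U = integral {u..v} U"
        using Henstock_Kurzweil_Integration.integral_combine[of a u v U] uv i by simp
      then have "norm (integral {a..v} U - integral {a..u} U) \<le> integral {u..v} ?A"
        using integral_norm_bound_integral[OF i(1,2)] by simp
      also have "\<dots> = integral {u..v} (T n) + integral {u..v} ?G"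
        using Henstock_Kurzweil_Integration.integral_add[OF i(3,4)] by simp
      also have "integral {u..v} (T n) \<le> integral {u..v} (\<lambda>x. real n)"
        using i by (intro integral_le) (auto simp: T_def)
      also have "\<dots> = real n * (v - u)" using uv by simp
      finally show ?thesis using uv by simp
    qed
    then have "(\<Sum>K\<in>\<D>. norm (integral {a..Sup K} U - integral {a..Inf K} U)) \<le>
        (\<Sum>K\<in>\<D>. real n * (Sup K - Inf K) + integral K ?G)"
      by (rule sum_mono)
    also have "\<dots> = real n * (\<Sum>K\<in>\<D>. Sup K - Inf K) + (\<Sum>K\<in>\<D>. integral K ?G)"
      by (simp add: sum.distrib sum_distrib_left)
    also have "(\<Sum>K\<in>\<D>. integral K ?G) \<le> integral {a..b} ?G"
    proof -
      have S: "?G integrable_on S"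
        using * G by (meson integrable_on_subdivision)
      have "integral S ?G = (\<Sum>K\<in>\<D>. integral K ?G)"
        using integral_combine_division_topdown[OF S] * by blast
      moreover have "integral S ?G \<le> integral {a..b} ?G"
        using * S G G0 by (intro integral_subset_le) auto
      ultimately show ?thesis by simp
    qed
    also have "\<dots> = integral {a..b} ?A - integral {a..b} (T n)"
      using Henstock_Kurzweil_Integration.integral_diff[OF A T] .
    also have "\<dots> < e/2" by (rule n)
    also have "real n * (\<Sum>K\<in>\<D>. Sup K - Inf K) \<le> real n * (e / (2 * (real n + 1)))"
      using * by (intro mult_left_mono) auto
    also have "\<dots> \<le> e / 2" using \<open>e > 0\<close> by (simp add: field_simps)
    finally show "(\<Sum>K\<in>\<D>. norm (integral {a..Sup K} U - integral {a..Inf K} U)) < e" by simp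
  qed
qed

section \<open>Differentiability almost everywhere\<close>

lemma DERIV_from_intervals:
  fixes F :: "real \<Rightarrow> real"
  assumes "\<And>n. \<exists>d>0. \<forall>u v. u < v \<and> (u = x \<or> v = x) \<and> v - u < d \<longrightarrow>
      \<bar>F v - F u - (v - u) * D\<bar> \<le> (v - u) / real (Suc n)"
  shows "(F has_real_derivative D) (at x)"
  unfolding DERIV_def LIM_eq
proof (intro allI impI)
  fix e :: real assume "e > 0"
  then obtain n where n: "1 / real (Suc n) < e" using nat_approx_posE by blast
  obtain d where d: "d > 0" "\<forall>u v. u < v \<and> (u = x \<or> v = x) \<and> v - u < d \<longrightarrow>
      \<bar>F v - F u - (v - u) * D\<bar> \<le> (v - u) / real (Suc n)"
    using assms by blast
  show "\<exists>s>0. \<forall>h. h \<noteq> 0 \<and> norm (h - 0) < s \<longrightarrow> norm ((F (x + h) - F x) / h - D) < e"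
  proof (intro exI[of _ d] conjI allI impI)
    fix h :: real assume h: "h \<noteq> 0 \<and> norm (h - 0) < d"
    have "\<bar>F (x + h) - F x - h * D\<bar> \<le> \<bar>h\<bar> / real (Suc n)"
    proof (cases "h > 0")
      case True
      with d(2)[rule_format, of x "x + h"] h show ?thesis by auto
    next
      case False
      with d(2)[rule_format, of "x + h" x] h show ?thesis by (auto simp: abs_minus_commute algebra_simps)
    qed
    then have "\<bar>F (x + h) - F x - h * D\<bar> / \<bar>h\<bar> \<le> 1 / real (Suc n)"
      using h by (simp add: field_simps)
    moreover have "(F (x + h) - F x) / h - D = (F (x + h) - F x - h * D) / h"
      using h by (simp add: field_simps)
    ultimately show "norm ((F (x + h) - F x) / h - D) < e"
      using n by (simp add: abs_divide)
  qed (use d in auto)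
qed

text \<open>At a point of \<open>E n\<close> arbitrarily short intervals deviate from the slope
  \<open>U x\<close> by more than \<open>1 / Suc n\<close> times their length. A disjoint gauge-fine
  family of them is a tagged partial division, so the Henstock lemma bounds the sum of the
  deviations and thereby the total length.\<close>

lemma indefinite_integral_DERIV_ae:
  fixes U :: "real \<Rightarrow> real"
  assumes U: "U integrable_on {a..b}"
  shows "negligible {x \<in> {a<..<b}. \<not> ((\<lambda>x. integral {a..x} U) has_real_derivative U x) (at x)}"
proof -
  let ?F = "\<lambda>x. integral {a..x} U"
  define E where "E n = {x \<in> {a<..<b}. \<forall>d>0. \<exists>u v. u < v \<and> (u = x \<or> v = x) \<and> v - u < d \<and>
      \<bar>?F v - ?F u - (v - u) * U x\<bar> > (v - u) / real (Suc n)}" for n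
  have "negligible (E n)" for n
    unfolding negligible_outer_le
  proof (intro allI impI)
    fix e :: real assume "e > 0"
    \<comment> \<open>Chosen so that, after division by the gap \<open>1 / Suc n\<close>, the
      selected intervals have total length below \<open>e/2\<close>.\<close>
    define e' where "e' = e / (2 * real (Suc n))"
    have "e' > 0" using \<open>e > 0\<close> by (simp add: e'_def)
    have Ub: "U integrable_on cbox a b" using U by simp
    obtain g where g: "gauge g" "\<And>p. \<lbrakk>p tagged_partial_division_of (cbox a b); g fine p\<rbrakk> \<Longrightarrow>
             (\<Sum>(x,k)\<in>p. norm (measure lborel k *\<^sub>R U x - integral k U)) < e'"
      using Henstock_lemma[OF Ub \<open>e' > 0\<close>] by blast
    \<comment> \<open>The point at which gauge and slope are taken is recorded in \<open>Q\<close>,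
      so that it can serve as the tag once the intervals have been selected.\<close>
    define Q where "Q u v = (\<exists>x\<in>{u..v}. {u..v} \<subseteq> g x \<and> \<bar>?F v - ?F u - (v - u) * U x\<bar> > (v - u) / real (Suc n))" for u v
    obtain C B where C: "finite C" "\<And>K. K \<in> C \<Longrightarrow> \<exists>u v. u < v \<and> K = {u..v} \<and> Q u v \<and> K \<subseteq> {a<..<b}"
      "pairwise disjnt C" "B \<in> lmeasurable" "measure lebesgue B < e/2" "E n - \<Union>C \<subseteq> B"
    proof (rule Vitali_finite_intervals[of "{a<..<b}" "E n" "e/2" Q])
      fix x d :: real assume x: "x \<in> E n" and "0 < d"
      have "open (g x)" "x \<in> g x" using g(1) by (auto simp: gauge_def)
      then obtain k where k: "k > 0" "ball x k \<subseteq> g x" by (meson open_contains_ball)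
      have "min d k > 0" using \<open>0 < d\<close> k by simp
      then obtain u v where uv: "u < v" "u = x \<or> v = x" "v - u < min d k"
         "\<bar>?F v - ?F u - (v - u) * U x\<bar> > (v - u) / real (Suc n)"
        using x unfolding E_def by blast
      have "{u..v} \<subseteq> ball x k" using uv by (auto simp: dist_real_def)
      then have "{u..v} \<subseteq> g x" "x \<in> {u..v}" using uv k by auto
      then have "Q u v" using uv unfolding Q_def by blast
      then show "\<exists>u v. u < v \<and> x \<in> {u..v} \<and> v - u < d \<and> Q u v"
        using uv by (intro exI[of _ u] exI[of _ v]) auto
    qed (use \<open>e > 0\<close> in \<open>auto simp: E_def\<close>)
    have Ci: "\<exists>u v. u < v \<and> K = {u..v}" if "K \<in> C" for K
      using C(2)[OF that] by blast
    note mC = measure_disjoint_intervals[OF C(1) Ci C(3)]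
    have "\<exists>x. x \<in> K \<and> K \<subseteq> g x \<and> norm (measure lborel K *\<^sub>R U x - integral K U) \<ge> (Sup K - Inf K) / real (Suc n)" if K: "K \<in> C" for K
    proof -
      obtain u v where uv: "u < v" "K = {u..v}" "Q u v" "K \<subseteq> {a<..<b}" using C(2)[OF K] by blast
      then have ab: "a \<le> u" "v \<le> b"
        using subsetD[OF uv(4), of u] subsetD[OF uv(4), of v] by auto
      then have "?F v - ?F u = integral {u..v} U"
        using Henstock_Kurzweil_Integration.integral_combine[of a u v U] uv integrable_subinterval_real[OF U, of a v] by simp
      with uv show ?thesis by (auto simp: Q_def abs_minus_commute)
    qed
    then obtain t where t: "\<And>K. K \<in> C \<Longrightarrow> t K \<in> K \<and> K \<subseteq> g (t K) \<and> norm (measure lborel K *\<^sub>R U (t K) - integral K U) \<ge> (Sup K - Inf K) / real (Suc n)"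
      by metis
    define p where "p = (\<lambda>K. (t K, K)) ` C"
    have "p tagged_partial_division_of cbox a b"
      unfolding tagged_partial_division_of_def
    proof (intro conjI allI impI)
      show "finite p" using C(1) by (simp add: p_def)
      fix x K assume "(x,K) \<in> p"
      then have K: "K \<in> C" "x = t K" by (auto simp: p_def)
      show "x \<in> K" using t K by blast
      show "\<exists>a b. K = cbox a b" using Ci[OF K(1)] by (metis box_real(2))
      have "K \<subseteq> {a<..<b}" using C(2)[OF K(1)] by blast
      then show "K \<subseteq> cbox a b" by (rule order_trans) auto
    next
      fix x1 K1 x2 K2 assume "(x1,K1) \<in> p \<and> (x2,K2) \<in> p \<and> (x1,K1) \<noteq> (x2,K2)"
      then have "K1 \<in> C" "K2 \<in> C" "K1 \<noteq> K2" by (auto simp: p_def)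
      then have "K1 \<inter> K2 = {}" using C(3) by (auto simp: pairwise_def disjnt_def)
      then show "interior K1 \<inter> interior K2 = {}" using interior_subset by blast
    qed
    moreover have "g fine p" using t by (auto simp: fine_def p_def)
    ultimately have "(\<Sum>(x,k)\<in>p. norm (measure lborel k *\<^sub>R U x - integral k U)) < e'"
      using g(2) by blast
    also have "(\<Sum>(x,k)\<in>p. norm (measure lborel k *\<^sub>R U x - integral k U)) = (\<Sum>K\<in>C. norm (measure lborel K *\<^sub>R U (t K) - integral K U))"
      unfolding p_def by (subst sum.reindex) (auto simp: inj_on_def)
    finally have "(\<Sum>K\<in>C. (Sup K - Inf K) / real (Suc n)) < e'"
      using sum_mono[of C "\<lambda>K. (Sup K - Inf K) / real (Suc n)" "\<lambda>K. norm (measure lborel K *\<^sub>R U (t K) - integral K U)"] t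
      by force
    then have "measure lebesgue (\<Union>C) / real (Suc n) < e'"
      using mC by (simp add: sum_divide_distrib)
    then have "measure lebesgue (\<Union>C) < e' * real (Suc n)"
      by (simp only: pos_divide_less_eq of_nat_0_less_iff zero_less_Suc)
    also have "\<dots> = e/2" by (simp add: e'_def del: of_nat_Suc)
    finally have "measure lebesgue (\<Union>C) < e/2" .
    moreover have "measure lebesgue (\<Union>C \<union> B) \<le> measure lebesgue (\<Union>C) + measure lebesgue B"
      using mC C(4) by (intro measure_Un_le) auto
    ultimately show "\<exists>T. E n \<subseteq> T \<and> T \<in> lmeasurable \<and> measure lebesgue T \<le> e"
      using C mC by (intro exI[of _ "\<Union>C \<union> B"] conjI) (auto intro!: fmeasurable.Un)
  qed
  then have "negligible (\<Union>n. E n)"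
    by (intro negligible_countable_Union) auto
  moreover have "{x \<in> {a<..<b}. \<not> (?F has_real_derivative U x) (at x)} \<subseteq> (\<Union>n. E n)"
  proof
    fix x assume x: "x \<in> {x \<in> {a<..<b}. \<not> (?F has_real_derivative U x) (at x)}"
    show "x \<in> (\<Union>n. E n)"
    proof (rule ccontr)
      assume *: "x \<notin> (\<Union>n. E n)"
      have "\<exists>d>0. \<forall>u v. u < v \<and> (u = x \<or> v = x) \<and> v - u < d \<longrightarrow>
        \<bar>?F v - ?F u - (v - u) * U x\<bar> \<le> (v - u) / real (Suc n)" for n
      proof -
        have "x \<notin> E n" using * by blast
        then show ?thesis using x unfolding E_def mem_Collect_eq by (meson not_le)
      qed
      from DERIV_from_intervals[OF this] x show False by blast
    qed
  qed
  ultimately show ?thesis by (rule negligible_subset)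
qed


text \<open>Disjoint intervals inside a window of length \<open>\<delta>/2\<close> have total
  increment below 1 by absolute continuity; if each is steeper than \<open>M\<close>, their total
  length is below \<open>1/M\<close>. Letting \<open>M\<close> grow makes the exceptional set
  negligible in every window, and negligibility is a local property.\<close>

lemma ac_on_slopes_bounded_ae:
  fixes w :: "real \<Rightarrow> real"
  assumes ac: "ac_on a b w"
  shows "negligible {x \<in> {a<..<b}. \<forall>M. \<forall>d>0. \<exists>u v. u < v \<and> x \<in> {u..v} \<and> v - u < d \<and> \<bar>w v - w u\<bar> > M * (v - u)}"
    (is "negligible ?E")
proof -
  obtain \<delta> where \<delta>: "\<delta> > 0" and ac\<delta>: "\<And>\<D>. \<D> division_of \<Union>\<D> \<Longrightarrow> \<Union>\<D> \<subseteq> {a..b} \<Longrightarrow> (\<Sum>K\<in>\<D>. Sup K - Inf K) < \<delta> \<Longrightarrow>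
        (\<Sum>K\<in>\<D>. norm (w (Sup K) - w (Inf K))) < 1"
    using ac_onD[OF ac zero_less_one] by blast
  have loc: "negligible (?E \<inter> {c<..<c+\<delta>/2})" for c
    unfolding negligible_outer_le
  proof (intro allI impI)
    fix e :: real assume "e > 0"
    let ?U = "{a<..<b} \<inter> {c<..<c+\<delta>/2}"
    define M where "M = 2 / e"
    have M: "M > 0" using \<open>e > 0\<close> by (simp add: M_def)
    obtain C B where C: "finite C" "\<And>K. K \<in> C \<Longrightarrow> \<exists>u v. u < v \<and> K = {u..v} \<and> \<bar>w v - w u\<bar> > M * (v - u) \<and> K \<subseteq> ?U"
      "pairwise disjnt C" "B \<in> lmeasurable" "measure lebesgue B < e/2" "(?E \<inter> {c<..<c+\<delta>/2}) - \<Union>C \<subseteq> B"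
    proof (rule Vitali_finite_intervals[of ?U "?E \<inter> {c<..<c+\<delta>/2}" "e/2" "\<lambda>u v. \<bar>w v - w u\<bar> > M * (v - u)"])
      show "?U \<in> lmeasurable" by (simp add: fmeasurable.Int)
    qed (use \<open>e > 0\<close> in auto)
    have Ci: "\<exists>u v. u < v \<and> K = {u..v}" if "K \<in> C" for K
      using C(2)[OF that] by blast
    note mC = measure_disjoint_intervals[OF C(1) Ci C(3)]
    have sub: "\<Union>C \<subseteq> {a<..<b}" "\<Union>C \<subseteq> {c<..<c+\<delta>/2}" using C(2) by blast+
    have "measure lebesgue (\<Union>C) \<le> measure lebesgue {c<..<c+\<delta>/2}"
      using sub mC by (intro measure_mono_fmeasurable) auto
    also have "\<dots> < \<delta>" using \<delta> by simp
    finally have small: "(\<Sum>K\<in>C. Sup K - Inf K) < \<delta>" using mC by simp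
    have "\<Union>C \<subseteq> {a..b}" using sub(1) by (rule order_trans) auto
    from ac\<delta>[OF division_of_disjoint_intervals[OF C(1) Ci C(3)] this small]
    have lt1: "(\<Sum>K\<in>C. norm (w (Sup K) - w (Inf K))) < 1" .
    have "M * measure lebesgue (\<Union>C) = (\<Sum>K\<in>C. M * (Sup K - Inf K))"
      using mC by (simp add: sum_distrib_left)
    also have "\<dots> \<le> (\<Sum>K\<in>C. norm (w (Sup K) - w (Inf K)))"
    proof (rule sum_mono)
      fix K assume "K \<in> C"
      from C(2)[OF this] show "M * (Sup K - Inf K) \<le> norm (w (Sup K) - w (Inf K))" by auto
    qed
    finally have "M * measure lebesgue (\<Union>C) < 1" using lt1 by linarith
    then have "measure lebesgue (\<Union>C) < e/2" using \<open>e > 0\<close> by (simp add: M_def field_simps)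
    moreover have "measure lebesgue (\<Union>C \<union> B) \<le> measure lebesgue (\<Union>C) + measure lebesgue B"
      using mC C(4) by (intro measure_Un_le) auto
    ultimately show "\<exists>T. ?E \<inter> {c<..<c+\<delta>/2} \<subseteq> T \<and> T \<in> lmeasurable \<and> measure lebesgue T \<le> e"
      using C mC by (intro exI[of _ "\<Union>C \<union> B"] conjI) (auto intro!: fmeasurable.Un)
  qed
  show ?thesis
  proof (rule locally_negligible_alt[THEN iffD2], rule ballI)
    fix x assume x: "x \<in> ?E"
    let ?I = "{x-\<delta>/4<..<x-\<delta>/4+\<delta>/2}"
    have "openin (top_of_set ?E) (?E \<inter> ?I)"
      by (intro openin_open_Int) simp
    moreover have "x \<in> ?I" using \<delta> by simp
    ultimately show "\<exists>U. openin (top_of_set ?E) U \<and> x \<in> U \<and> negligible U"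
      using loc[of "x-\<delta>/4"] x by (intro exI[of _ "?E \<inter> ?I"]) blast
  qed
qed


text \<open>If the set had outer measure \<open>m > 0\<close>, cover it by intervals of slope below \<open>- \<kappa>\<close> inside a nearly
  optimal open set, and then again by intervals of slope above \<open>\<kappa>\<close> inside the first ones. What remains of
  the first family is so short that, by absolute continuity, the two total increments, below
  \<open>- \<kappa> m\<close> and above \<open>\<kappa> m\<close> up to small errors, differ by less than \<open>\<kappa> m\<close>.\<close>

lemma ac_on_opposite_slopes_ae:
  fixes w :: "real \<Rightarrow> real"
  assumes ac: "ac_on a b w" and \<kappa>: "\<kappa> > 0"
  shows "negligible {x \<in> {a<..<b}.
     (\<forall>d>0. \<exists>u v. u < v \<and> x \<in> {u..v} \<and> v - u < d \<and> w v - w u < - \<kappa> * (v - u)) \<and>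
     (\<forall>d>0. \<exists>u v. u < v \<and> x \<in> {u..v} \<and> v - u < d \<and> w v - w u > \<kappa> * (v - u))}"
    (is "negligible ?E")
proof (rule ccontr)
  define E where "E = ?E"
  assume "\<not> negligible ?E"
  then have nE: "\<not> negligible E" by (simp only: E_def not_False_eq_True)
  have Eab: "E \<subseteq> {a<..<b}" unfolding E_def by blast
  have low: "\<exists>u v. u < v \<and> x \<in> {u..v} \<and> v - u < d \<and> w v - w u < - \<kappa> * (v - u)" if "x \<in> E" "d > 0" for x d
    using that by (simp add: E_def)
  have high: "\<exists>u v. u < v \<and> x \<in> {u..v} \<and> v - u < d \<and> w v - w u > \<kappa> * (v - u)" if "x \<in> E" "d > 0" for x d
    using that by (simp add: E_def)
  obtain e0 where "e0 > 0" and e1: "\<not> (\<exists>T. E \<subseteq> T \<and> T \<in> lmeasurable \<and> measure lebesgue T \<le> e0)"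
    using nE unfolding negligible_outer_le not_all not_imp by (elim exE conjE) (rule that)
  have e0: "e0 > 0" "e0 < measure lebesgue T" if "E \<subseteq> T" "T \<in> lmeasurable" for T
  proof -
    show "e0 < measure lebesgue T" using e1 that not_le by blast
  qed (fact \<open>e0 > 0\<close>)
  \<comment> \<open>\<open>E\<close> is not known to be measurable, so its outer measure is written
    as an infimum over measurable supersets; non-negligibility makes it positive.\<close>
  define MM where "MM = {measure lebesgue T | T. E \<subseteq> T \<and> T \<in> lmeasurable}"
  define m where "m = Inf MM"
  have Uab: "{a<..<b} \<in> lmeasurable" by auto
  with Eab have ne: "MM \<noteq> {}" by (auto simp: MM_def)
  have bdd: "bdd_below MM" by (intro bdd_belowI[of _ 0]) (auto simp: MM_def)
  have "e0 \<le> m" unfolding m_def using e0(2) by (intro cInf_greatest[OF ne]) (auto simp: MM_def less_imp_le)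
  then have m: "m > 0" using \<open>e0 > 0\<close> by simp
  have mle: "m \<le> measure lebesgue T" if "E \<subseteq> T" "T \<in> lmeasurable" for T
    unfolding m_def using that by (intro cInf_lower[OF _ bdd]) (auto simp: MM_def)
  have "\<kappa> * m > 0" using m \<kappa> by simp
  obtain \<delta> where \<delta>: "\<delta> > 0" and ac\<delta>: "\<And>\<D>. \<D> division_of \<Union>\<D> \<Longrightarrow> \<Union>\<D> \<subseteq> {a..b} \<Longrightarrow> (\<Sum>K\<in>\<D>. Sup K - Inf K) < \<delta> \<Longrightarrow>
        (\<Sum>K\<in>\<D>. norm (w (Sup K) - w (Inf K))) < \<kappa> * m"
    using ac_onD[OF ac \<open>\<kappa> * m > 0\<close>] by blast
  \<comment> \<open>The first family has total length below \<open>m + 2 * \<epsilon>\<close>, the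
    second above \<open>m - 2 * \<epsilon>\<close>, so the remainder is shorter than
    \<open>4 * \<epsilon> < \<delta>\<close>. The final contradiction uses that
    \<open>(m - \<epsilon>) + (m - 2 * \<epsilon>)\<close> exceeds \<open>m\<close>.\<close>
  define \<epsilon> where "\<epsilon> = min (\<delta> / 8) (m / 4)"
  have \<epsilon>: "\<epsilon> > 0" "4 * \<epsilon> < \<delta>" "4 * \<epsilon> \<le> m" using \<delta> m by (auto simp: \<epsilon>_def)
  have "Inf MM < m + \<epsilon>" using \<epsilon> by (simp add: m_def)
  then obtain T where T: "E \<subseteq> T" "T \<in> lmeasurable" "measure lebesgue T < m + \<epsilon>"
    using cInf_lessD[OF ne \<open>Inf MM < m + \<epsilon>\<close>] by (auto simp: MM_def)
  define T' where "T' = T \<inter> {a<..<b}"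
  have T': "E \<subseteq> T'" "T' \<in> lmeasurable" "measure lebesgue T' < m + \<epsilon>"
  proof -
    show "E \<subseteq> T'" using T Eab by (auto simp: T'_def)
    show "T' \<in> lmeasurable" using T by (auto simp: T'_def intro!: fmeasurable.Int)
    have "measure lebesgue T' \<le> measure lebesgue T"
      using T \<open>T' \<in> lmeasurable\<close> by (intro measure_mono_fmeasurable) (auto simp: T'_def)
    then show "measure lebesgue T' < m + \<epsilon>" using T by simp
  qed
  obtain U0 where U0: "open U0" "T' \<subseteq> U0" "(U0 - T') \<in> lmeasurable" "measure lebesgue (U0 - T') < \<epsilon>"
  proof -
    have "T' \<in> sets lebesgue" using T' by auto
    then obtain U0 where U0: "open U0" "T' \<subseteq> U0" "(U0 - T') \<in> lmeasurable" "emeasure lebesgue (U0 - T') < ennreal \<epsilon>"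
      using sets_lebesgue_outer_open[of T' \<epsilon>] \<epsilon>(1) by blast
    then have "ennreal (measure lebesgue (U0 - T')) < ennreal \<epsilon>"
      by (metis emeasure_eq_measure2)
    then have "measure lebesgue (U0 - T') < \<epsilon>" using ennreal_less_iff[OF measure_nonneg] by blast
    with U0 that show ?thesis by blast
  qed
  define U where "U = U0 \<inter> {a<..<b}"
  have U: "open U" "E \<subseteq> U" "U \<subseteq> {a<..<b}" using U0 T' Eab by (auto simp: U_def)
  have Um: "U \<in> lmeasurable" using U by (intro fmeasurableI2[OF Uab(1)]) auto
  have "measure lebesgue U \<le> measure lebesgue (T' \<union> (U0 - T'))"
    using U0 T' Um by (intro measure_mono_fmeasurable fmeasurable.Un) (auto simp: U_def)
  also have "\<dots> \<le> measure lebesgue T' + measure lebesgue (U0 - T')"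
    using U0 T' by (intro measure_Un_le) auto
  finally have mU: "measure lebesgue U < m + 2 * \<epsilon>" using T' U0 by linarith

  obtain C1 B1 where C1: "finite C1" "\<And>K. K \<in> C1 \<Longrightarrow> \<exists>u v. u < v \<and> K = {u..v} \<and> w v - w u < - \<kappa> * (v - u) \<and> K \<subseteq> U"
      "pairwise disjnt C1" "B1 \<in> lmeasurable" "measure lebesgue B1 < \<epsilon>" "E - \<Union>C1 \<subseteq> B1"
  proof (rule Vitali_finite_intervals[of U E \<epsilon> "\<lambda>u v. w v - w u < - \<kappa> * (v - u)"])
    fix x d :: real assume "x \<in> E" "0 < d"
    then show "\<exists>u v. u < v \<and> x \<in> {u..v} \<and> v - u < d \<and> w v - w u < - \<kappa> * (v - u)" by (rule low)
  qed (use U Um \<epsilon> in auto)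
  have Ci1: "\<exists>u v. u < v \<and> K = {u..v}" if "K \<in> C1" for K
    using C1(2)[OF that] by blast
  note mC1 = measure_disjoint_intervals[OF C1(1) Ci1 C1(3)]
  \<comment> \<open>The second covering takes place in an open set, so the intervals are replaced by
    their interiors; the end points \<open>FF\<close> lost in this way are finitely many.\<close>
  define U2 where "U2 = (\<Union>K\<in>C1. interior K)"
  define FF where "FF = (\<Union>K\<in>C1. {Inf K, Sup K})"
  have U2sub: "U2 \<subseteq> U" "U2 \<subseteq> \<Union>C1"
  proof -
    show "U2 \<subseteq> \<Union>C1" unfolding U2_def using interior_subset by blast
    also have "\<Union>C1 \<subseteq> U" using C1(2) by (intro Union_least) blast
    finally show "U2 \<subseteq> U" .
  qed
  have U2: "open U2" "U2 \<in> lmeasurable"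
  proof -
    show "open U2" by (auto simp: U2_def)
    then show "U2 \<in> lmeasurable" using U2sub by (intro fmeasurableI2[OF Um]) auto
  qed
  have C1U2: "\<Union>C1 \<subseteq> U2 \<union> FF"
  proof
    fix x assume "x \<in> \<Union>C1"
    then obtain K where K: "K \<in> C1" "x \<in> K" by blast
    then obtain u v where "u < v" "K = {u..v}" using Ci1 by blast
    then have "x \<in> interior K \<or> x \<in> {Inf K, Sup K}" using K by auto
    then show "x \<in> U2 \<union> FF" using K by (auto simp: U2_def FF_def)
  qed
  have FF: "negligible FF" using C1(1) by (auto simp: FF_def)
  \<comment> \<open>Requiring each new interval to lie in a single member of the first family allows
    every such member to be divided separately, with the new intervals as pieces.\<close>
  obtain C2 B2 where C2: "finite C2" "\<And>K. K \<in> C2 \<Longrightarrow> \<exists>u v. u < v \<and> K = {u..v} \<and> (w v - w u > \<kappa> * (v - u) \<and> (\<exists>L\<in>C1. {u..v} \<subseteq> L)) \<and> K \<subseteq> U2"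
      "pairwise disjnt C2" "B2 \<in> lmeasurable" "measure lebesgue B2 < \<epsilon>" "(E \<inter> U2) - \<Union>C2 \<subseteq> B2"
  proof (rule Vitali_finite_intervals[of U2 "E \<inter> U2" \<epsilon> "\<lambda>u v. w v - w u > \<kappa> * (v - u) \<and> (\<exists>L\<in>C1. {u..v} \<subseteq> L)"])
    fix x d :: real assume x: "x \<in> E \<inter> U2" and "0 < d"
    then obtain L where L: "L \<in> C1" "x \<in> interior L" by (auto simp: U2_def)
    then obtain k where k: "k > 0" "ball x k \<subseteq> L" by (meson mem_interior)
    have "min d k > 0" using \<open>0 < d\<close> k by simp
    then obtain u v where uv: "u < v" "x \<in> {u..v}" "v - u < min d k" "w v - w u > \<kappa> * (v - u)"
      using high[of x "min d k"] x by blast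
    have "{u..v} \<subseteq> ball x k"
    proof
      fix y assume "y \<in> {u..v}"
      then have "\<bar>x - y\<bar> < k" using uv by (simp add: abs_if)
      then show "y \<in> ball x k" by (simp add: dist_real_def)
    qed
    then have "{u..v} \<subseteq> L" using k by blast
    then show "\<exists>u v. u < v \<and> x \<in> {u..v} \<and> v - u < d \<and> w v - w u > \<kappa> * (v - u) \<and> (\<exists>L\<in>C1. {u..v} \<subseteq> L)"
      using uv L by (intro exI[of _ u] exI[of _ v]) auto
  qed (use U2 \<epsilon> in auto)
  have Ci2: "\<exists>u v. u < v \<and> K = {u..v}" if "K \<in> C2" for K
    using C2(2)[OF that] by blast
  note mC2 = measure_disjoint_intervals[OF C2(1) Ci2 C2(3)]
  have len1: "measure lebesgue (\<Union>C1) < m + 2 * \<epsilon>"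
  proof -
    have "measure lebesgue (\<Union>C1) \<le> measure lebesgue U"
    proof (rule measure_mono_fmeasurable)
      show "\<Union>C1 \<subseteq> U" using C1(2) by (intro Union_least) blast
    qed (use mC1 Um in auto)
    then show ?thesis using mU by linarith
  qed
  have len1': "m - \<epsilon> < measure lebesgue (\<Union>C1)"
  proof -
    have "m \<le> measure lebesgue (\<Union>C1 \<union> B1)" using C1 mC1 by (intro mle fmeasurable.Un) auto
    also have "\<dots> \<le> measure lebesgue (\<Union>C1) + measure lebesgue B1"
      using mC1 C1(4) by (intro measure_Un_le) auto
    finally show ?thesis using C1(5) by linarith
  qed
  have len2: "m - 2 * \<epsilon> < measure lebesgue (\<Union>C2)"
  proof -
    let ?X = "\<Union>C2 \<union> (B1 \<union> B2)"
    have X: "?X \<in> lmeasurable" using C1 C2 mC2 by (intro fmeasurable.Un) auto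
    have FN: "FF \<in> null_sets lebesgue" using FF by (simp add: negligible_iff_null_sets)
    have "E \<subseteq> ?X \<union> FF" using C1(6) C2(6) C1U2 by blast
    then have "m \<le> measure lebesgue (?X \<union> FF)"
      using mle fmeasurable.Un[OF X fmeasurableI_null_sets[OF FN]] by blast
    also have "\<dots> = measure lebesgue ?X"
      using X FN by (intro measure_Un_null_set) auto
    also have "\<dots> \<le> measure lebesgue (\<Union>C2) + measure lebesgue (B1 \<union> B2)"
      using mC2 C1(4) C2(4) by (intro measure_Un_le) auto
    also have "measure lebesgue (B1 \<union> B2) \<le> measure lebesgue B1 + measure lebesgue B2"
      using C1(4) C2(4) by (intro measure_Un_le) auto
    finally show ?thesis using C1(5) C2(5) by linarith
  qed

  define S where "S L = {K \<in> C2. K \<subseteq> L}" for L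
  have "\<exists>q. S L \<subseteq> q \<and> q division_of L" if L: "L \<in> C1" for L
  proof -
    obtain u v where uv: "u < v" "L = {u..v}" using Ci1[OF L] by blast
    have "finite (S L)" "\<And>K. K \<in> S L \<Longrightarrow> \<exists>u v. u < v \<and> K = {u..v}" "pairwise disjnt (S L)" "\<Union>(S L) \<subseteq> {u..v}"
      using C2(1,3) Ci2 uv by (auto simp: S_def intro: pairwise_subset)
    from extend_disjoint_intervals[OF this] uv show ?thesis by metis
  qed
  then obtain q where q: "\<And>L. L \<in> C1 \<Longrightarrow> S L \<subseteq> q L" "\<And>L. L \<in> C1 \<Longrightarrow> q L division_of L" by metis
  define R where "R = (\<Union>L\<in>C1. q L - S L)"
  have fq: "finite (q L)" if "L \<in> C1" for L using q(2)[OF that] by auto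
  have C1disj: "L1 \<inter> L2 = {}" if "L1 \<in> C1" "L2 \<in> C1" "L1 \<noteq> L2" for L1 L2
    using C1(3) that by (auto simp: pairwise_def disjnt_def)
  have qsub: "K \<subseteq> L" "K \<noteq> {}" if "L \<in> C1" "K \<in> q L" for K L
    using division_ofD(2,3)[OF q(2)[OF that(1)] that(2)] by auto
  have qdisj: "q i \<inter> q j = {}" if "i \<in> C1" "j \<in> C1" "i \<noteq> j" for i j
  proof (rule ccontr)
    assume "q i \<inter> q j \<noteq> {}"
    then obtain K where K: "K \<in> q i" "K \<in> q j" by blast
    have "K \<subseteq> i \<inter> j" using qsub(1)[OF that(1) K(1)] qsub(1)[OF that(2) K(2)] by simp
    then show False using C1disj[OF that] qsub(2)[OF that(1) K(1)] by simp
  qed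
  have RU: "R division_of \<Union>R"
  proof (rule division_ofI)
    show "finite R" using C1(1) fq by (auto simp: R_def)
    fix K assume "K \<in> R"
    then obtain L where L: "L \<in> C1" "K \<in> q L" by (auto simp: R_def)
    then show "K \<noteq> {}" "\<exists>a b. K = cbox a b" using division_ofD(3,4)[OF q(2)[OF L(1)] L(2)] by auto
    show "K \<subseteq> \<Union>R" using \<open>K \<in> R\<close> by blast
    fix K' assume "K' \<in> R" "K \<noteq> K'"
    then obtain L' where L': "L' \<in> C1" "K' \<in> q L'" by (auto simp: R_def)
    show "interior K \<inter> interior K' = {}"
    proof (cases "L = L'")
      case True
      then show ?thesis using division_ofD(5)[OF q(2)[OF L(1)] L(2)] L' \<open>K \<noteq> K'\<close> by auto
    next
      case False
      then have "K \<inter> K' = {}" using C1disj[OF L(1) L'(1)] qsub(1)[OF L] qsub(1)[OF L'] by blast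
      then show ?thesis using interior_subset by blast
    qed
  qed auto
  have "\<Union>R \<subseteq> U"
  proof (rule Union_least)
    fix K assume "K \<in> R"
    then obtain L where L: "L \<in> C1" "K \<in> q L" unfolding R_def by blast
    then have "L \<subseteq> U" using C1(2) by blast
    with qsub(1)[OF L] show "K \<subseteq> U" by (rule order_trans)
  qed
  then have Rsub: "\<Union>R \<subseteq> {a..b}" using U(3) by (rule order_trans[OF order_trans]) auto
  have C2eq: "C2 = (\<Union>L\<in>C1. S L)"
  proof
    show "C2 \<subseteq> (\<Union>L\<in>C1. S L)"
    proof
      fix K assume K: "K \<in> C2"
      then obtain L where "L \<in> C1" "K \<subseteq> L" using C2(2)[OF K] by blast
      with K show "K \<in> (\<Union>L\<in>C1. S L)" unfolding S_def by blast
    qed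
  qed (auto simp: S_def)
  \<comment> \<open>Used with the identity for the total length of the remainder and with
    \<open>w\<close> for its total increment.\<close>
  have telR: "(\<Sum>K\<in>R. F (Sup K) - F (Inf K)) = (\<Sum>L\<in>C1. F (Sup L) - F (Inf L)) - (\<Sum>K\<in>C2. F (Sup K) - F (Inf K))"
    for F :: "real \<Rightarrow> real"
  proof -
    have "(\<Sum>K\<in>R. F (Sup K) - F (Inf K)) = (\<Sum>L\<in>C1. \<Sum>K\<in>q L - S L. F (Sup K) - F (Inf K))"
      unfolding R_def
    proof (rule sum.UNION_disjoint)
      show "\<forall>i\<in>C1. \<forall>j\<in>C1. i \<noteq> j \<longrightarrow> (q i - S i) \<inter> (q j - S j) = {}"
        using qdisj by blast
    qed (use C1(1) fq in auto)
    also have "\<dots> = (\<Sum>L\<in>C1. (F (Sup L) - F (Inf L)) - (\<Sum>K\<in>S L. F (Sup K) - F (Inf K)))"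
    proof (rule sum.cong)
      fix L assume L: "L \<in> C1"
      then obtain u v where uv: "u < v" "L = {u..v}" using Ci1 by blast
      have "(\<Sum>K\<in>q L. F (Sup K) - F (Inf K)) = F v - F u"
        using division_telescope[of u v "q L" F] uv q(2)[OF L] by simp
      moreover have "(\<Sum>K\<in>q L. F (Sup K) - F (Inf K)) = (\<Sum>K\<in>q L - S L. F (Sup K) - F (Inf K)) + (\<Sum>K\<in>S L. F (Sup K) - F (Inf K))"
        using sum.subset_diff[OF q(1)[OF L] fq[OF L]] .
      ultimately show "(\<Sum>K\<in>q L - S L. F (Sup K) - F (Inf K)) = (F (Sup L) - F (Inf L)) - (\<Sum>K\<in>S L. F (Sup K) - F (Inf K))"
        using uv by simp
    qed simp
    also have "\<dots> = (\<Sum>L\<in>C1. F (Sup L) - F (Inf L)) - (\<Sum>L\<in>C1. \<Sum>K\<in>S L. F (Sup K) - F (Inf K))"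
      by (rule sum_subtractf)
    also have "(\<Sum>L\<in>C1. \<Sum>K\<in>S L. F (Sup K) - F (Inf K)) = (\<Sum>K\<in>C2. F (Sup K) - F (Inf K))"
      unfolding C2eq
    proof (rule sum.UNION_disjoint[symmetric])
      show "\<forall>i\<in>C1. \<forall>j\<in>C1. i \<noteq> j \<longrightarrow> S i \<inter> S j = {}"
        using qdisj q(1) by blast
    qed (use C1(1) C2(1) in \<open>auto simp: S_def\<close>)
    finally show ?thesis .
  qed
  have "(\<Sum>K\<in>R. Sup K - Inf K) = measure lebesgue (\<Union>C1) - measure lebesgue (\<Union>C2)"
    using telR[of "\<lambda>x. x"] mC1 mC2 by simp
  then have "(\<Sum>K\<in>R. Sup K - Inf K) < \<delta>" using len1 len2 \<epsilon> by linarith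
  from ac\<delta>[OF RU Rsub this] have "(\<Sum>K\<in>R. norm (w (Sup K) - w (Inf K))) < \<kappa> * m" .
  moreover have "- (\<Sum>K\<in>R. w (Sup K) - w (Inf K)) \<le> (\<Sum>K\<in>R. norm (w (Sup K) - w (Inf K)))"
    unfolding sum_negf[symmetric] by (intro sum_mono) auto
  moreover have "\<kappa> * measure lebesgue (\<Union>C2) \<le> (\<Sum>K\<in>C2. w (Sup K) - w (Inf K))"
  proof -
    have "\<kappa> * measure lebesgue (\<Union>C2) = (\<Sum>K\<in>C2. \<kappa> * (Sup K - Inf K))"
      using mC2 by (simp add: sum_distrib_left)
    also have "\<dots> \<le> (\<Sum>K\<in>C2. w (Sup K) - w (Inf K))"
    proof (rule sum_mono)
      fix K assume "K \<in> C2"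
      from C2(2)[OF this] show "\<kappa> * (Sup K - Inf K) \<le> w (Sup K) - w (Inf K)" by auto
    qed
    finally show ?thesis .
  qed
  moreover have "(\<Sum>K\<in>C1. w (Sup K) - w (Inf K)) \<le> - \<kappa> * measure lebesgue (\<Union>C1)"
  proof -
    have "(\<Sum>K\<in>C1. w (Sup K) - w (Inf K)) \<le> (\<Sum>K\<in>C1. - \<kappa> * (Sup K - Inf K))"
    proof (rule sum_mono)
      fix K assume "K \<in> C1"
      from C1(2)[OF this] show "w (Sup K) - w (Inf K) \<le> - \<kappa> * (Sup K - Inf K)" by auto
    qed
    also have "\<dots> = - \<kappa> * measure lebesgue (\<Union>C1)" using mC1 by (simp only: sum_distrib_left)
    finally show ?thesis .
  qed
  ultimately have "\<kappa> * (measure lebesgue (\<Union>C1) + measure lebesgue (\<Union>C2)) < \<kappa> * m"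
    using telR[of w] by (simp add: algebra_simps)
  then have "measure lebesgue (\<Union>C1) + measure lebesgue (\<Union>C2) < m" using \<kappa> by simp
  then show False using len1' len2 \<epsilon> m by linarith
qed

text \<open>If the lower and upper limits of the difference quotient differ, two rationals fit
  between them. Subtracting the linear function whose slope \<open>c\<close> is their midpoint
  leaves slopes below \<open>- k\<close> and above \<open>k\<close> on arbitrarily short intervals,
  \<open>k\<close> being half their distance: a null set for each of countably many pairs. Infinite
  limits are excluded by the bound on slopes.\<close>

lemma ac_on_real_differentiable_ae:
  fixes w :: "real \<Rightarrow> real"
  assumes ac: "ac_on a b w"
  shows "negligible {x \<in> {a<..<b}. \<not> w differentiable (at x)}"
proof -
  define E0 where "E0 = {x \<in> {a<..<b}. \<forall>M. \<forall>d>0. \<exists>u v. u < v \<and> x \<in> {u..v} \<and> v - u < d \<and> \<bar>w v - w u\<bar> > M * (v - u)}"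
  define E1 where "E1 c k = {x \<in> {a<..<b}.
     (\<forall>d>0. \<exists>u v. u < v \<and> x \<in> {u..v} \<and> v - u < d \<and> (w v - c * v) - (w u - c * u) < - k * (v - u)) \<and>
     (\<forall>d>0. \<exists>u v. u < v \<and> x \<in> {u..v} \<and> v - u < d \<and> (w v - c * v) - (w u - c * u) > k * (v - u))}" for c k :: real
  define I where "I = {p :: rat \<times> rat. fst p < snd p}"
  define E where "E = E0 \<union> (\<Union>p\<in>I. E1 ((of_rat (fst p) + of_rat (snd p))/2) ((of_rat (snd p) - of_rat (fst p))/2))"
  have "ac_on a b (\<lambda>x. w x - c * x)" for c
    by (intro ac_on_diff[OF ac] ac_on_Lipschitz[of _ _ _ "\<bar>c\<bar>"])
       (simp flip: abs_mult right_diff_distrib)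
  then have "negligible (E1 c k)" if "k > 0" for c k
    using ac_on_opposite_slopes_ae[of a b "\<lambda>x. w x - c * x" k] that unfolding E1_def by simp
  then have "negligible (\<Union>p\<in>I. E1 ((of_rat (fst p) + of_rat (snd p))/2) ((of_rat (snd p) - of_rat (fst p))/2))"
    by (intro negligible_countable_Union) (auto simp: I_def of_rat_less)
  moreover have "negligible E0" unfolding E0_def using ac_on_slopes_bounded_ae[OF ac] .
  ultimately have "negligible E" unfolding E_def by simp
  moreover have "{x \<in> {a<..<b}. \<not> w differentiable (at x)} \<subseteq> E"
  proof (rule subsetI, rule ccontr)
    fix x assume x: "x \<in> {x \<in> {a<..<b}. \<not> w differentiable (at x)}" and xE: "x \<notin> E"
    define s where "s h = (w (x + h) - w x) / h" for h
    have slope: "\<exists>u v. u < v \<and> x \<in> {u..v} \<and> v - u < d \<and> w v - w u = s h * (v - u)"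
      if "h \<noteq> 0" "\<bar>h\<bar> < d" for h d
    proof (cases "h > 0")
      case True
      with that show ?thesis by (intro exI[of _ x] exI[of _ "x + h"]) (auto simp: s_def)
    next
      case False
      with that show ?thesis by (intro exI[of _ "x + h"] exI[of _ x]) (auto simp: s_def)
    qed
    have freq: "\<exists>h. h \<noteq> 0 \<and> \<bar>h\<bar> < d \<and> P h" if "\<exists>\<^sub>F h in at 0. P h" "d > 0" for P and d :: real
      using that unfolding frequently_def eventually_at by (auto simp: dist_real_def)
    define f where "f h = ereal (s h)" for h
    let ?l = "Liminf (at 0) f" and ?L = "Limsup (at 0) f"
    have "?l = ?L"
    proof (rule ccontr)
      assume "?l \<noteq> ?L"
      then have "?l < ?L" using Liminf_le_Limsup[of "at (0::real)" f] by (simp add: order.not_eq_order_implies_strict)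
      then obtain r1 where r1: "?l < real_of_rat r1" "real_of_rat r1 < ?L" using ereal_dense3 by blast
      then obtain r2 where r2: "real_of_rat r1 < ereal (real_of_rat r2)" "real_of_rat r2 < ?L" using ereal_dense3 by blast
      have r12: "real_of_rat r1 < real_of_rat r2" using r2 by simp
      define c k where "c = (real_of_rat r1 + real_of_rat r2)/2" and "k = (real_of_rat r2 - real_of_rat r1)/2"
      have "\<exists>\<^sub>F h in at 0. s h < real_of_rat r1"
      proof (rule ccontr)
        assume "\<not> (\<exists>\<^sub>F h in at 0. s h < real_of_rat r1)"
        then have "\<forall>\<^sub>F h in at 0. ereal (real_of_rat r1) \<le> f h" by (simp add: not_frequently not_less f_def)
        from Liminf_bounded[OF this] r1 show False by simp
      qed
      moreover have "\<exists>\<^sub>F h in at 0. s h > real_of_rat r2"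
      proof (rule ccontr)
        assume "\<not> (\<exists>\<^sub>F h in at 0. s h > real_of_rat r2)"
        then have "\<forall>\<^sub>F h in at 0. f h \<le> ereal (real_of_rat r2)" by (simp add: not_frequently not_less f_def)
        from Limsup_bounded[OF this] r2 show False by simp
      qed
      ultimately have "x \<in> E1 c k"
      proof -
        assume f1: "\<exists>\<^sub>F h in at 0. s h < real_of_rat r1" and f2: "\<exists>\<^sub>F h in at 0. s h > real_of_rat r2"
        show ?thesis
          unfolding E1_def mem_Collect_eq
        proof (intro conjI allI impI)
          show "x \<in> {a<..<b}" using x by simp
          fix d :: real assume "d > 0"
          obtain h where h: "h \<noteq> 0" "\<bar>h\<bar> < d" "s h < real_of_rat r1" using freq[OF f1 \<open>d > 0\<close>] by blast
          obtain u v where uv: "u < v" "x \<in> {u..v}" "v - u < d" "w v - w u = s h * (v - u)" using slope[OF h(1,2)] by blast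
          have "(s h - c) * (v - u) < - k * (v - u)"
            using h(3) uv(1) by (intro mult_strict_right_mono) (auto simp: c_def k_def field_simps)
          then show "\<exists>u v. u < v \<and> x \<in> {u..v} \<and> v - u < d \<and> (w v - c * v) - (w u - c * u) < - k * (v - u)"
            using uv by (intro exI[of _ u] exI[of _ v]) (auto simp: algebra_simps)
          obtain h where h: "h \<noteq> 0" "\<bar>h\<bar> < d" "s h > real_of_rat r2" using freq[OF f2 \<open>d > 0\<close>] by blast
          obtain u v where uv: "u < v" "x \<in> {u..v}" "v - u < d" "w v - w u = s h * (v - u)" using slope[OF h(1,2)] by blast
          have "(s h - c) * (v - u) > k * (v - u)"
            using h(3) uv(1) by (intro mult_strict_right_mono) (auto simp: c_def k_def field_simps)
          then show "\<exists>u v. u < v \<and> x \<in> {u..v} \<and> v - u < d \<and> (w v - c * v) - (w u - c * u) > k * (v - u)"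
            using uv by (intro exI[of _ u] exI[of _ v]) (auto simp: algebra_simps)
        qed
      qed
      moreover have "(r1, r2) \<in> I" using r12 by (simp add: I_def of_rat_less)
      ultimately have "x \<in> E" unfolding E_def c_def k_def by force
      then show False using xE by blast
    qed
    then have lim: "(f \<longlongrightarrow> ?l) (at 0)"
      using tendsto_iff_Liminf_eq_Limsup[of "at (0::real)" f ?l] by simp
    have "x \<notin> E0" using xE by (simp add: E_def)
    then obtain M d where Md: "d > 0" "\<And>u v. u < v \<Longrightarrow> x \<in> {u..v} \<Longrightarrow> v - u < d \<Longrightarrow> \<bar>w v - w u\<bar> \<le> M * (v - u)"
      using x unfolding E0_def mem_Collect_eq by (meson not_le)
    have bd: "\<bar>s h\<bar> \<le> M" if h: "h \<noteq> 0" "\<bar>h\<bar> < d" for h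
    proof -
      obtain u v where uv: "u < v" "x \<in> {u..v}" "v - u < d" "w v - w u = s h * (v - u)" using slope[OF h] by blast
      from Md(2)[OF uv(1-3)] have "\<bar>s h\<bar> * (v - u) \<le> M * (v - u)" using uv by (simp add: abs_mult)
      then show ?thesis using uv(1) by simp
    qed
    have ev: "\<forall>\<^sub>F h in at 0. \<bar>s h\<bar> \<le> M"
      unfolding eventually_at using Md(1) bd by (intro exI[of _ d]) (auto simp: dist_real_def)
    have "ereal (-M) \<le> ?l" by (rule Liminf_bounded) (use ev in \<open>eventually_elim, auto simp: f_def\<close>)
    moreover have "?L \<le> ereal M" by (rule Limsup_bounded) (use ev in \<open>eventually_elim, auto simp: f_def\<close>)
    ultimately obtain D where "?l = ereal D" using \<open>?l = ?L\<close> by (cases ?L) auto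
    then have "(s \<longlongrightarrow> D) (at 0)" using lim by (simp add: f_def[abs_def])
    then have "(w has_real_derivative D) (at x)" by (simp add: DERIV_def s_def[abs_def])
    then show False using x unfolding has_field_derivative_def differentiable_def by blast
  qed
  ultimately show ?thesis by (rule negligible_subset)
qed

lemma ac_on_complex_differentiable_ae:
  fixes f :: "real \<Rightarrow> complex"
  assumes ac: "ac_on a b f"
  shows "negligible {x \<in> {a<..<b}. \<not> f differentiable (at x)}"
proof (rule negligible_subset)
  show "negligible ({x \<in> {a<..<b}. \<not> (\<lambda>x. Re (f x)) differentiable (at x)} \<union> {x \<in> {a<..<b}. \<not> (\<lambda>x. Im (f x)) differentiable (at x)})"
    using ac_on_real_differentiable_ae ac_on_bounded_linear[OF bounded_linear_Re ac] ac_on_bounded_linear[OF bounded_linear_Im ac]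
    by (intro negligible_Un) auto
  have "f differentiable (at x)" if d: "(\<lambda>x. Re (f x)) differentiable (at x)" "(\<lambda>x. Im (f x)) differentiable (at x)" for x
  proof -
    obtain D1 D2 where "((\<lambda>x. Re (f x)) has_derivative D1) (at x)" "((\<lambda>x. Im (f x)) has_derivative D2) (at x)"
      using d unfolding differentiable_def by blast
    then have "((\<lambda>x. complex_of_real (Re (f x)) + \<i> * complex_of_real (Im (f x))) has_derivative
        (\<lambda>h. complex_of_real (D1 h) + \<i> * complex_of_real (D2 h))) (at x)"
      by (intro derivative_intros)
    then show ?thesis unfolding differentiable_def by (auto simp flip: complex_eq)
  qed
  then show "{x \<in> {a<..<b}. \<not> f differentiable (at x)} \<subseteq>
    {x \<in> {a<..<b}. \<not> (\<lambda>x. Re (f x)) differentiable (at x)} \<union> {x \<in> {a<..<b}. \<not> (\<lambda>x. Im (f x)) differentiable (at x)}"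
    by blast
qed

section \<open>Scalar differential equations on a half-line\<close>

lemma continuous_on_atLeastI:
  assumes "\<And>b. continuous_on {a..b::real} f"
  shows "continuous_on {a..} f"
  unfolding continuous_on_eq_continuous_within
proof
  fix x assume "x \<in> {a..}"
  then have "continuous (at x within {a..x+1}) f"
    using assms[of "x+1"] by (simp add: continuous_on_eq_continuous_within)
  moreover have "at x within {a..x+1} = at x within {a..}"
    by (rule at_within_nhd[of _ "{x-1<..<x+1}"]) auto
  ultimately show "continuous (at x within {a..}) f" by (simp add: continuous_within)
qed

lemma half_line_continuous_on:
  assumes "\<And>x. a \<le> x \<Longrightarrow> (f has_real_derivative f' x) (at x within {a..})" and "S \<subseteq> {a..}"
  shows "continuous_on S f"
proof -
  have "continuous_on {a..} f"
    using assms(1) by (auto simp: continuous_on_eq_continuous_within intro: DERIV_continuous)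
  then show ?thesis using assms(2) by (rule continuous_on_subset)
qed

lemma half_line_DERIV:
  assumes "\<And>x. a \<le> x \<Longrightarrow> (f has_real_derivative f' x) (at x within {a..})" and "(a::real) < x"
  shows "(f has_real_derivative f' x) (at x)"
proof -
  have "at x within {a..} = at x"
    using assms(2) by (intro at_within_interior) (simp add: interior_real_atLeast)
  then show ?thesis using assms(1)[of x] assms(2) by simp
qed

lemma half_line_nondecreasing:
  fixes f :: "real \<Rightarrow> real"
  assumes d: "\<And>x. a \<le> x \<Longrightarrow> (f has_real_derivative f' x) (at x within {a..})"
    and "a \<le> p" "p \<le> q" and nn: "\<And>x. p < x \<Longrightarrow> x < q \<Longrightarrow> f' x \<ge> 0"
  shows "f p \<le> f q"
proof (rule DERIV_nonneg_imp_increasing_open[OF \<open>p \<le> q\<close>])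
  fix x assume "p < x" "x < q"
  then show "\<exists>y. (f has_real_derivative y) (at x) \<and> 0 \<le> y"
    using half_line_DERIV[OF d, of x] nn[of x] \<open>a \<le> p\<close> by auto
qed (rule half_line_continuous_on[OF d], use \<open>a \<le> p\<close> in auto)

lemma half_line_const:
  fixes f :: "real \<Rightarrow> real" and a :: real
  assumes "\<And>x. a \<le> x \<Longrightarrow> (f has_real_derivative 0) (at x within {a..})" "a \<le> x"
  shows "f x = f a"
proof (rule antisym)
  show "f a \<le> f x" using half_line_nondecreasing[OF assms(1), of a x] assms(2) by simp
  show "f x \<le> f a" using half_line_nondecreasing[of a "\<lambda>x. - f x" "\<lambda>_. 0" a x] assms DERIV_minus[OF assms(1)] by simp
qed

lemma half_line_growth:
  fixes f :: "real \<Rightarrow> real"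
  assumes d: "\<And>x. a \<le> x \<Longrightarrow> (f has_real_derivative f' x) (at x within {a..})"
    and "a \<le> p" "p \<le> q" and nn: "\<And>x. p < x \<Longrightarrow> x < q \<Longrightarrow> f' x \<ge> k"
  shows "f q \<ge> f p + k * (q - p)"
proof -
  have "((\<lambda>x. f x - k * x) has_real_derivative f' x - k) (at x within {a..})" if "a \<le> x" for x
    using d[OF that] by (auto intro!: derivative_eq_intros)
  from half_line_nondecreasing[OF this \<open>a \<le> p\<close> \<open>p \<le> q\<close>] nn
  show ?thesis by (simp add: algebra_simps)
qed

text \<open>The compact set where \<open>f \<ge> c\<close> has a largest element. Barrier and
  comparison arguments start from this point, after which \<open>f\<close> stays below
  \<open>c\<close>.\<close>

lemma last_crossing:
  fixes f :: "real \<Rightarrow> real"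
  assumes cont: "continuous_on {p..q} f" and "p \<le> q" "f p \<ge> c" "f q < c"
  obtains t where "p \<le> t" "t < q" "f t = c" "\<And>x. t < x \<Longrightarrow> x \<le> q \<Longrightarrow> f x < c"
proof -
  let ?S = "{x \<in> {p..q}. f x \<ge> c}"
  have "closed ?S"
    using continuous_closed_preimage[OF cont, of "{c..}"] by (simp add: vimage_def Int_def conj_commute)
  moreover have "bounded ?S" by (rule bounded_subset[of "{p..q}"]) auto
  ultimately have "compact ?S" by (simp add: compact_eq_bounded_closed)
  moreover have "?S \<noteq> {}" using assms by auto
  ultimately obtain t where t: "t \<in> ?S" "\<And>x. x \<in> ?S \<Longrightarrow> x \<le> t"
    using compact_attains_sup[of ?S] by blast
  have lt: "f x < c" if "t < x" "x \<le> q" for x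
    using t(2)[of x] t(1) that by force
  have "t < q" using t(1) assms(4) by (cases "t = q") auto
  have "f t = c"
  proof (rule ccontr)
    assume "f t \<noteq> c"
    then have "f t > c" using t(1) by auto
    have "continuous_on {t..q} f" using cont t(1) by (auto intro: continuous_on_subset)
    then obtain x where "t \<le> x" "x \<le> q" "f x = c"
      using IVT2'[of f q c t] \<open>f t > c\<close> assms(4) \<open>t < q\<close> by auto
    then show False using lt[of x] \<open>f t > c\<close> by (cases "t = x") auto
  qed
  then show thesis using that[of t] t(1) \<open>t < q\<close> lt by auto
qed

text \<open>At the last crossing the positive derivative lifts \<open>f\<close> above
  \<open>c\<close> immediately afterwards, a contradiction. The sign of the derivative enters only
  on the level \<open>c\<close> itself.\<close>

lemma half_line_barrier_ge:
  fixes f :: "real \<Rightarrow> real"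
  assumes d: "\<And>x. a \<le> x \<Longrightarrow> (f has_real_derivative f' x) (at x within {a..})"
    and "a \<le> p" "p \<le> q" "f p \<ge> c" and pos: "\<And>x. p \<le> x \<Longrightarrow> f x = c \<Longrightarrow> f' x > 0"
  shows "f q \<ge> c"
proof (rule ccontr)
  assume "\<not> f q \<ge> c"
  then obtain t where t: "p \<le> t" "t < q" "f t = c" "\<And>x. t < x \<Longrightarrow> x \<le> q \<Longrightarrow> f x < c"
    using last_crossing[of p q f c] half_line_continuous_on[OF d, of "{p..q}"] assms(2-4) by (auto simp: not_le)
  have "(f has_real_derivative f' t) (at t within {a..})" "f' t > 0"
    using d[of t] pos[of t] t assms(2) by auto
  then obtain e where e: "e > 0" "\<And>h. h > 0 \<Longrightarrow> t + h \<in> {a..} \<Longrightarrow> h < e \<Longrightarrow> f t < f (t + h)"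
    using has_real_derivative_pos_inc_right by blast
  define h where "h = min (e/2) (q - t)"
  have "h > 0" "h < e" "t + h \<le> q" using e(1) t by (auto simp: h_def min_def)
  then show False using e(2)[of h] t(1,3) t(4)[of "t + h"] assms(2) by auto
qed

lemma half_line_barrier_le:
  fixes f :: "real \<Rightarrow> real"
  assumes d: "\<And>x. a \<le> x \<Longrightarrow> (f has_real_derivative f' x) (at x within {a..})"
    and "a \<le> p" "p \<le> q" "f p \<le> c" and neg: "\<And>x. p \<le> x \<Longrightarrow> f x = c \<Longrightarrow> f' x < 0"
  shows "f q \<le> c"
proof -
  have "- f q \<ge> - c"
    by (rule half_line_barrier_ge[of a "\<lambda>x. - f x" "\<lambda>x. - f' x" p])
       (use assms in \<open>auto intro!: derivative_eq_intros\<close>)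
  then show ?thesis by simp
qed

text \<open>A Gronwall argument: while \<open>f\<close> is negative,
  \<open>f x * exp (- K * x)\<close> is nondecreasing, so \<open>f\<close> cannot become negative
  after its last zero.\<close>

lemma half_line_comparison:
  fixes f :: "real \<Rightarrow> real"
  assumes d: "\<And>x. a \<le> x \<Longrightarrow> (f has_real_derivative f' x) (at x within {a..})"
    and "a \<le> p" "p \<le> q" "f p \<ge> 0" and ge: "\<And>x. p < x \<Longrightarrow> f x < 0 \<Longrightarrow> f' x \<ge> K * f x"
  shows "f q \<ge> 0"
proof (rule ccontr)
  assume "\<not> f q \<ge> 0"
  then obtain t where t: "p \<le> t" "t < q" "f t = 0" "\<And>x. t < x \<Longrightarrow> x \<le> q \<Longrightarrow> f x < 0"
    using last_crossing[of p q f 0] half_line_continuous_on[OF d, of "{p..q}"] assms(2-4) by (auto simp: not_le)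
  have "((\<lambda>x. f x * exp (- K * x)) has_real_derivative (f' x - K * f x) * exp (- K * x)) (at x within {a..})" if "a \<le> x" for x
    using d[OF that] by (auto intro!: derivative_eq_intros simp: algebra_simps)
  from half_line_nondecreasing[OF this, of t q] t ge assms(2)
  have "f t * exp (- K * t) \<le> f q * exp (- K * q)" by auto
  then show False using t(2,3) t(4)[of q] by (simp add: zero_le_mult_iff)
qed

text \<open>Below the level \<open>c\<close> the function climbs at rate at least \<open>k\<close>,
  so it arrives after time \<open>(c - f p) / k\<close> at the latest; from then on the level is a
  barrier.\<close>

lemma half_line_eventually_ge:
  fixes f :: "real \<Rightarrow> real"
  assumes d: "\<And>x. a \<le> x \<Longrightarrow> (f has_real_derivative f' x) (at x within {a..})"
    and "a \<le> p" "k > 0" and ge: "\<And>x. p \<le> x \<Longrightarrow> f x \<le> c \<Longrightarrow> f' x \<ge> k"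
  shows "\<forall>\<^sub>F x in at_top. f x \<ge> c"
proof -
  have "\<exists>q\<ge>p. f q \<ge> c"
  proof (rule ccontr)
    assume "\<not> (\<exists>q\<ge>p. f q \<ge> c)"
    then have lt: "f q < c" if "q \<ge> p" for q using that by (meson not_le)
    define q where "q = p + (c - f p) / k"
    have "q \<ge> p" using lt[of p] \<open>k > 0\<close> by (simp add: q_def)
    have "f q \<ge> f p + k * (q - p)"
    proof (rule half_line_growth[OF d \<open>a \<le> p\<close> \<open>q \<ge> p\<close>])
      fix x assume "p < x" "x < q"
      then show "k \<le> f' x" using ge[of x] lt[of x] by simp
    qed
    also have "f p + k * (q - p) = c" using \<open>k > 0\<close> by (simp add: q_def)
    finally show False using lt[OF \<open>q \<ge> p\<close>] by simp
  qed
  then obtain q where q: "q \<ge> p" "f q \<ge> c" by blast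
  have pos: "f' x > 0" if "q \<le> x" "f x = c" for x
    using ge[of x] that q(1) \<open>k > 0\<close> by simp
  show ?thesis
    unfolding eventually_at_top_linorder
  proof (intro exI[of _ q] allI impI)
    fix x assume "q \<le> x"
    show "f x \<ge> c"
      by (rule half_line_barrier_ge[OF d _ \<open>q \<le> x\<close> q(2)]) (use q(1) assms(2) pos in auto)
  qed
qed

lemma half_line_integral_deriv:
  fixes g :: "real \<Rightarrow> real"
  assumes "continuous_on {a..} g" "a \<le> x"
  shows "((\<lambda>x. integral {a..x} g) has_real_derivative g x) (at x within {a..})"
proof -
  have "continuous_on {a..x+1} g" using assms(1) by (rule continuous_on_subset) auto
  then have "((\<lambda>x. integral {a..x} g) has_real_derivative g x) (at x within {a..x+1})"
    using assms(2) by (intro integral_has_real_derivative) auto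
  moreover have "at x within {a..x+1} = at x within {a..}"
    by (rule at_within_nhd[of _ "{x-1<..<x+1}"]) auto
  ultimately show ?thesis by simp
qed

text \<open>Picard iteration; the weight \<open>exp (2 K (x - a))\<close> makes one step a contraction by a factor
  \<open>1/2\<close> on every compact interval, whatever the Lipschitz constant \<open>K\<close> there.\<close>

lemma global_Picard:
  fixes F :: "real \<Rightarrow> real \<Rightarrow> real"
  assumes cont: "continuous_on ({a..} \<times> UNIV) (\<lambda>p. F (fst p) (snd p))"
    and lip: "\<And>b. \<exists>K>0. \<forall>x\<in>{a..b}. \<forall>s t. \<bar>F x s - F x t\<bar> \<le> K * \<bar>s - t\<bar>"
  shows "\<exists>\<phi>. \<phi> a = s0 \<and> (\<forall>x\<ge>a. (\<phi> has_real_derivative F x (\<phi> x)) (at x within {a..}))"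
proof -
  define ph where "ph n = ((\<lambda>g x. s0 + integral {a..x} (\<lambda>t. F t (g t))) ^^ n) (\<lambda>x. s0)" for n
  have ph_0: "ph 0 x = s0" for x by (simp add: ph_def)
  have ph_Suc: "ph (Suc n) x = s0 + integral {a..x} (\<lambda>t. F t (ph n t))" for n x by (simp add: ph_def)
  have contF: "continuous_on S (\<lambda>t. F t (g t))" if "continuous_on S g" "S \<subseteq> {a..}" for g S
    by (rule continuous_on_compose2[OF cont, of S "\<lambda>t. (t, g t)", simplified])
       (use that in \<open>auto intro!: continuous_intros\<close>)
  have cont_ph: "continuous_on {a..} (ph n)" for n
  proof (induction n)
    case 0 then show ?case by (simp add: ph_0[abs_def])
  next
    case (Suc n)
    have "continuous_on {a..} (\<lambda>x. integral {a..x} (\<lambda>t. F t (ph n t)))"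
      by (rule half_line_continuous_on[OF half_line_integral_deriv]) (auto intro: contF Suc)
    then show ?case by (auto simp: ph_Suc[abs_def] intro!: continuous_intros)
  qed
  \<comment> \<open>The limit of the iterates is written as a telescoping series, to which the
    Weierstrass test applies on each compact interval.\<close>
  define \<phi> where "\<phi> x = s0 + (\<Sum>i. ph (Suc i) x - ph i x)" for x
  have ph_sum: "ph n x = s0 + (\<Sum>i<n. ph (Suc i) x - ph i x)" for n x
    using sum_lessThan_telescope[of "\<lambda>i. ph i x" n] by (simp add: ph_0)
  have unif: "uniform_limit {a..b} ph \<phi> sequentially" for b
  proof -
    obtain K where K: "K > 0" "\<And>x s t. x \<in> {a..b} \<Longrightarrow> \<bar>F x s - F x t\<bar> \<le> K * \<bar>s - t\<bar>" using lip[of b] by blast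
    have cb: "continuous_on {a..b} (\<lambda>t. F t (ph n t))" for n
      by (intro contF continuous_on_subset[OF cont_ph]) auto
    have "bounded ((\<lambda>x. ph 1 x - ph 0 x) ` {a..b})"
      by (intro compact_imp_bounded compact_continuous_image continuous_intros continuous_on_subset[OF cont_ph]) auto
    then obtain C where C: "C > 0" "\<And>x. x \<in> {a..b} \<Longrightarrow> \<bar>ph 1 x - ph 0 x\<bar> \<le> C"
      unfolding bounded_pos real_norm_def by (meson imageI)
    have step: "\<bar>ph (Suc n) x - ph n x\<bar> \<le> C * (1/2)^n * exp (2 * K * (x - a))" if "x \<in> {a..b}" for n x
      using that
    proof (induction n arbitrary: x)
      case 0
      have "C * 1 \<le> C * exp (2 * K * (x - a))"
        using C(1) K(1) 0 by (intro mult_left_mono) auto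
      then show ?case using C(2)[OF 0] by simp
    next
      case (Suc n)
      let ?D = "\<lambda>t. F t (ph (Suc n) t) - F t (ph n t)"
      let ?w = "\<lambda>t. K * (C * (1/2)^n * exp (2 * K * (t - a)))"
      have sub: "{a..x} \<subseteq> {a..b}" using Suc.prems by auto
      have i: "(\<lambda>t. F t (ph k t)) integrable_on {a..x}" for k
        by (intro integrable_continuous_real continuous_on_subset[OF cb sub])
      have w: "(?w has_integral (C * (1/2)^Suc n * exp (2 * K * (x - a)) - C * (1/2)^Suc n * exp (2 * K * (a - a)))) {a..x}"
        using Suc.prems K(1) by (intro fundamental_theorem_of_calculus)
          (auto intro!: derivative_eq_intros simp flip: has_real_derivative_iff_has_vector_derivative)
      have "ph (Suc (Suc n)) x - ph (Suc n) x = integral {a..x} ?D"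
        using Henstock_Kurzweil_Integration.integral_diff[OF i i, of "Suc n" n] by (simp add: ph_Suc)
      moreover have "norm (integral {a..x} ?D) \<le> integral {a..x} ?w"
      proof (rule integral_norm_bound_integral)
        show "?D integrable_on {a..x}" by (rule integrable_diff[OF i i])
        show "?w integrable_on {a..x}" using w by blast
        fix t assume t: "t \<in> {a..x}"
        then have tb: "t \<in> {a..b}" using sub by blast
        have "norm (?D t) \<le> K * \<bar>ph (Suc n) t - ph n t\<bar>" using K(2)[OF tb] by simp
        also have "\<dots> \<le> ?w t" using Suc.IH[OF tb] K(1) by (intro mult_left_mono) auto
        finally show "norm (?D t) \<le> ?w t" .
      qed
      moreover have "integral {a..x} ?w \<le> C * (1/2)^Suc n * exp (2 * K * (x - a))"
        using integral_unique[OF w] C(1) by simp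
      ultimately show ?case by simp
    qed
    have "uniform_limit {a..b} (\<lambda>n x. \<Sum>i<n. ph (Suc i) x - ph i x) (\<lambda>x. \<Sum>i. ph (Suc i) x - ph i x) sequentially"
    proof (rule Weierstrass_m_test)
      show "summable (\<lambda>n. C * exp (2 * K * (b - a)) * (1/2)^n)"
        by (intro summable_mult summable_geometric) auto
      fix n x assume x: "x \<in> {a..b}"
      have "\<bar>ph (Suc n) x - ph n x\<bar> \<le> C * (1/2)^n * exp (2 * K * (x - a))" using step[OF x] .
      also have "\<dots> \<le> C * (1/2)^n * exp (2 * K * (b - a))"
        using x C K(1) by (intro mult_left_mono) auto
      finally show "norm (ph (Suc n) x - ph n x) \<le> C * exp (2 * K * (b - a)) * (1/2)^n"
        by (simp add: mult_ac)
    qed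
    then have "uniform_limit {a..b} (\<lambda>n x. s0 + (\<Sum>i<n. ph (Suc i) x - ph i x)) (\<lambda>x. s0 + (\<Sum>i. ph (Suc i) x - ph i x)) sequentially"
      by (intro uniform_limit_add uniform_limit_const)
    then show ?thesis by (simp add: ph_sum[symmetric, abs_def] \<phi>_def[abs_def])
  qed
  have ptw: "(\<lambda>n. ph n x) \<longlonglongrightarrow> \<phi> x" if "a \<le> x" for x
    using tendsto_uniform_limitI[OF unif[of x]] that by auto
  have cont_\<phi>_b: "continuous_on {a..b} \<phi>" for b
    by (rule uniform_limit_theorem[OF _ unif])
       (intro always_eventually allI continuous_on_subset[OF cont_ph], auto)
  have cont_\<phi>: "continuous_on {a..} \<phi>"
    by (rule continuous_on_atLeastI[OF cont_\<phi>_b])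
  have eq: "\<phi> x = s0 + integral {a..x} (\<lambda>t. F t (\<phi> t))" if "a \<le> x" for x
  proof -
    obtain K where K: "K > 0" "\<And>t s u. t \<in> {a..x} \<Longrightarrow> \<bar>F t s - F t u\<bar> \<le> K * \<bar>s - u\<bar>" using lip[of x] by blast
    have "uniform_limit {a..x} (\<lambda>n t. F t (ph n t)) (\<lambda>t. F t (\<phi> t)) sequentially"
    proof (rule uniform_limitI)
      fix e :: real assume "e > 0"
      then have "\<forall>\<^sub>F n in sequentially. \<forall>t\<in>{a..x}. dist (ph n t) (\<phi> t) < e / K"
        using uniform_limitD[OF unif[of x]] K(1) by simp
      then show "\<forall>\<^sub>F n in sequentially. \<forall>t\<in>{a..x}. dist (F t (ph n t)) (F t (\<phi> t)) < e"
      proof eventually_elim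
        case (elim n)
        show ?case
        proof
          fix t assume t: "t \<in> {a..x}"
          have "dist (F t (ph n t)) (F t (\<phi> t)) \<le> K * dist (ph n t) (\<phi> t)"
            using K(2)[OF t] by (simp add: dist_real_def)
          also have "\<dots> < K * (e / K)" using elim t K(1) by (intro mult_strict_left_mono) auto
          finally show "dist (F t (ph n t)) (F t (\<phi> t)) < e" using K(1) by simp
        qed
      qed
    qed
    then obtain I J where IJ: "\<And>n. ((\<lambda>t. F t (ph n t)) has_integral I n) {a..x}" "((\<lambda>t. F t (\<phi> t)) has_integral J) {a..x}" "I \<longlonglongrightarrow> J"
      by (rule uniform_limit_integral) (auto intro!: contF continuous_on_subset[OF cont_ph])
    have "(\<lambda>n. ph (Suc n) x) \<longlonglongrightarrow> s0 + J"
      using IJ(3) integral_unique[OF IJ(1)] unfolding ph_Suc by (auto intro!: tendsto_intros)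
    moreover have "(\<lambda>n. ph (Suc n) x) \<longlonglongrightarrow> \<phi> x" using ptw[OF that] by (rule LIMSEQ_Suc)
    ultimately show ?thesis using LIMSEQ_unique integral_unique[OF IJ(2)] by blast
  qed
  have "(\<phi> has_real_derivative F x (\<phi> x)) (at x within {a..})" if "a \<le> x" for x
  proof (rule has_field_derivative_transform_within[where d = 1])
    show "((\<lambda>x. s0 + integral {a..x} (\<lambda>t. F t (\<phi> t))) has_real_derivative F x (\<phi> x)) (at x within {a..})"
      using half_line_integral_deriv[OF contF[OF cont_\<phi>] that] by (auto intro!: derivative_eq_intros)
  qed (use that eq in auto)
  moreover have "\<phi> a = s0" using eq[of a] by simp
  ultimately show ?thesis by blast
qed

section \<open>The Pruefer angle\<close>

lemma abs_sin_diff_le: "\<bar>sin x - sin y\<bar> \<le> \<bar>x - y\<bar>" for x y :: real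
proof -
  have "\<bar>sin x - sin y\<bar> = 2 * \<bar>sin ((x - y)/2)\<bar> * \<bar>cos ((x + y)/2)\<bar>"
    by (simp add: sin_diff_sin abs_mult)
  also have "\<dots> \<le> 2 * \<bar>(x - y)/2\<bar> * 1"
    by (intro mult_mono abs_sin_x_le_abs_x) auto
  finally show ?thesis by simp
qed

lemma abs_cos_diff_le: "\<bar>cos x - cos y\<bar> \<le> \<bar>x - y\<bar>" for x y :: real
  using abs_sin_diff_le[of "pi/2 - x" "pi/2 - y"] by (simp add: sin_diff cos_diff)

lemma abs_sin_sq_diff_le: "\<bar>(sin x)\<^sup>2 - (sin y)\<^sup>2\<bar> \<le> 2 * \<bar>x - y\<bar>" for x y :: real
proof -
  have "\<bar>(sin x)\<^sup>2 - (sin y)\<^sup>2\<bar> = \<bar>sin x - sin y\<bar> * \<bar>sin x + sin y\<bar>"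
    by (simp add: abs_mult[symmetric] power2_eq_square algebra_simps)
  also have "\<dots> \<le> \<bar>x - y\<bar> * 2"
  proof (intro mult_mono abs_sin_diff_le)
    show "\<bar>sin x + sin y\<bar> \<le> 2"
      using abs_triangle_ineq[of "sin x" "sin y"] abs_sin_le_one[of x] abs_sin_le_one[of y] by linarith
  qed auto
  finally show ?thesis by simp
qed

lemma shift_int_pi:
  "cos (2 * (s - of_int k * pi)) = cos (2 * s)" "sin (2 * (s - of_int k * pi)) = sin (2 * s)"
  "\<bar>sin (s - of_int k * pi)\<bar> = \<bar>sin s\<bar>" for s :: real and k :: int
proof -
  have e: "2 * (s - of_int k * pi) = 2 * s - 2 * pi * of_int k" by (simp add: algebra_simps)
  show "cos (2 * (s - of_int k * pi)) = cos (2 * s)" "sin (2 * (s - of_int k * pi)) = sin (2 * s)"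
    unfolding e cos_diff sin_diff by (simp_all add: cos_int_2pin sin_int_2pin)
  show "\<bar>sin (s - of_int k * pi)\<bar> = \<bar>sin s\<bar>"
  proof -
    have z: "sin (of_int k * pi) = 0" by (auto simp: sin_zero_iff_int2)
    then have "\<bar>cos (of_int k * pi)\<bar> = 1" by (rule sin_zero_abs_cos_one)
    with z show ?thesis by (simp add: sin_diff abs_mult)
  qed
qed

text \<open>For the limit equation \<open>\<phi>' = \<mu> cos (2 \<phi>)\<close> the angle rises in
  the first sector and falls in the second; the third and fourth facts concern a neighbourhood of an
  attracting zero, the last one that of a repelling zero. The margin 1/2 is there to absorb
  perturbations. Each fact is a shift of \<open>cos y \<ge> 1/2\<close> for \<open>y\<close> between
  \<open>- pi/3\<close> and \<open>pi/3\<close>.\<close>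

lemma sectors:
  fixes s :: real and k :: int
  shows "s \<in> {of_int k * pi - pi/6..of_int k * pi + pi/6} \<Longrightarrow> cos (2 * s) \<ge> 1/2"
    and "s \<in> {of_int k * pi + pi/3..of_int k * pi + 2*pi/3} \<Longrightarrow> cos (2 * s) \<le> - 1/2"
    and "s \<in> {of_int k * pi + pi/6..of_int k * pi + pi/3} \<Longrightarrow> sin (2 * s) \<ge> 1/2"
    and "s \<in> {of_int k * pi + pi/6..of_int k * pi + pi/3} \<Longrightarrow> \<bar>sin s\<bar> \<ge> 1/2"
    and "s \<in> {of_int k * pi + 2*pi/3..of_int k * pi + 5*pi/6} \<Longrightarrow> sin (2 * s) \<le> - 1/2"
proof -
  define t where "t = s - of_int k * pi"
  have c: "cos (2 * s) = cos (2 * t)" "sin (2 * s) = sin (2 * t)" "\<bar>sin s\<bar> = \<bar>sin t\<bar>"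
    unfolding t_def shift_int_pi by (rule refl)+
  have base: "cos y \<ge> 1/2" if "\<bar>y\<bar> \<le> pi/3" for y :: real
  proof -
    have "cos (pi/3) \<le> cos \<bar>y\<bar>" using that by (intro cos_monotone_0_pi_le) auto
    then show ?thesis by (simp add: cos_60)
  qed
  show "cos (2 * s) \<ge> 1/2" if "s \<in> {of_int k * pi - pi/6..of_int k * pi + pi/6}"
    unfolding c using that by (intro base) (auto simp: t_def abs_if)
  show "cos (2 * s) \<le> - 1/2" if "s \<in> {of_int k * pi + pi/3..of_int k * pi + 2*pi/3}"
  proof -
    have "cos (2 * t - pi) \<ge> 1/2" using that by (intro base) (auto simp: t_def abs_if)
    then show ?thesis unfolding c by (simp add: cos_diff)
  qed
  show "sin (2 * s) \<ge> 1/2" if "s \<in> {of_int k * pi + pi/6..of_int k * pi + pi/3}"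
  proof -
    have "cos (2 * t - pi/2) \<ge> 1/2" using that by (intro base) (auto simp: t_def abs_if)
    then show ?thesis unfolding c by (simp add: cos_diff)
  qed
  show "\<bar>sin s\<bar> \<ge> 1/2" if "s \<in> {of_int k * pi + pi/6..of_int k * pi + pi/3}"
  proof -
    have "cos (t - pi/2) \<ge> 1/2" using that by (intro base) (auto simp: t_def abs_if)
    then show ?thesis unfolding c by (simp add: cos_diff)
  qed
  show "sin (2 * s) \<le> - 1/2" if "s \<in> {of_int k * pi + 2*pi/3..of_int k * pi + 5*pi/6}"
  proof -
    have "cos (2 * t - pi - pi/2) \<ge> 1/2" using that by (intro base) (auto simp: t_def abs_if)
    then have "- sin (2 * t) \<ge> 1/2" by (simp only: cos_diff[of "2*t - pi"] cos_diff[of "2*t"] sin_diff[of "2*t"]) simp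
    then show ?thesis unfolding c by simp
  qed
qed

lemma DERIV_mult_exp:
  "(f has_real_derivative D) (at x within S) \<Longrightarrow>
   ((\<lambda>x. f x * exp (K * x)) has_real_derivative (D + K * f x) * exp (K * x)) (at x within S)"
  by (auto intro!: derivative_eq_intros simp: algebra_simps)

text \<open>The function differentiated here is the continuous lift of \<open>arctan (m tan \<phi>)\<close>.\<close>

lemma modified_angle_deriv:
  assumes m: "m x > 0" and dm: "(m has_real_derivative m') (at x)" and d\<phi>: "(\<phi> has_real_derivative \<phi>') (at x)"
  defines "s \<equiv> sin (\<phi> x)" and "c \<equiv> cos (\<phi> x)"
  shows "((\<lambda>x. \<phi> x + arctan ((m x - 1) * sin (\<phi> x) * cos (\<phi> x) / ((cos (\<phi> x))\<^sup>2 + m x * (sin (\<phi> x))\<^sup>2)))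
     has_real_derivative (m x * \<phi>' + m' * s * c) / (c\<^sup>2 + (m x)\<^sup>2 * s\<^sup>2)) (at x)"
proof -
  let ?m = "m x"
  \<comment> \<open>\<open>D\<close> and \<open>N\<close> are the inner and the cross product of the
    unit vector \<open>(c, s)\<close> with \<open>(c, m s)\<close>, whose squared length is
    \<open>G\<close>. Hence \<open>N / D\<close> is the tangent of the angle between them, and
    \<open>D > 0\<close> keeps that angle in the range of \<open>arctan\<close>.\<close>
  define D where "D = c\<^sup>2 + ?m * s\<^sup>2"
  define G where "G = c\<^sup>2 + ?m\<^sup>2 * s\<^sup>2"
  define N where "N = (?m - 1) * s * c"
  define N' where "N' = m' * s * c + (?m - 1) * (c\<^sup>2 - s\<^sup>2) * \<phi>'"
  define D' where "D' = m' * s\<^sup>2 + 2 * (?m - 1) * s * c * \<phi>'"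
  have sc: "c\<^sup>2 = 1 - s\<^sup>2" unfolding s_def c_def by (simp add: cos_squared_eq)
  have "s = 0 \<Longrightarrow> c \<noteq> 0" using sc by auto
  then have D: "D > 0" and G: "G > 0"
    using m unfolding D_def G_def by (cases "s = 0"; auto intro!: add_nonneg_pos)+
  have dN: "((\<lambda>x. (m x - 1) * sin (\<phi> x) * cos (\<phi> x)) has_real_derivative N') (at x)"
    unfolding N'_def s_def c_def
    by (auto intro!: derivative_eq_intros dm d\<phi> simp: power2_eq_square algebra_simps)
  have dD: "((\<lambda>x. (cos (\<phi> x))\<^sup>2 + m x * (sin (\<phi> x))\<^sup>2) has_real_derivative D') (at x)"
    unfolding D'_def s_def c_def
    by (auto intro!: derivative_eq_intros dm d\<phi> simp: power2_eq_square algebra_simps)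
  have D0: "(cos (\<phi> x))\<^sup>2 + ?m * (sin (\<phi> x))\<^sup>2 \<noteq> 0" using D unfolding D_def s_def c_def by simp
  have quot: "((\<lambda>x. (m x - 1) * sin (\<phi> x) * cos (\<phi> x) / ((cos (\<phi> x))\<^sup>2 + m x * (sin (\<phi> x))\<^sup>2))
      has_real_derivative (N' * D - N * D') / (D * D)) (at x)"
    using DERIV_divide[OF dN dD D0] unfolding D_def N_def s_def c_def .
  have val: "(m x - 1) * sin (\<phi> x) * cos (\<phi> x) / ((cos (\<phi> x))\<^sup>2 + m x * (sin (\<phi> x))\<^sup>2) = N / D"
    unfolding D_def N_def s_def c_def by simp
  have der: "((\<lambda>x. \<phi> x + arctan ((m x - 1) * sin (\<phi> x) * cos (\<phi> x) / ((cos (\<phi> x))\<^sup>2 + m x * (sin (\<phi> x))\<^sup>2)))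
      has_real_derivative \<phi>' + inverse (1 + (N / D)\<^sup>2) * ((N' * D - N * D') / (D * D))) (at x)"
    using DERIV_add[OF d\<phi> DERIV_chain2[OF DERIV_arctan quot]] unfolding val .
  have DN: "D\<^sup>2 + N\<^sup>2 = G"
  proof -
    have "D\<^sup>2 + N\<^sup>2 - G = (c\<^sup>2 + s\<^sup>2 - 1) * G"
      unfolding D_def N_def G_def by algebra
    then show ?thesis using sc by simp
  qed
  have "inverse (1 + (N / D)\<^sup>2) * ((N' * D - N * D') / (D * D)) = (N' * D - N * D') / G"
  proof -
    have "1 + (N / D)\<^sup>2 = G / D\<^sup>2" using D DN by (simp add: field_simps power_divide)
    then have "inverse (1 + (N / D)\<^sup>2) = D * D / G" by (simp add: power2_eq_square)
    then show ?thesis using D by simp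
  qed
  moreover have "\<phi>' * G + (N' * D - N * D') = ?m * \<phi>' + m' * s * c"
  proof -
    \<comment> \<open>The factor \<open>c^2 + s^2 - 1\<close> is displayed, which turns an identity
      on the unit circle into one between polynomials.\<close>
    have "\<phi>' * G + (N' * D - N * D') - (?m * \<phi>' + m' * s * c) =
        (c\<^sup>2 + s\<^sup>2 - 1) * (m' * s * c + \<phi>' * ((?m - 1) * (c\<^sup>2 - ?m * s\<^sup>2) + ?m))"
      unfolding D_def N_def G_def N'_def D'_def by algebra
    then show ?thesis using sc by simp
  qed
  then have "\<phi>' + (N' * D - N * D') / G = (?m * \<phi>' + m' * s * c) / G"
    using G by (simp add: field_simps)
  ultimately show ?thesis using der unfolding G_def by simp
qed

section \<open>The angle and its dependence on the spectral parameter\<close>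

locale pruefer =
  fixes a \<mu> \<phi>0 :: real and P :: "real \<Rightarrow> real"
  assumes a: "a > 0" and \<mu>: "\<mu> > 0"
    and contP: "continuous_on {a..} P" and limP: "(P \<longlongrightarrow> 0) at_top"
    and \<phi>0: "0 \<le> \<phi>0" "\<phi>0 \<le> 2 * pi"
begin

text \<open>\<open>\<mu> * E\<close> is the deviation from \<open>\<mu>^2\<close> of the coefficient
  in the equation for the quasi-derivative: the spectral term, and the square of \<open>P\<close>
  that replaces \<open>V\<close>. It tends to 0 at infinity, and \<open>E l x < \<mu>\<close> marks
  the classically forbidden region.\<close>

definition E :: "real \<Rightarrow> real \<Rightarrow> real" where
  "E l x = ((l + 1/4) / x\<^sup>2 + (P x)\<^sup>2) / \<mu>"

definition F :: "real \<Rightarrow> real \<Rightarrow> real \<Rightarrow> real" where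
  "F l x s = \<mu> * cos (2 * s) + P x * sin (2 * s) + E l x * (sin s)\<^sup>2"

definition ph :: "real \<Rightarrow> real \<Rightarrow> real" where
  "ph l = (SOME f. f a = \<phi>0 \<and> (\<forall>x\<ge>a. (f has_real_derivative F l x (f x)) (at x within {a..})))"

lemma P_bounded: "\<exists>B>0. \<forall>x\<ge>a. \<bar>P x\<bar> \<le> B"
proof -
  have "\<forall>\<^sub>F x in at_top. \<bar>P x\<bar> < 1"
    using tendstoD[OF limP, of 1] by (simp add: dist_real_def)
  then obtain c where c: "\<And>x. x \<ge> c \<Longrightarrow> \<bar>P x\<bar> < 1" by (auto simp: eventually_at_top_linorder)
  have "continuous_on {a..c} P" using contP by (rule continuous_on_subset) auto
  then have "bounded (P ` {a..c})" by (intro compact_imp_bounded compact_continuous_image) auto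
  then obtain C where C: "C > 0" "\<And>x. x \<in> {a..c} \<Longrightarrow> \<bar>P x\<bar> \<le> C"
    unfolding bounded_pos real_norm_def by (meson imageI)
  show ?thesis
  proof (intro exI[of _ "C + 1"] conjI allI impI)
    fix x assume "x \<ge> a"
    then show "\<bar>P x\<bar> \<le> C + 1" using C(1) C(2)[of x] c[of x] by (cases "x \<le> c") auto
  qed (use C in auto)
qed

lemma F_Lipschitz: "\<bar>F l x s - F l x t\<bar> \<le> 2 * (\<mu> + \<bar>P x\<bar> + \<bar>E l x\<bar>) * \<bar>s - t\<bar>"
proof -
  let ?c = "cos (2 * s) - cos (2 * t)" and ?s = "sin (2 * s) - sin (2 * t)" and ?q = "(sin s)\<^sup>2 - (sin t)\<^sup>2"
  let ?m = "2 * \<bar>s - t\<bar>"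
  have m: "2 * \<bar>s - t\<bar> = \<bar>2 * s - 2 * t\<bar>" by (simp add: abs_if)
  have b: "\<bar>?c\<bar> \<le> ?m" "\<bar>?s\<bar> \<le> ?m" "\<bar>?q\<bar> \<le> ?m"
    unfolding m using abs_cos_diff_le abs_sin_diff_le abs_sin_sq_diff_le[of s t, unfolded m] by blast+
  have "F l x s - F l x t = \<mu> * ?c + P x * ?s + E l x * ?q"
    by (simp add: F_def algebra_simps)
  moreover have "\<bar>\<mu> * ?c\<bar> \<le> \<mu> * ?m" using b \<mu> by (simp only: abs_mult abs_of_pos mult_left_mono)
  moreover have "\<bar>P x * ?s\<bar> \<le> \<bar>P x\<bar> * ?m" using b by (simp only: abs_mult) (intro mult_left_mono, auto)
  moreover have "\<bar>E l x * ?q\<bar> \<le> \<bar>E l x\<bar> * ?m" using b by (simp only: abs_mult) (intro mult_left_mono, auto)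
  ultimately have "\<bar>F l x s - F l x t\<bar> \<le> \<mu> * ?m + \<bar>P x\<bar> * ?m + \<bar>E l x\<bar> * ?m" by linarith
  then show ?thesis by (simp add: algebra_simps)
qed

text \<open>A Lipschitz constant in the angle that is uniform in \<open>x\<close> and in bounded
  \<open>l\<close>; uniformity in \<open>l\<close> is what continuity in the parameter rests
  on.\<close>

definition KL :: "real \<Rightarrow> real" where
  "KL \<Lambda> = (SOME K. K > 0 \<and> (\<forall>l x s t. \<bar>l\<bar> \<le> \<Lambda> \<longrightarrow> x \<ge> a \<longrightarrow> \<bar>F l x s - F l x t\<bar> \<le> K * \<bar>s - t\<bar>))"

lemma KL: "KL \<Lambda> > 0" "\<bar>l\<bar> \<le> \<Lambda> \<Longrightarrow> x \<ge> a \<Longrightarrow> \<bar>F l x s - F l x t\<bar> \<le> KL \<Lambda> * \<bar>s - t\<bar>"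
proof -
  obtain B where B: "B > 0" "\<And>x. x \<ge> a \<Longrightarrow> \<bar>P x\<bar> \<le> B" using P_bounded by blast
  define C where "C = ((\<bar>\<Lambda>\<bar> + 1/4) / a\<^sup>2 + B\<^sup>2) / \<mu>"
  have C: "C \<ge> 0" using \<mu> by (simp add: C_def)
  have "\<exists>K. K > 0 \<and> (\<forall>l x s t. \<bar>l\<bar> \<le> \<Lambda> \<longrightarrow> x \<ge> a \<longrightarrow> \<bar>F l x s - F l x t\<bar> \<le> K * \<bar>s - t\<bar>)"
  proof (intro exI[of _ "2 * (\<mu> + B + C)"] conjI allI impI)
    fix l x s t assume l: "\<bar>l\<bar> \<le> \<Lambda>" and x: "x \<ge> a"
    have "a\<^sup>2 \<le> x\<^sup>2" using x a by (intro power_mono) auto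
    then have "\<bar>(l + 1/4) / x\<^sup>2\<bar> \<le> (\<bar>\<Lambda>\<bar> + 1/4) / a\<^sup>2"
      unfolding abs_divide using l a by (intro frac_le) auto
    moreover have "(P x)\<^sup>2 \<le> B\<^sup>2" using B(2)[OF x] B(1) by (simp add: abs_le_square_iff[symmetric])
    ultimately have "\<bar>(l + 1/4) / x\<^sup>2 + (P x)\<^sup>2\<bar> \<le> (\<bar>\<Lambda>\<bar> + 1/4) / a\<^sup>2 + B\<^sup>2"
      by (intro order_trans[OF abs_triangle_ineq] add_mono) auto
    then have "\<bar>E l x\<bar> \<le> C" using \<mu> unfolding E_def C_def abs_divide by (simp add: divide_right_mono)
    then have "2 * (\<mu> + \<bar>P x\<bar> + \<bar>E l x\<bar>) * \<bar>s - t\<bar> \<le> 2 * (\<mu> + B + C) * \<bar>s - t\<bar>"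
      using B(2)[OF x] by (intro mult_right_mono) auto
    then show "\<bar>F l x s - F l x t\<bar> \<le> 2 * (\<mu> + B + C) * \<bar>s - t\<bar>"
      using F_Lipschitz[of l x s t] by linarith
  qed (use \<mu> B C in auto)
  from someI_ex[OF this, folded KL_def]
  show "KL \<Lambda> > 0" "\<bar>l\<bar> \<le> \<Lambda> \<Longrightarrow> x \<ge> a \<Longrightarrow> \<bar>F l x s - F l x t\<bar> \<le> KL \<Lambda> * \<bar>s - t\<bar>" by blast+
qed

lemma contE: "continuous_on {a..} (E l)"
  using a unfolding E_def[abs_def] by (intro continuous_intros contP) (auto simp: \<mu> less_imp_neq[symmetric])

lemma ph_ex: "\<exists>f. f a = \<phi>0 \<and> (\<forall>x\<ge>a. (f has_real_derivative F l x (f x)) (at x within {a..}))"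
proof (rule global_Picard)
  have fst': "continuous_on ({a..} \<times> UNIV) (\<lambda>p :: real \<times> real. g (fst p))" if "continuous_on {a..} g" for g :: "real \<Rightarrow> real"
    by (rule continuous_on_compose2[OF that]) (auto intro!: continuous_intros)
  show "continuous_on ({a..} \<times> UNIV) (\<lambda>p. F l (fst p) (snd p))"
    unfolding F_def by (intro continuous_intros fst' contP contE)
  fix b
  show "\<exists>K>0. \<forall>x\<in>{a..b}. \<forall>s t. \<bar>F l x s - F l x t\<bar> \<le> K * \<bar>s - t\<bar>"
    using KL(1)[of "\<bar>l\<bar>"] KL(2)[of l "\<bar>l\<bar>"] by (intro exI[of _ "KL \<bar>l\<bar>"]) auto
qed

lemma ph_a: "ph l a = \<phi>0"
  and ph_deriv: "x \<ge> a \<Longrightarrow> (ph l has_real_derivative F l x (ph l x)) (at x within {a..})"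
  using someI_ex[OF ph_ex[of l]] unfolding ph_def[symmetric] by blast+

lemma ph_cont: "continuous_on {a..} (ph l)"
  by (rule half_line_continuous_on[OF ph_deriv]) auto

lemma E_mono: "l \<le> l' \<Longrightarrow> E l x \<le> E l' x"
  unfolding E_def using \<mu> by (intro divide_right_mono add_right_mono) auto

lemma F_mono: "l \<le> l' \<Longrightarrow> F l x s \<le> F l' x s"
  unfolding F_def using E_mono by (simp add: mult_right_mono)

lemma F_diff: "F l' x s - F l x s = (l' - l) / (x\<^sup>2 * \<mu>) * (sin s)\<^sup>2"
proof -
  have "E l' x - E l x = (l' - l) / (x\<^sup>2 * \<mu>)"
    unfolding E_def diff_divide_distrib[symmetric] by (simp flip: diff_divide_distrib)
  then show ?thesis unfolding F_def by (simp flip: left_diff_distrib)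
qed

lemma dph_deriv:
  "x \<ge> a \<Longrightarrow> ((\<lambda>x. ph l' x - ph l x) has_real_derivative F l' x (ph l' x) - F l x (ph l x)) (at x within {a..})"
  by (intro derivative_intros ph_deriv)

text \<open>\<open>F\<close> grows with \<open>l\<close> and is Lipschitz in the angle, so where the
  difference of the angles is negative its derivative is at least a constant times the difference;
  the comparison lemma then applies.\<close>

lemma ph_mono:
  assumes "l \<le> l'" "x \<ge> a"
  shows "ph l x \<le> ph l' x"
proof -
  have "ph l' x - ph l x \<ge> 0"
  proof (rule half_line_comparison[OF dph_deriv, of a x _ _ "KL \<bar>l\<bar>"])
    fix x assume x: "a < x" and neg: "ph l' x - ph l x < 0"
    have "\<bar>F l x (ph l' x) - F l x (ph l x)\<bar> \<le> KL \<bar>l\<bar> * \<bar>ph l' x - ph l x\<bar>" using KL(2)[of l "\<bar>l\<bar>" x] x by simp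
    moreover have "KL \<bar>l\<bar> * \<bar>ph l' x - ph l x\<bar> = - (KL \<bar>l\<bar> * (ph l' x - ph l x))"
      using neg by (simp only: abs_of_neg mult_minus_right)
    ultimately have "F l x (ph l' x) - F l x (ph l x) \<ge> KL \<bar>l\<bar> * (ph l' x - ph l x)" by linarith
    then show "KL \<bar>l\<bar> * (ph l' x - ph l x) \<le> F l' x (ph l' x) - F l x (ph l x)"
      using F_mono[OF assms(1), of x "ph l' x"] by linarith
  qed (use assms in \<open>auto simp: ph_a\<close>)
  then show ?thesis by simp
qed

lemma F_at_zero: "sin s = 0 \<Longrightarrow> F l x s = \<mu>"
  by (simp add: F_def sin_double cos_double_sin)

text \<open>The difference times an exponential is nonnegative and nondecreasing, so equality at
  \<open>x\<close> spreads back to all of \<open>{a..x}\<close>. There the two right-hand sides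
  agree, which forces the sine of the angle to vanish on an interval; but at zeros of the sine the
  angle moves with speed \<mu>.\<close>

lemma ph_strict_mono:
  assumes "l < l'" "x > a"
  shows "ph l x < ph l' x"
proof (rule ccontr)
  assume "\<not> ph l x < ph l' x"
  then have eqx: "ph l' x - ph l x = 0" using ph_mono[of l l' x] assms by simp
  let ?d = "\<lambda>x. ph l' x - ph l x" and ?K = "KL \<bar>l\<bar>"
  have d0: "?d y \<ge> 0" if "y \<ge> a" for y using ph_mono[of l l' y] assms that by simp
  have der: "((\<lambda>x. ?d x * exp (?K * x)) has_real_derivative
      (F l' x (ph l' x) - F l x (ph l x) + ?K * ?d x) * exp (?K * x)) (at x within {a..})" if "a \<le> x" for x
    by (rule DERIV_mult_exp[OF dph_deriv[OF that]])
  have nn: "(F l' y (ph l' y) - F l y (ph l y) + ?K * ?d y) * exp (?K * y) \<ge> 0" if "y \<ge> a" for y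
  proof -
    have "\<bar>F l y (ph l' y) - F l y (ph l y)\<bar> \<le> ?K * \<bar>?d y\<bar>" using KL(2)[of l "\<bar>l\<bar>" y] that by simp
    then have "F l y (ph l' y) - F l y (ph l y) + ?K * ?d y \<ge> 0" using d0[OF that] by simp
    then show ?thesis using F_mono[of l l' y "ph l' y"] assms by simp
  qed
  have z: "?d y = 0" if y: "a \<le> y" "y \<le> x" for y
  proof -
    have "?d y * exp (?K * y) \<le> ?d x * exp (?K * x)"
      by (rule half_line_nondecreasing[OF der, of y x]) (use y nn in auto)
    then show ?thesis using eqx d0[OF y(1)] by (simp add: mult_le_0_iff)
  qed
  have s0: "sin (ph l' y) = 0" if y: "a < y" "y < x" for y
  proof -
    have "((\<lambda>x. ?d x) has_real_derivative F l' y (ph l' y) - F l y (ph l y)) (at y)"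
      by (rule half_line_DERIV[OF dph_deriv y(1)])
    moreover have "((\<lambda>x. ?d x) has_real_derivative 0) (at y)"
    proof (rule has_field_derivative_transform_within_open[of "\<lambda>_. 0" _ _ "{a<..<x}"])
      show "\<And>u. u \<in> {a<..<x} \<Longrightarrow> 0 = ?d u" using z by simp
    qed (use y in auto)
    ultimately have "F l' y (ph l' y) - F l y (ph l y) = 0" by (rule DERIV_unique)
    moreover have "ph l y = ph l' y" using z[of y] y by simp
    ultimately have "(l' - l) / (y\<^sup>2 * \<mu>) * (sin (ph l' y))\<^sup>2 = 0" using F_diff[of l' y "ph l' y" l] by simp
    then show ?thesis using assms y a \<mu> by simp
  qed
  define y where "y = (a + x) / 2"
  have y: "a < y" "y < x" using assms by (auto simp: y_def)
  have "((\<lambda>u. sin (ph l' u)) has_real_derivative cos (ph l' y) * F l' y (ph l' y)) (at y)"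
    using half_line_DERIV[OF ph_deriv y(1), of l'] by (auto intro!: derivative_eq_intros)
  moreover have "((\<lambda>u. sin (ph l' u)) has_real_derivative 0) (at y)"
  proof (rule has_field_derivative_transform_within_open[of "\<lambda>_. 0" _ _ "{a<..<x}"])
    show "\<And>u. u \<in> {a<..<x} \<Longrightarrow> 0 = sin (ph l' u)" using s0 by simp
  qed (use y in auto)
  ultimately have "cos (ph l' y) * F l' y (ph l' y) = 0" by (rule DERIV_unique)
  moreover have "cos (ph l' y) \<noteq> 0" using s0[OF y] sin_zero_abs_cos_one by fastforce
  ultimately show False using F_at_zero[OF s0[OF y]] \<mu> by simp
qed

text \<open>Gronwall's estimate, the forcing term being at most
  \<open>(l' - l) / (a\<^sup>2 * \<mu>)\<close>. The constant depends on \<open>x\<close>, which is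
  harmless for continuity in \<open>l\<close> at a fixed point.\<close>

lemma ph_Lipschitz_param:
  assumes "x \<ge> a" "\<bar>l\<bar> \<le> \<Lambda>" "l \<le> l'"
  shows "ph l' x - ph l x \<le> exp (KL \<Lambda> * x) * ((x - a) / (a\<^sup>2 * \<mu>)) * (l' - l)"
proof -
  let ?d = "\<lambda>x. ph l' x - ph l x" and ?K = "KL \<Lambda>" and ?c = "(l' - l) / (a\<^sup>2 * \<mu>)"
  have c: "?c \<ge> 0" using assms \<mu> a by simp
  have der: "((\<lambda>x. ?c * x - ?d x * exp (- ?K * x)) has_real_derivative
      ?c - (F l' x (ph l' x) - F l x (ph l x) - ?K * ?d x) * exp (- ?K * x)) (at x within {a..})" if "a \<le> x" for x
  proof -
    have "((\<lambda>x. ?d x * exp (- ?K * x)) has_real_derivative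
      (F l' x (ph l' x) - F l x (ph l x) + (- ?K) * ?d x) * exp (- ?K * x)) (at x within {a..})"
      by (rule DERIV_mult_exp[OF dph_deriv[OF that]])
    from DERIV_diff[OF DERIV_cmult_Id[of ?c] this] show ?thesis by (simp add: algebra_simps)
  qed
  have "?c * a - ?d a * exp (- ?K * a) \<le> ?c * x - ?d x * exp (- ?K * x)"
  proof (rule half_line_nondecreasing[OF der])
    fix y assume y: "a < y"
    have "\<bar>F l y (ph l' y) - F l y (ph l y)\<bar> \<le> ?K * \<bar>?d y\<bar>" using KL(2)[of l \<Lambda> y] y assms by simp
    then have 1: "F l y (ph l' y) - F l y (ph l y) - ?K * ?d y \<le> 0" using ph_mono[of l l' y] assms y by simp
    have "F l' y (ph l' y) - F l y (ph l' y) = (l' - l) / (y\<^sup>2 * \<mu>) * (sin (ph l' y))\<^sup>2" by (rule F_diff)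
    also have "\<dots> \<le> ?c * 1"
    proof (rule mult_mono)
      have "a\<^sup>2 * \<mu> \<le> y\<^sup>2 * \<mu>" using y a \<mu> by (intro mult_right_mono power_mono) auto
      then show "(l' - l) / (y\<^sup>2 * \<mu>) \<le> ?c" using assms a \<mu> y by (intro divide_left_mono mult_pos_pos) auto
      show "(sin (ph l' y))\<^sup>2 \<le> 1" by (simp add: abs_square_le_1)
    qed (use c in auto)
    finally have "F l' y (ph l' y) - F l y (ph l y) - ?K * ?d y \<le> ?c" using 1 by linarith
    then have "(F l' y (ph l' y) - F l y (ph l y) - ?K * ?d y) * exp (- ?K * y) \<le> ?c * exp (- ?K * y)"
      by (rule mult_right_mono) simp
    also have "\<dots> \<le> ?c * 1" using c KL(1)[of \<Lambda>] y a by (intro mult_left_mono) auto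
    finally show "0 \<le> ?c - (F l' y (ph l' y) - F l y (ph l y) - ?K * ?d y) * exp (- ?K * y)" by simp
  qed (use assms in auto)
  moreover have "?d a * exp (- ?K * a) = 0" by (simp add: ph_a)
  moreover have "?c * (x - a) = ?c * x - ?c * a" by (rule right_diff_distrib)
  ultimately have "?d x * exp (- ?K * x) \<le> ?c * (x - a)" by linarith
  then have "?d x * exp (- ?K * x) * exp (?K * x) \<le> ?c * (x - a) * exp (?K * x)"
    by (rule mult_right_mono) simp
  moreover have "?d x * exp (- ?K * x) * exp (?K * x) = ?d x" by (simp add: mult.assoc flip: exp_add)
  moreover have "?c * (x - a) * exp (?K * x) = exp (KL \<Lambda> * x) * ((x - a) / (a\<^sup>2 * \<mu>)) * (l' - l)"
    by (simp add: mult_ac)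
  ultimately show ?thesis by (simp only:)
qed

lemma ph_cont_param:
  assumes "x \<ge> a"
  shows "continuous_on S (\<lambda>l. ph l x)"
proof -
  have "continuous_on {-\<Lambda>..\<Lambda>} (\<lambda>l. ph l x)" for \<Lambda>
  proof (rule continuous_onI)
    define C where "C = exp (KL \<Lambda> * x) * ((x - a) / (a\<^sup>2 * \<mu>)) + 1"
    have C0: "exp (KL \<Lambda> * x) * ((x - a) / (a\<^sup>2 * \<mu>)) \<ge> 0" using assms a \<mu> by simp
    then have C: "C > 0" by (simp add: C_def)
    have L: "\<bar>ph l' x - ph l x\<bar> \<le> C * \<bar>l' - l\<bar>" if "l \<in> {-\<Lambda>..\<Lambda>}" "l' \<in> {-\<Lambda>..\<Lambda>}" "l \<le> l'" for l l'
    proof -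
      have "ph l' x - ph l x \<le> exp (KL \<Lambda> * x) * ((x - a) / (a\<^sup>2 * \<mu>)) * (l' - l)"
        using that by (intro ph_Lipschitz_param assms) auto
      also have "\<dots> \<le> C * (l' - l)" using that by (intro mult_right_mono) (auto simp: C_def)
      finally show ?thesis using ph_mono[OF that(3) assms] that by simp
    qed
    fix l e :: real assume l: "l \<in> {-\<Lambda>..\<Lambda>}" and e: "e > 0"
    show "\<exists>d>0. \<forall>l'\<in>{-\<Lambda>..\<Lambda>}. dist l' l < d \<longrightarrow> dist (ph l' x) (ph l x) \<le> e"
    proof (intro exI[of _ "e / C"] conjI ballI impI)
      fix l' assume l': "l' \<in> {-\<Lambda>..\<Lambda>}" "dist l' l < e / C"
      have "\<bar>ph l' x - ph l x\<bar> \<le> C * \<bar>l' - l\<bar>"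
        using L[OF l l'(1)] L[OF l'(1) l] by (cases "l \<le> l'") (auto simp: abs_minus_commute)
      also have "\<dots> \<le> C * (e / C)" using l'(2) C by (intro mult_left_mono) (auto simp: dist_real_def)
      finally show "dist (ph l' x) (ph l x) \<le> e" using C by (simp add: dist_real_def)
    qed (use e C in auto)
  qed
  then have "continuous (at l) (\<lambda>l. ph l x)" for l
    by (rule continuous_on_interior[of "{-(\<bar>l\<bar>+1)..\<bar>l\<bar>+1}"]) auto
  then show ?thesis by (simp add: continuous_at_imp_continuous_on)
qed

text \<open>At multiples of pi the right-hand side is \<mu> for all \<open>l\<close> and
  \<open>x\<close>, so such a level is never crossed downwards. Consequently angles stay nonnegative
  and lose at most pi.\<close>

lemma ph_barrier_ge:
  assumes "sin c = 0" "a \<le> p" "p \<le> q" "ph l p \<ge> c"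
  shows "ph l q \<ge> c"
  by (rule half_line_barrier_ge[OF ph_deriv assms(2-4)]) (use assms(1) F_at_zero \<mu> in auto)

lemma ph_nonneg: "x \<ge> a \<Longrightarrow> ph l x \<ge> 0"
  using ph_barrier_ge[of 0 a x l] \<phi>0 by (simp add: ph_a)

lemma ph_after_ge:
  assumes "a \<le> p" "p \<le> q"
  shows "ph l q \<ge> ph l p - pi"
proof -
  define k where "k = \<lfloor>ph l p / pi\<rfloor>"
  have k: "of_int k * pi \<le> ph l p" "ph l p < (of_int k + 1) * pi"
    using floor_correct[of "ph l p / pi"] pi_gt_zero
    unfolding k_def[symmetric] by (simp_all add: pos_le_divide_eq pos_divide_less_eq)
  have "ph l q \<ge> of_int k * pi"
    by (rule ph_barrier_ge[OF _ assms]) (use k in \<open>auto simp: sin_zero_iff_int2\<close>)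
  then show ?thesis using k by (simp add: algebra_simps)
qed

text \<open>At odd multiples of pi/2 the right-hand side is \<open>E l x - \<mu>\<close>, which is
  negative in the forbidden region; there these levels are never crossed upwards.\<close>

lemma ph_after_le:
  assumes "a \<le> p" "p \<le> q" and small: "\<And>x. x \<ge> p \<Longrightarrow> E l x < \<mu>"
  shows "ph l q \<le> ph l p + pi"
proof -
  define k where "k = \<lceil>(ph l p - pi/2) / pi\<rceil>"
  have "of_int k - 1 < (ph l p - pi/2) / pi" "(ph l p - pi/2) / pi \<le> of_int k"
    using ceiling_correct[of "(ph l p - pi/2) / pi"] unfolding k_def[symmetric] by simp_all
  then have "(of_int k - 1) * pi < ph l p - pi/2" "ph l p - pi/2 \<le> of_int k * pi"
    by (simp_all only: pos_less_divide_eq pos_divide_le_eq pi_gt_zero)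
  then have k: "ph l p \<le> of_int k * pi + pi/2" "of_int k * pi + pi/2 < ph l p + pi"
    by (simp_all add: left_diff_distrib)
  have "ph l q \<le> of_int k * pi + pi/2"
  proof (rule half_line_barrier_le[OF ph_deriv assms(1,2) k(1)])
    fix x assume x: "p \<le> x" "ph l x = of_int k * pi + pi/2"
    have "sin (of_int k * pi) = 0" by (simp add: sin_zero_iff_int2)
    then have c: "cos (ph l x) = 0" unfolding x(2) by (simp add: cos_add)
    then have "(sin (ph l x))\<^sup>2 = 1" using sin_cos_squared_add[of "ph l x"] by simp
    then show "F l x (ph l x) < 0" using small[OF x(1)] c unfolding F_def cos_double_cos sin_double by simp
  qed
  then show ?thesis using k by linarith
qed

end

section \<open>Behaviour of the angle near infinity\<close>

context pruefer
begin

text \<open>\<open>\<mu> / 4\<close> is half of what \<open>sectors\<close> guarantees for the size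
  of \<open>\<mu> * cos (2 * s)\<close>, so that the sign of \<open>F\<close> survives with the same
  margin. Uniformity in \<open>l\<close> lets one \<open>X\<close> serve a whole interval of
  parameters.\<close>

definition small :: "real \<Rightarrow> real \<Rightarrow> bool" where
  "small \<Lambda> X \<longleftrightarrow> X \<ge> a \<and> (\<forall>x\<ge>X. \<forall>l. \<bar>l\<bar> \<le> \<Lambda> \<longrightarrow> \<bar>P x\<bar> + \<bar>E l x\<bar> \<le> \<mu> / 4)"

lemma small_ex: "\<exists>X\<ge>X0. small \<Lambda> X"
proof -
  define e where "e x = \<bar>P x\<bar> + ((\<bar>\<Lambda>\<bar> + 1/4) / x\<^sup>2 + (P x)\<^sup>2) / \<mu>" for x
  have "((\<lambda>x. (\<bar>\<Lambda>\<bar> + 1/4) / x\<^sup>2) \<longlongrightarrow> 0) at_top" by real_asymp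
  then have "(e \<longlongrightarrow> \<bar>0\<bar> + (0 + 0\<^sup>2) / \<mu>) at_top"
    unfolding e_def[abs_def] using \<mu> by (intro tendsto_intros limP) auto
  then have "\<forall>\<^sub>F x in at_top. e x < \<mu> / 4"
    using \<mu> by (intro order_tendstoD) auto
  then obtain c where c: "\<And>x. x \<ge> c \<Longrightarrow> e x < \<mu> / 4" by (auto simp: eventually_at_top_linorder)
  show ?thesis
  proof (intro exI[of _ "max X0 (max a c)"] conjI)
    show "small \<Lambda> (max X0 (max a c))"
      unfolding small_def
    proof (intro conjI allI impI)
      fix x l assume x: "max X0 (max a c) \<le> x" and l: "\<bar>l\<bar> \<le> \<Lambda>"
      have "\<bar>(l + 1/4) / x\<^sup>2\<bar> \<le> (\<bar>\<Lambda>\<bar> + 1/4) / x\<^sup>2"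
        unfolding abs_divide abs_power2 using l by (intro divide_right_mono) auto
      then have "\<bar>(l + 1/4) / x\<^sup>2 + (P x)\<^sup>2\<bar> \<le> (\<bar>\<Lambda>\<bar> + 1/4) / x\<^sup>2 + (P x)\<^sup>2"
        by (intro order_trans[OF abs_triangle_ineq] add_mono) auto
      then have "\<bar>P x\<bar> + \<bar>E l x\<bar> \<le> e x"
        using \<mu> unfolding E_def e_def abs_divide by (simp add: divide_right_mono)
      then show "\<bar>P x\<bar> + \<bar>E l x\<bar> \<le> \<mu> / 4" using c[of x] x by simp
    qed auto
  qed auto
qed

lemma smallD:
  assumes "small \<Lambda> X" "\<bar>l\<bar> \<le> \<Lambda>" "x \<ge> X"
  shows "x \<ge> a" "\<bar>P x\<bar> + \<bar>E l x\<bar> \<le> \<mu> / 4" "\<bar>F l x s - \<mu> * cos (2 * s)\<bar> \<le> \<mu> / 4"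
proof -
  show "x \<ge> a" and 1: "\<bar>P x\<bar> + \<bar>E l x\<bar> \<le> \<mu> / 4" using assms by (auto simp: small_def)
  have "\<bar>P x * sin (2 * s)\<bar> \<le> \<bar>P x\<bar> * 1" unfolding abs_mult by (intro mult_left_mono) auto
  moreover have "\<bar>E l x * (sin s)\<^sup>2\<bar> \<le> \<bar>E l x\<bar> * 1"
    unfolding abs_mult by (intro mult_left_mono) (auto simp: abs_square_le_1)
  moreover have "F l x s - \<mu> * cos (2 * s) = P x * sin (2 * s) + E l x * (sin s)\<^sup>2"
    by (simp add: F_def)
  ultimately show "\<bar>F l x s - \<mu> * cos (2 * s)\<bar> \<le> \<mu> / 4" using 1 by linarith
qed

lemma F_pos:
  assumes "small \<Lambda> X" "\<bar>l\<bar> \<le> \<Lambda>" "x \<ge> X" "s \<in> {of_int k * pi - pi/6..of_int k * pi + pi/6}"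
  shows "F l x s \<ge> \<mu> / 4"
proof -
  have "\<mu> * (1/2) \<le> \<mu> * cos (2 * s)" using sectors(1)[OF assms(4)] \<mu> by (intro mult_left_mono) auto
  then show ?thesis using smallD(3)[OF assms(1-3), of s] by linarith
qed

lemma F_neg:
  assumes "small \<Lambda> X" "\<bar>l\<bar> \<le> \<Lambda>" "x \<ge> X" "s \<in> {of_int k * pi + pi/3..of_int k * pi + 2*pi/3}"
  shows "F l x s \<le> - \<mu> / 4"
proof -
  have "\<mu> * cos (2 * s) \<le> \<mu> * (- 1/2)" using sectors(2)[OF assms(4)] \<mu> by (intro mult_left_mono) auto
  then show ?thesis using smallD(3)[OF assms(1-3), of s] by linarith
qed

lemma stays_above:
  assumes "small \<Lambda> X" "\<bar>l\<bar> \<le> \<Lambda>" "X \<le> p" "p \<le> q" "c \<in> {of_int k * pi - pi/6..of_int k * pi + pi/6}" "ph l p \<ge> c"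
  shows "ph l q \<ge> c"
proof (rule half_line_barrier_ge[OF ph_deriv _ assms(4,6)])
  fix x assume "p \<le> x" "ph l x = c"
  then show "F l x (ph l x) > 0" using F_pos[OF assms(1,2) _ assms(5), of x] assms(3) \<mu> by auto
qed (use smallD(1)[OF assms(1-3)] in auto)

lemma stays_below:
  assumes "small \<Lambda> X" "\<bar>l\<bar> \<le> \<Lambda>" "X \<le> p" "p \<le> q" "c \<in> {of_int k * pi + pi/3..of_int k * pi + 2*pi/3}" "ph l p \<le> c"
  shows "ph l q \<le> c"
proof (rule half_line_barrier_le[OF ph_deriv _ assms(4,6)])
  fix x assume "p \<le> x" "ph l x = c"
  then show "F l x (ph l x) < 0" using F_neg[OF assms(1,2) _ assms(5), of x] assms(3) \<mu> by auto
qed (use smallD(1)[OF assms(1-3)] in auto)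

text \<open>The angles of the decaying solution lie in the \<open>k\<close>-th decaying sector near infinity; all other
  solutions end up in a growing sector.\<close>

definition decaying :: "real \<Rightarrow> int \<Rightarrow> bool" where
  "decaying l k \<longleftrightarrow> (\<forall>\<^sub>F x in at_top. ph l x \<in> {of_int k * pi + 2*pi/3..of_int k * pi + 5*pi/6})"

definition growing :: "real \<Rightarrow> int \<Rightarrow> bool" where
  "growing l k \<longleftrightarrow> (\<forall>\<^sub>F x in at_top. ph l x \<in> {of_int k * pi + pi/6..of_int k * pi + pi/3})"

text \<open>Both ends of the interval are barriers pointing inwards, and between them and the
  growing sector the angle approaches that sector with speed at least
  \<open>\<mu> / 4\<close>.\<close>

lemma trap:
  assumes X: "small \<Lambda> X" "\<bar>l\<bar> \<le> \<Lambda>" and p: "X \<le> p"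
    and in_trap: "ph l p \<in> {of_int k * pi - pi/6..of_int k * pi + 2*pi/3}"
  shows "growing l k"
proof -
  have lo: "ph l x \<ge> of_int k * pi - pi/6" if "x \<ge> p" for x
    using stays_above[OF X p that, of "of_int k * pi - pi/6" k] in_trap by auto
  have hi: "ph l x \<le> of_int k * pi + 2*pi/3" if "x \<ge> p" for x
    using stays_below[OF X p that, of "of_int k * pi + 2*pi/3" k] in_trap by auto
  have pa: "a \<le> p" using smallD(1)[OF X p] .
  have "\<forall>\<^sub>F x in at_top. ph l x \<ge> of_int k * pi + pi/6"
  proof (rule half_line_eventually_ge[OF ph_deriv pa, where k = "\<mu>/4"])
    fix x assume x: "p \<le> x" and le: "ph l x \<le> of_int k * pi + pi/6"
    then show "F l x (ph l x) \<ge> \<mu> / 4" using F_pos[OF X, of x "ph l x" k] lo[OF x] p by auto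
  qed (use \<mu> in auto)
  moreover have "\<forall>\<^sub>F x in at_top. - ph l x \<ge> - (of_int k * pi + pi/3)"
  proof (rule half_line_eventually_ge[OF DERIV_minus[OF ph_deriv] pa, where k = "\<mu>/4"])
    fix x assume x: "p \<le> x" and le: "- ph l x \<le> - (of_int k * pi + pi/3)"
    then show "- F l x (ph l x) \<ge> \<mu> / 4" using F_neg[OF X, of x "ph l x" k] hi[OF x] p by auto
  qed (use \<mu> in auto)
  ultimately show ?thesis
    unfolding growing_def by eventually_elim auto
qed

text \<open>Beyond \<open>X\<close> the angle starts in a period that ends with the
  \<open>k\<close>-th decaying sector. If it does not stay in this sector, it is at some point below
  it, in the trap with index \<open>k\<close>, or above it, in the trap with index
  \<open>k + 1\<close>.\<close>

lemma trichotomy: "(\<exists>k. decaying l k) \<or> (\<exists>k. growing l k)"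
proof -
  obtain X where X: "small \<bar>l\<bar> X" using small_ex by blast
  have l: "\<bar>l\<bar> \<le> \<bar>l\<bar>" by simp
  define k where "k = \<lfloor>(ph l X + pi/6) / pi\<rfloor>"
  have "of_int k \<le> (ph l X + pi/6) / pi" "(ph l X + pi/6) / pi < of_int k + 1"
    using floor_correct[of "(ph l X + pi/6) / pi"] unfolding k_def[symmetric] by simp_all
  then have "of_int k * pi \<le> ph l X + pi/6" "ph l X + pi/6 < (of_int k + 1) * pi"
    by (simp_all only: pos_le_divide_eq pos_divide_less_eq pi_gt_zero)
  then have k: "ph l X \<ge> of_int k * pi - pi/6" "ph l X \<le> of_int k * pi + 5*pi/6"
    by (simp_all add: distrib_right)
  show ?thesis
  proof (cases "\<forall>x\<ge>X. ph l x \<in> {of_int k * pi + 2*pi/3..of_int k * pi + 5*pi/6}")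
    case True
    then have "decaying l k" unfolding decaying_def eventually_at_top_linorder by blast
    then show ?thesis by blast
  next
    case False
    then obtain p where p: "X \<le> p" "ph l p < of_int k * pi + 2*pi/3 \<or> ph l p > of_int k * pi + 5*pi/6"
      by (auto simp: not_le)
    show ?thesis
    proof (cases "ph l p < of_int k * pi + 2*pi/3")
      case True
      have "ph l p \<ge> of_int k * pi - pi/6"
        using stays_above[OF X l order_refl p(1), of "of_int k * pi - pi/6" k] k by auto
      with True have "growing l k" by (intro trap[OF X l p(1)]) auto
      then show ?thesis by blast
    next
      case False
      have "ph l p \<le> of_int (k+1) * pi + 2*pi/3"
        using stays_below[OF X l order_refl p(1), of "of_int (k+1) * pi + 2*pi/3" "k+1"] k
        by (auto simp: distrib_right)
      moreover have "ph l p \<ge> of_int (k+1) * pi - pi/6"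
        using False p(2) by (auto simp: distrib_right)
      ultimately have "growing l (k+1)" by (intro trap[OF X l p(1)]) auto
      then show ?thesis by blast
    qed
  qed
qed

lemma decaying_nonneg:
  assumes "decaying l k"
  shows "k \<ge> 0"
proof -
  have "\<forall>\<^sub>F x in at_top. x \<ge> a \<and> ph l x \<in> {of_int k * pi + 2*pi/3..of_int k * pi + 5*pi/6}"
    using assms unfolding decaying_def by (intro eventually_conj eventually_ge_at_top)
  then obtain x where "x \<ge> a" "ph l x \<le> of_int k * pi + 5*pi/6"
    using eventually_happens'[of "at_top :: real filter"] by auto
  then have "0 \<le> of_int k * pi + 5*pi/6" using ph_nonneg[of x l] by linarith
  then have "0 \<le> (of_int k + 5/6) * pi" by (simp add: distrib_right)
  then have "0 \<le> real_of_int k + 5/6" using pi_gt_zero by (simp add: zero_le_mult_iff)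
  then show ?thesis by linarith
qed

lemma decaying_unique_index:
  assumes "decaying l k" "decaying l j"
  shows "k = j"
proof -
  have "\<forall>\<^sub>F x in at_top. ph l x \<in> {of_int k * pi + 2*pi/3..of_int k * pi + 5*pi/6} \<and>
      ph l x \<in> {of_int j * pi + 2*pi/3..of_int j * pi + 5*pi/6}"
    using assms unfolding decaying_def by (rule eventually_conj)
  then obtain x where "ph l x \<in> {of_int k * pi + 2*pi/3..of_int k * pi + 5*pi/6}"
      "ph l x \<in> {of_int j * pi + 2*pi/3..of_int j * pi + 5*pi/6}"
    using eventually_happens'[of "at_top :: real filter"] by auto
  then have "of_int k * pi \<le> of_int j * pi + pi/6" "of_int j * pi \<le> of_int k * pi + pi/6" by auto
  then have "of_int k * pi < (of_int j + 1) * pi" "of_int j * pi < (of_int k + 1) * pi"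
    using pi_gt_zero unfolding distrib_right mult_1 by linarith+
  then have "real_of_int k < of_int j + 1" "real_of_int j < of_int k + 1"
    using pi_gt_zero by (simp_all only: mult_less_cancel_right_pos)
  then show ?thesis by linarith
qed

text \<open>Two decaying solutions with the same index would have angles whose difference grows
  exponentially, because the decaying sector is repelling.\<close>

lemma decaying_inj:
  assumes "decaying l k" "decaying l' k"
  shows "l = l'"
proof (rule ccontr)
  assume "l \<noteq> l'"
  have *: False if dec: "decaying l k" "decaying l' k" and less: "l < l'" for l l'
  proof -
    let ?\<Lambda> = "max \<bar>l\<bar> \<bar>l'\<bar>"
    obtain X0 where X0: "\<And>x. x \<ge> X0 \<Longrightarrow> ph l x \<in> {of_int k * pi + 2*pi/3..of_int k * pi + 5*pi/6} \<and>
        ph l' x \<in> {of_int k * pi + 2*pi/3..of_int k * pi + 5*pi/6}"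
      using eventually_conj[OF dec[unfolded decaying_def]] unfolding eventually_at_top_linorder by blast
    obtain X where X: "X \<ge> max X0 (a+1)" "small ?\<Lambda> X" using small_ex by blast
    let ?d = "\<lambda>x. ph l' x - ph l x"
    have dX: "?d X > 0" using ph_strict_mono[OF less, of X] X by simp
    have mono: "?d x \<ge> 0" if "x \<ge> X" for x using ph_mono[of l l' x] less that X by simp
    have rate: "F l' x (ph l' x) - F l x (ph l x) \<ge> \<mu>/2 * ?d x" if x: "x \<ge> X" for x
    proof -
      let ?s = "ph l x" and ?t = "ph l' x"
      have in_sector: "s \<in> {of_int k * pi + 2*pi/3..of_int k * pi + 5*pi/6}" if "?s \<le> s" "s \<le> ?t" for s
        using X0[of x] X x that by auto
      have st: "?s \<le> ?t" using mono[OF x] by simp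
      \<comment> \<open>On the decaying sector the derivative \<open>- 2 * sin (2 * s)\<close> of
        the cosine is at least 1: this is the repulsion. The perturbations consume half of
        it.\<close>
      have "cos (2 * ?s) - ?s \<le> cos (2 * ?t) - ?t"
      proof (rule DERIV_nonneg_imp_nondecreasing[OF st])
        fix s assume s: "?s \<le> s" "s \<le> ?t"
        have "((\<lambda>s. cos (2 * s) - s) has_real_derivative (- 2 * sin (2 * s) - 1)) (at s)"
          by (auto intro!: derivative_eq_intros)
        moreover have "- 2 * sin (2 * s) - 1 \<ge> 0" using sectors(5)[OF in_sector[OF s]] by simp
        ultimately show "\<exists>y. ((\<lambda>s. cos (2 * s) - s) has_real_derivative y) (at s) \<and> 0 \<le> y" by blast
      qed
      then have "\<mu> * (cos (2 * ?t) - cos (2 * ?s)) \<ge> \<mu> * ?d x" using \<mu> by (intro mult_left_mono) auto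
      moreover have "\<bar>P x * (sin (2 * ?t) - sin (2 * ?s))\<bar> \<le> \<bar>P x\<bar> * (2 * ?d x)"
        using abs_sin_diff_le[of "2 * ?t" "2 * ?s"] st unfolding abs_mult by (intro mult_left_mono) auto
      moreover have "\<bar>E l x * ((sin ?t)\<^sup>2 - (sin ?s)\<^sup>2)\<bar> \<le> \<bar>E l x\<bar> * (2 * ?d x)"
        using abs_sin_sq_diff_le[of ?t ?s] st unfolding abs_mult by (intro mult_left_mono) auto
      moreover have "F l x ?t - F l x ?s = \<mu> * (cos (2 * ?t) - cos (2 * ?s)) + P x * (sin (2 * ?t) - sin (2 * ?s)) + E l x * ((sin ?t)\<^sup>2 - (sin ?s)\<^sup>2)"
        by (simp add: F_def algebra_simps)
      ultimately have "F l x ?t - F l x ?s \<ge> \<mu> * ?d x - (\<bar>P x\<bar> + \<bar>E l x\<bar>) * (2 * ?d x)"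
        unfolding distrib_right abs_le_iff by linarith
      moreover have "(\<bar>P x\<bar> + \<bar>E l x\<bar>) * (2 * ?d x) \<le> \<mu>/4 * (2 * ?d x)"
        using smallD(2)[OF X(2), of l x] x mono[OF x] by (intro mult_right_mono) auto
      ultimately show ?thesis using F_mono[of l l' x ?t] less by linarith
    qed
    have aX: "a \<le> X" using X by simp
    have inc: "?d x \<ge> ?d X" if x: "x \<ge> X" for x
    proof (rule half_line_nondecreasing[OF dph_deriv aX x])
      fix y assume "X < y"
      then show "F l' y (ph l' y) - F l y (ph l y) \<ge> 0"
        using rate[of y] mono[of y] \<mu> mult_nonneg_nonneg[of "\<mu>/2" "?d y"] by linarith
    qed
    \<comment> \<open>Long enough for linear growth at the initial rate to gain pi, more than the
      width pi/6 of the sector.\<close>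
    define q where "q = X + 2 * pi / (\<mu> * ?d X)"
    have q: "q \<ge> X" using dX \<mu> by (simp add: q_def)
    have "?d q \<ge> ?d X + \<mu>/2 * ?d X * (q - X)"
    proof (rule half_line_growth[OF dph_deriv aX q])
      fix y assume "X < y"
      then have "\<mu>/2 * ?d X \<le> \<mu>/2 * ?d y" using inc[of y] \<mu> by (intro mult_left_mono) auto
      then show "\<mu>/2 * ?d X \<le> F l' y (ph l' y) - F l y (ph l y)" using rate[of y] \<open>X < y\<close> by linarith
    qed
    also have "\<mu>/2 * ?d X * (q - X) = pi" using dX \<mu> by (simp add: q_def)
    finally have "?d q > pi" using dX by linarith
    moreover have "?d q \<le> pi/6" using X0[of q] q X by auto
    ultimately show False using pi_gt_zero by linarith
  qed
  show False using *[OF assms] *[OF assms(2,1)] \<open>l \<noteq> l'\<close> by linarith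
qed

text \<open>Connectedness of the parameter interval. If no parameter has index \<open>k\<close>,
  each angle leaves the sector after \<open>X\<close>, either below or above. Both are open
  conditions on the parameter, and they exclude each other because the two edges can only be crossed
  outwards. The exit point varies with the parameter, so the intermediate value theorem at one fixed
  \<open>x\<close> would not do.\<close>

lemma decaying_exists:
  assumes X: "small \<Lambda> X" and l: "\<bar>l0\<bar> \<le> \<Lambda>" "\<bar>l1\<bar> \<le> \<Lambda>" "l0 \<le> l1"
    and p: "p \<ge> X" "ph l0 p < of_int k * pi + 2*pi/3" and q: "q \<ge> X" "ph l1 q > of_int k * pi + 5*pi/6"
  shows "\<exists>\<nu>\<in>{l0..l1}. decaying \<nu> k"
proof (rule ccontr)
  assume no: "\<not> (\<exists>\<nu>\<in>{l0..l1}. decaying \<nu> k)"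
  let ?lo = "of_int k * pi + 2*pi/3" and ?hi = "of_int k * pi + 5*pi/6"
  define A where "A = (\<Union>x\<in>{X..}. {l0..l1} \<inter> (\<lambda>\<nu>. ph \<nu> x) -` {..<?lo})"
  define B where "B = (\<Union>x\<in>{X..}. {l0..l1} \<inter> (\<lambda>\<nu>. ph \<nu> x) -` {?hi<..})"
  have Xa: "x \<ge> a" if "x \<ge> X" for x using X that by (auto simp: small_def)
  have "openin (top_of_set {l0..l1}) A" "openin (top_of_set {l0..l1}) B"
    unfolding A_def B_def using Xa
    by (intro openin_Union ballI; auto intro!: continuous_openin_preimage_gen ph_cont_param)+
  moreover have "{l0..l1} \<subseteq> A \<union> B"
  proof
    fix \<nu> assume \<nu>: "\<nu> \<in> {l0..l1}"
    then have "\<not> decaying \<nu> k" using no by blast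
    then have "\<not> (\<forall>x\<ge>X. ph \<nu> x \<in> {?lo..?hi})" unfolding decaying_def eventually_at_top_linorder by blast
    then show "\<nu> \<in> A \<union> B" using \<nu> by (auto simp: A_def B_def not_le)
  qed
  moreover have "A \<inter> B = {}"
  proof (rule ccontr)
    assume "A \<inter> B \<noteq> {}"
    then obtain \<nu> where AB: "\<nu> \<in> A" "\<nu> \<in> B" by blast
    from AB(1) obtain x where \<nu>: "\<nu> \<in> {l0..l1}" and x: "x \<ge> X" "ph \<nu> x < ?lo" unfolding A_def by auto
    from AB(2) obtain y where y: "y \<ge> X" "ph \<nu> y > ?hi" unfolding B_def by auto
    have n: "\<bar>\<nu>\<bar> \<le> \<Lambda>" using \<nu> l by auto
    show False
    proof (cases "x \<le> y")
      case True
      have "ph \<nu> y \<le> ?lo"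
        by (rule stays_below[OF X n x(1) True, of _ k]) (use x in auto)
      then show False using y pi_gt_zero by linarith
    next
      case False
      have "ph \<nu> x \<ge> ?hi"
        by (rule stays_above[OF X n y(1), of _ _ "k+1"]) (use y False in \<open>auto simp: distrib_right\<close>)
      then show False using x pi_gt_zero by linarith
    qed
  qed
  moreover have "l0 \<in> A" using p l by (auto simp: A_def)
  moreover have "l1 \<in> B" using q l by (auto simp: B_def)
  moreover have "connected {l0..l1}" by simp
  ultimately show False unfolding connected_openin by blast
qed

text \<open>With \<open>m = r / (\<mu> x)\<close> and \<open>G = c^2 + m^2 s^2\<close>, where
  \<open>c\<close> and \<open>s\<close> are the cosine and sine of the angle, \<open>F\<close>
  equals \<open>\<mu> G\<close> plus terms free of \<open>r\<close>. Rescaling the tangent by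
  \<open>m\<close> multiplies by \<open>m / G\<close>, so the main term becomes exactly
  \<open>m \<mu> = r / x\<close>, and the rest is bounded whatever the angle is.\<close>

lemma angle_bound:
  assumes l: "l + 1/4 > 0" and r: "r = sqrt (l + 1/4)" and X: "X \<ge> a"
    and B: "\<And>x. x \<ge> a \<Longrightarrow> \<bar>P x\<bar> \<le> B"
  shows "\<bar>ph l X - r * ln (X / a)\<bar> \<le> B * X + (B\<^sup>2 + \<mu>\<^sup>2) * X\<^sup>2 / (2 * r) + ln (X / a) / 2 + 4 * pi"
proof -
  have r0: "r > 0" and r2: "r\<^sup>2 = l + 1/4" using l r by auto
  have B0: "B \<ge> 0" using B[of a] by simp
  define m where "m x = r / (\<mu> * x)" for x
  define \<Phi> where "\<Phi> x = ph l x + arctan ((m x - 1) * sin (ph l x) * cos (ph l x) / ((cos (ph l x))\<^sup>2 + m x * (sin (ph l x))\<^sup>2))" for x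
  define G where "G x = (cos (ph l x))\<^sup>2 + (m x)\<^sup>2 * (sin (ph l x))\<^sup>2" for x
  define \<Phi>' where "\<Phi>' x = (m x * F l x (ph l x) + (- m x / x) * sin (ph l x) * cos (ph l x)) / G x" for x
  \<comment> \<open>A primitive of the error bound \<open>W'\<close>: its terms stem from the mixed
    term with \<open>P\<close>, from the terms with the squared sine, where
    \<open>m * s^2 / G \<le> 1 / m\<close>, and from the derivative of \<open>m\<close>.\<close>
  define W where "W x = B * x + (B\<^sup>2 + \<mu>\<^sup>2) * x\<^sup>2 / (2 * r) + ln x / 2" for x
  define W' where "W' x = B + (B\<^sup>2 + \<mu>\<^sup>2) * x / r + 1 / (2 * x)" for x
  have mpos: "m x > 0" if "x \<ge> a" for x using that a r0 \<mu> by (simp add: m_def)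
  \<comment> \<open>This distance occurs at \<open>X\<close> and at \<open>a\<close>; together with
    \<open>\<phi>0 \<le> 2 * pi\<close> it fits into the summand \<open>4 * pi\<close> of the
    bound.\<close>
  have near: "\<bar>\<Phi> x - ph l x\<bar> \<le> pi/2" for x
  proof -
    have "\<bar>arctan z\<bar> \<le> pi/2" for z
      using arctan_lbound[of z] arctan_ubound[of z] unfolding abs_le_iff by linarith
    then show ?thesis unfolding \<Phi>_def by simp
  qed
  have d\<Phi>: "(\<Phi> has_real_derivative \<Phi>' x) (at x)" if x: "x > a" for x
  proof -
    have dm: "(m has_real_derivative - m x / x) (at x)"
      unfolding m_def[abs_def] using x a \<mu> by (auto intro!: derivative_eq_intros simp: field_simps power2_eq_square)
    have dp: "(ph l has_real_derivative F l x (ph l x)) (at x)" by (rule half_line_DERIV[OF ph_deriv x])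
    show ?thesis
      using modified_angle_deriv[OF mpos dm dp] x unfolding \<Phi>_def[abs_def] \<Phi>'_def G_def by simp
  qed
  have dW: "(W has_real_derivative W' x) (at x)" if "x > a" for x
    unfolding W_def[abs_def] W'_def using that a r0 by (auto intro!: derivative_eq_intros simp: field_simps)
  have main: "\<bar>\<Phi>' x - r / x\<bar> \<le> W' x" if x: "x > a" for x
  proof -
    let ?s = "sin (ph l x)" and ?c = "cos (ph l x)" and ?m = "m x"
    have x0: "x > 0" using x a by simp
    have m: "?m > 0" using mpos[of x] x by simp
    have sc: "?c\<^sup>2 = 1 - ?s\<^sup>2" by (simp add: cos_squared_eq)
    have "?s = 0 \<Longrightarrow> ?c \<noteq> 0" using sc by auto
    then have G: "G x > 0"
      using m unfolding G_def by (cases "?s = 0") (auto intro!: add_nonneg_pos)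
    have El: "E l x = \<mu> * ?m\<^sup>2 + (P x)\<^sup>2 / \<mu>"
      unfolding E_def m_def r2[symmetric] using \<mu> x0 by (simp add: field_simps power2_eq_square)
    have Feq: "F l x (ph l x) = \<mu> * G x + 2 * P x * ?s * ?c + ((P x)\<^sup>2 / \<mu> - \<mu>) * ?s\<^sup>2"
      unfolding F_def El G_def cos_double sin_double by (simp add: algebra_simps)
    have "\<Phi>' x - r / x = (2 * P x * (?m * (?s * ?c)) + ((P x)\<^sup>2 / \<mu> - \<mu>) * (?m * ?s\<^sup>2) - (?m * (?s * ?c)) / x) / G x"
    proof -
      have "r / x = ?m * \<mu>" using \<mu> by (simp add: m_def)
      then have "r / x = ?m * (\<mu> * G x) / G x" using G by simp
      then show ?thesis unfolding \<Phi>'_def Feq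
        by (simp only: diff_divide_distrib[symmetric]) (simp add: algebra_simps)
    qed
    also have "\<dots> = 2 * P x * (?m * (?s * ?c) / G x) + ((P x)\<^sup>2 / \<mu> - \<mu>) * (?m * ?s\<^sup>2 / G x) - (?m * (?s * ?c) / G x) / x"
      by (simp add: add_divide_distrib diff_divide_distrib)
    finally have eq: "\<Phi>' x - r / x = 2 * P x * (?m * (?s * ?c) / G x) + ((P x)\<^sup>2 / \<mu> - \<mu>) * (?m * ?s\<^sup>2 / G x) - (?m * (?s * ?c) / G x) / x" .
    have b1: "\<bar>?m * (?s * ?c) / G x\<bar> \<le> 1/2"
    proof -
      have "2 * \<bar>?m * (?s * ?c)\<bar> \<le> G x"
        using sum_squares_bound[of "\<bar>?c\<bar>" "\<bar>?m * ?s\<bar>"] m by (simp add: G_def abs_mult power_mult_distrib mult_ac)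
      then show ?thesis using G by (simp add: abs_divide field_simps)
    qed
    have b2: "\<bar>?m * ?s\<^sup>2 / G x\<bar> \<le> 1 / ?m"
    proof -
      have "?m * (?m * ?s\<^sup>2) \<le> G x" by (simp add: G_def power2_eq_square)
      then show ?thesis using G m by (simp add: abs_divide abs_mult field_simps)
    qed
    have "\<bar>2 * P x * (?m * (?s * ?c) / G x)\<bar> \<le> 2 * B * (1/2)"
      unfolding abs_mult[of "2 * P x"] using b1 B[of x] x B0 by (intro mult_mono) (auto simp: abs_mult)
    moreover have "\<bar>((P x)\<^sup>2 / \<mu> - \<mu>) * (?m * ?s\<^sup>2 / G x)\<bar> \<le> (B\<^sup>2 / \<mu> + \<mu>) * (1 / ?m)"
      unfolding abs_mult[of "(P x)\<^sup>2 / \<mu> - \<mu>"]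
    proof (intro mult_mono b2)
      have "(P x)\<^sup>2 \<le> B\<^sup>2" using B[of x] x B0 by (simp add: abs_le_square_iff[symmetric])
      then have "(P x)\<^sup>2 / \<mu> \<le> B\<^sup>2 / \<mu>" using \<mu> by (simp add: divide_right_mono)
      moreover have "(P x)\<^sup>2 / \<mu> \<ge> 0" using \<mu> by simp
      ultimately show "\<bar>(P x)\<^sup>2 / \<mu> - \<mu>\<bar> \<le> B\<^sup>2 / \<mu> + \<mu>" using \<mu> unfolding abs_le_iff by linarith
    qed (use \<mu> in auto)
    moreover have "(B\<^sup>2 / \<mu> + \<mu>) * (1 / ?m) = (B\<^sup>2 + \<mu>\<^sup>2) * x / r"
      using \<mu> r0 x0 by (simp add: m_def field_simps power2_eq_square)
    moreover have "\<bar>(?m * (?s * ?c) / G x) / x\<bar> \<le> (1/2) / x"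
      unfolding abs_divide[of _ x] abs_of_pos[OF x0] using b1 x0 by (intro divide_right_mono) auto
    ultimately have "\<bar>\<Phi>' x - r / x\<bar> \<le> 2 * B * (1/2) + (B\<^sup>2 + \<mu>\<^sup>2) * x / r + (1/2) / x"
      unfolding eq by linarith
    then show ?thesis by (simp add: W'_def)
  qed
  have c1: "continuous_on {a..X} m" unfolding m_def using a \<mu> by (intro continuous_intros) auto
  have c2: "continuous_on {a..X} (ph l)" using ph_cont by (rule continuous_on_subset) auto
  have c\<Phi>: "continuous_on {a..X} \<Phi>"
    unfolding \<Phi>_def
  proof (intro continuous_intros c1 c2 ballI)
    fix x assume x: "x \<in> {a..X}"
    have "m x > 0" using mpos[of x] x by simp
    moreover have "sin (ph l x) = 0 \<Longrightarrow> cos (ph l x) \<noteq> 0" using sin_zero_abs_cos_one by fastforce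
    ultimately show "(cos (ph l x))\<^sup>2 + m x * (sin (ph l x))\<^sup>2 \<noteq> 0"
      by (cases "sin (ph l x) = 0") (auto simp: add_nonneg_eq_0_iff)
  qed
  have cW: "continuous_on {a..X} W" unfolding W_def using a r0 by (intro continuous_intros) auto
  have cl: "continuous_on {a..X} (\<lambda>x. r * ln x)" using a by (intro continuous_intros) auto
  have up: "W a - (\<Phi> a - r * ln a) \<le> W X - (\<Phi> X - r * ln X)"
  proof (rule DERIV_nonneg_imp_increasing_open[OF X])
    fix x assume x: "a < x"
    have "((\<lambda>x. W x - (\<Phi> x - r * ln x)) has_real_derivative W' x - (\<Phi>' x - r * (1 / x))) (at x)"
      using x a by (intro DERIV_diff dW d\<Phi> DERIV_cmult DERIV_ln_divide) auto
    moreover have "W' x - (\<Phi>' x - r * (1 / x)) \<ge> 0" using main[OF x] by (simp add: abs_le_iff)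
    ultimately show "\<exists>y. ((\<lambda>x. W x - (\<Phi> x - r * ln x)) has_real_derivative y) (at x) \<and> 0 \<le> y" by blast
  qed (intro continuous_on_diff cW c\<Phi> cl)
  have lo: "W a + (\<Phi> a - r * ln a) \<le> W X + (\<Phi> X - r * ln X)"
  proof (rule DERIV_nonneg_imp_increasing_open[OF X])
    fix x assume x: "a < x"
    have "((\<lambda>x. W x + (\<Phi> x - r * ln x)) has_real_derivative W' x + (\<Phi>' x - r * (1 / x))) (at x)"
      using x a by (intro DERIV_add DERIV_diff dW d\<Phi> DERIV_cmult DERIV_ln_divide) auto
    moreover have "W' x + (\<Phi>' x - r * (1 / x)) \<ge> 0" using main[OF x] unfolding abs_le_iff by simp
    ultimately show "\<exists>y. ((\<lambda>x. W x + (\<Phi> x - r * ln x)) has_real_derivative y) (at x) \<and> 0 \<le> y" by blast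
  qed (intro continuous_on_add continuous_on_diff cW c\<Phi> cl)
  have ln: "ln (X / a) = ln X - ln a" using X a by (simp add: ln_div)
  have "B * a \<ge> 0" "(B\<^sup>2 + \<mu>\<^sup>2) * a\<^sup>2 / (2 * r) \<ge> 0" using B0 a r0 by auto
  then have WW: "W X - W a \<le> B * X + (B\<^sup>2 + \<mu>\<^sup>2) * X\<^sup>2 / (2 * r) + ln (X / a) / 2"
    unfolding W_def ln by (simp add: diff_divide_distrib)
  have "\<bar>\<Phi> X - \<Phi> a - (r * ln X - r * ln a)\<bar> \<le> W X - W a"
    using up lo unfolding abs_le_iff by linarith
  moreover have "r * ln (X / a) = r * ln X - r * ln a" unfolding ln by (rule right_diff_distrib)
  moreover have "0 \<le> ph l a" "ph l a \<le> 2 * pi" using \<phi>0 by (auto simp: ph_a)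
  ultimately show ?thesis
    using near[of X] near[of a] WW unfolding abs_le_iff by linarith
qed

section \<open>Counting the decaying parameters\<close>

lemma ph_zero_bounded: "\<exists>M\<ge>0. \<forall>x\<ge>a. ph 0 x \<le> M"
proof -
  obtain X where X: "small 0 X" using small_ex by blast
  have aX: "a \<le> X" using X by (simp add: small_def)
  have E: "E 0 x < \<mu>" if "x \<ge> X" for x using smallD(2)[OF X _ that, of 0] \<mu> by auto
  have "ph 0 x \<le> ph 0 X + pi" if "x \<ge> a" for x
  proof (cases "x \<le> X")
    case True
    then show ?thesis using ph_after_ge[OF that True, of 0] by simp
  next
    case False
    then show ?thesis using ph_after_le[OF aX, of x 0] E by auto
  qed
  moreover have "ph 0 X + pi \<ge> 0" using ph_nonneg[OF aX, of 0] pi_gt_zero by simp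
  ultimately show ?thesis by blast
qed

text \<open>For a boundary problem these are the eigenvalues up to \<open>l\<close>, all of them
  simple, so the cardinality is the counting function.\<close>

definition spec :: "real \<Rightarrow> real set" where
  "spec l = {\<nu>. \<nu> \<le> l \<and> (\<exists>k. decaying \<nu> k)}"

text \<open>Indices are nonnegative, different for different parameters, and bounded because the
  angle of \<open>l\<close> dominates those of smaller parameters and gains at most pi after
  \<open>X\<close>. One unit of the bound pays for this pi, the other for counting from index
  0.\<close>

lemma counting_upper:
  assumes X: "X \<ge> a" "\<And>x. x \<ge> X \<Longrightarrow> E l x < \<mu>"
  shows "finite (spec l)"
    and "real (card (spec l)) \<le> ph l X / pi + 2"
proof -
  let ?S = "spec l"
  define idx where "idx \<nu> = (SOME k. decaying \<nu> k)" for \<nu>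
  have idx: "decaying \<nu> (idx \<nu>)" if "\<nu> \<in> ?S" for \<nu>
    unfolding idx_def using that by (auto simp: spec_def intro: someI_ex)
  have inj: "inj_on (nat \<circ> idx) ?S"
  proof (rule inj_onI)
    fix \<nu> \<nu>' assume n: "\<nu> \<in> ?S" "\<nu>' \<in> ?S" and "(nat \<circ> idx) \<nu> = (nat \<circ> idx) \<nu>'"
    then have "idx \<nu> = idx \<nu>'"
      using decaying_nonneg[OF idx[OF n(1)]] decaying_nonneg[OF idx[OF n(2)]] by simp
    then show "\<nu> = \<nu>'" using decaying_inj idx[OF n(1)] idx[OF n(2)] by metis
  qed
  define N where "N = nat \<lfloor>ph l X / pi + 1\<rfloor>"
  have sub: "(nat \<circ> idx) ` ?S \<subseteq> {..N}"
  proof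
    fix j assume "j \<in> (nat \<circ> idx) ` ?S"
    then obtain \<nu> where \<nu>: "\<nu> \<in> ?S" "j = nat (idx \<nu>)" by auto
    have "\<forall>\<^sub>F x in at_top. x \<ge> X \<and> ph \<nu> x \<in> {of_int (idx \<nu>) * pi + 2*pi/3..of_int (idx \<nu>) * pi + 5*pi/6}"
      using idx[OF \<nu>(1)] unfolding decaying_def by (intro eventually_conj eventually_ge_at_top)
    then obtain x where x: "x \<ge> X" "of_int (idx \<nu>) * pi + 2*pi/3 \<le> ph \<nu> x"
      using eventually_happens'[of "at_top :: real filter"] by auto
    have "ph \<nu> x \<le> ph l x" using \<nu>(1) x X by (intro ph_mono) (auto simp: spec_def)
    also have "\<dots> \<le> ph l X + pi" by (rule ph_after_le[OF X(1) x(1) X(2)])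
    finally have "of_int (idx \<nu>) * pi \<le> ph l X + pi" using x(2) pi_gt_zero by linarith
    then have "of_int (idx \<nu>) \<le> (ph l X + pi) / pi" by (simp only: pos_le_divide_eq pi_gt_zero)
    then have "of_int (idx \<nu>) \<le> ph l X / pi + 1" by (simp add: add_divide_distrib)
    then have "idx \<nu> \<le> \<lfloor>ph l X / pi + 1\<rfloor>" by (simp only: le_floor_iff)
    then show "j \<in> {..N}" using \<nu>(2) by (simp add: N_def nat_mono)
  qed
  show fin: "finite ?S" using finite_imageD[OF finite_subset[OF sub] inj] by simp
  have "card ?S = card ((nat \<circ> idx) ` ?S)" using card_image[OF inj] by simp
  also have "\<dots> \<le> card {..N}" by (rule card_mono[OF _ sub]) simp
  finally have "card ?S \<le> N + 1" by simp
  moreover have "real N \<le> ph l X / pi + 1"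
    using ph_nonneg[OF X(1), of l] unfolding N_def by (simp add: of_nat_nat)
  ultimately show "real (card ?S) \<le> ph l X / pi + 2" by linarith
qed

text \<open>A sector that lies above \<open>M\<close> and is passed by the angle of \<open>l\<close>
  separates the parameters 0 and \<open>l\<close>, hence belongs to a decaying parameter between
  them; one parameter cannot have two indices. The sectors below \<open>M\<close> cost only a
  constant.\<close>

lemma counting_lower:
  assumes M: "\<And>x. x \<ge> a \<Longrightarrow> ph 0 x \<le> M" "M \<ge> 0" and l: "l \<ge> 0" and X: "X \<ge> a"
    and fin: "finite (spec l)"
  shows "real (card (spec l)) \<ge> ph l X / pi - M / pi - 3"
proof -
  let ?S = "spec l"
  obtain Y where Y: "Y \<ge> X" "small l Y" using small_ex by blast
  define k0 where "k0 = nat \<lceil>M / pi\<rceil>"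
  \<comment> \<open>For \<open>k < k1\<close> the angle at \<open>X\<close> is at least
    \<open>(k + 2) * pi\<close>, so even after losing pi on the way to \<open>Y\<close> it is above
    the \<open>k\<close>-th decaying sector.\<close>
  define k1 where "k1 = nat \<lfloor>ph l X / pi - 1\<rfloor>"
  have "\<exists>\<nu>\<in>{0..l}. decaying \<nu> (int k)" if k: "k \<in> {k0..<k1}" for k
  proof (rule decaying_exists[OF Y(2)])
    have "M / pi \<le> real k" using k unfolding k0_def by (simp add: nat_le_iff ceiling_le_iff)
    then have "M \<le> real k * pi" by (simp only: pos_divide_le_eq pi_gt_zero)
    moreover have "ph 0 Y \<le> M" using M(1) Y X by simp
    ultimately show "ph 0 Y < of_int (int k) * pi + 2*pi/3"
      unfolding of_int_of_nat_eq using pi_gt_zero by linarith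
    have "real k + 1 \<le> ph l X / pi - 1" using k unfolding k1_def by (simp add: less_nat_zero_code nat_less_iff zless_nat_eq_int_zless) linarith
    then have "real k + 2 \<le> ph l X / pi" by simp
    then have "(real k + 2) * pi \<le> ph l X" by (simp only: pos_le_divide_eq pi_gt_zero)
    moreover have "ph l Y \<ge> ph l X - pi" by (rule ph_after_ge[OF X Y(1)])
    ultimately show "ph l Y > of_int (int k) * pi + 5*pi/6"
      unfolding of_int_of_nat_eq distrib_right using pi_gt_zero by linarith
  qed (use l in auto)
  then obtain \<nu> where \<nu>: "\<And>k. k \<in> {k0..<k1} \<Longrightarrow> \<nu> k \<in> {0..l} \<and> decaying (\<nu> k) (int k)" by metis
  have "inj_on \<nu> {k0..<k1}"
  proof (rule inj_onI)
    fix i j assume ij: "i \<in> {k0..<k1}" "j \<in> {k0..<k1}" "\<nu> i = \<nu> j"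
    then have "int i = int j" using \<nu> decaying_unique_index by metis
    then show "i = j" by simp
  qed
  then have "card {k0..<k1} = card (\<nu> ` {k0..<k1})" by (simp add: card_image)
  also have "\<dots> \<le> card ?S"
  proof (rule card_mono[OF fin])
    show "\<nu> ` {k0..<k1} \<subseteq> ?S" using \<nu> by (force simp: spec_def)
  qed
  finally have "real k1 - real k0 \<le> real (card ?S)" by simp
  moreover have "real k1 \<ge> ph l X / pi - 2" unfolding k1_def by linarith
  moreover have "real k0 \<le> M / pi + 1"
    using M(2) unfolding k0_def by (simp add: of_nat_nat)
  ultimately show ?thesis by linarith
qed

text \<open>Pi times the count lies between \<open>f - h\<close> and \<open>f + h\<close>. Here
  \<open>f\<close> is asymptotic to \<open>sqrt l * ln l / 2\<close>, while \<open>h\<close> is only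
  \<open>O (sqrt l)\<close>.\<close>

lemma counting_asymptotics:
  "((\<lambda>l. pi * real (card (spec l)) / (sqrt l * ln l / 2)) \<longlongrightarrow> 1) at_top"
proof -
  obtain B where B: "B > 0" "\<And>x. x \<ge> a \<Longrightarrow> \<bar>P x\<bar> \<le> B" using P_bounded by blast
  obtain M where M: "M \<ge> 0" "\<And>x. x \<ge> a \<Longrightarrow> ph 0 x \<le> M" using ph_zero_bounded by blast
  have "\<forall>\<^sub>F x in at_top. \<bar>P x\<bar> < \<mu> / 2"
    using tendstoD[OF limP, of "\<mu>/2"] \<mu> by (simp add: dist_real_def)
  then obtain X1 where X1: "\<And>x. x \<ge> X1 \<Longrightarrow> \<bar>P x\<bar> < \<mu> / 2" by (auto simp: eventually_at_top_linorder)
  define r where "r l = sqrt (l + 1/4)" for l :: real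
  \<comment> \<open>The factor 2 makes the spectral part of \<open>\<mu> * E\<close> at most
    \<open>\<mu>\<^sup>2 / 4\<close> from here on; with \<open>P\<close> below
    \<open>\<mu> / 2\<close> in absolute value this gives \<open>E < \<mu>\<close>.\<close>
  define X where "X l = 2 * r l / \<mu>" for l
  define N where "N l = real (card (spec l))" for l
  define c where "c = ln (2 / (\<mu> * a))"
  \<comment> \<open>\<open>D * r l\<close> is the value at \<open>X l\<close> of the first two error
    terms of \<open>angle_bound\<close>; \<open>C\<close> collects the multiples of pi and
    \<open>M\<close> from the two counting bounds.\<close>
  define D where "D = 2 * B / \<mu> + 2 * (B\<^sup>2 + \<mu>\<^sup>2) / \<mu>\<^sup>2"
  define C where "C = 8 * pi + M"
  define f where "f l = r l * ln (r l) + c * r l" for l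
  define h where "h l = D * r l + ln (r l) / 2 + c / 2 + C" for l
  have "filterlim X at_top at_top"
    unfolding X_def r_def using \<mu> by real_asymp
  then have evX: "\<forall>\<^sub>F l in at_top. X l \<ge> max a X1" unfolding filterlim_at_top by blast
  have ev: "\<forall>\<^sub>F l in at_top. f l - h l \<le> pi * N l \<and> pi * N l \<le> f l + h l"
    using evX eventually_ge_at_top[of 0]
  proof eventually_elim
    case (elim l)
    have r: "r l > 0" "(r l)\<^sup>2 = l + 1/4" using elim by (auto simp: r_def)
    have Xa: "X l \<ge> a" "X l \<ge> X1" using elim by auto
    have E: "E l x < \<mu>" if x: "x \<ge> X l" for x
    proof -
      have Xp: "X l > 0" using Xa a by simp
      have "(l + 1/4) / x\<^sup>2 \<le> (l + 1/4) / (X l)\<^sup>2"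
        using x Xp elim by (intro divide_left_mono power_mono mult_pos_pos zero_less_power) auto
      also have "\<dots> = \<mu>\<^sup>2 / 4" using r \<mu> by (simp add: X_def power_divide power_mult_distrib flip: r(2))
      finally have "(l + 1/4) / x\<^sup>2 \<le> \<mu>\<^sup>2 / 4" .
      moreover have "(P x)\<^sup>2 \<le> (\<mu> / 2)\<^sup>2"
        using X1[of x] x Xa \<mu> by (simp add: abs_le_square_iff[symmetric])
      moreover have "(\<mu> / 2)\<^sup>2 = \<mu>\<^sup>2 / 4" by (simp add: power_divide)
      ultimately have "(l + 1/4) / x\<^sup>2 + (P x)\<^sup>2 \<le> \<mu>\<^sup>2 / 2" by linarith
      also have "\<dots> < \<mu> * \<mu>" using \<mu> by (simp add: power2_eq_square)
      finally show ?thesis unfolding E_def using \<mu> by (simp add: pos_divide_less_eq)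
    qed
    note up = counting_upper[OF Xa(1) E]
    have lo: "ph l (X l) / pi - M / pi - 3 \<le> N l"
      unfolding N_def by (rule counting_lower) (use M elim Xa up in auto)
    have "\<bar>ph l (X l) - r l * ln (X l / a)\<bar> \<le> B * X l + (B\<^sup>2 + \<mu>\<^sup>2) * (X l)\<^sup>2 / (2 * r l) + ln (X l / a) / 2 + 4 * pi"
      using elim Xa B(2) by (intro angle_bound) (auto simp: r_def)
    moreover have "ln (X l / a) = ln (r l) + c"
      unfolding X_def c_def using r a \<mu> by (subst ln_mult_pos[symmetric]) (auto simp: field_simps)
    moreover have "B * X l + (B\<^sup>2 + \<mu>\<^sup>2) * (X l)\<^sup>2 / (2 * r l) = D * r l"
      unfolding X_def D_def using r(1) \<mu> by (simp add: field_simps power2_eq_square)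
    ultimately have ph: "\<bar>ph l (X l) - (r l * ln (r l) + c * r l)\<bar> \<le> D * r l + (ln (r l) + c) / 2 + 4 * pi"
      by (simp add: distrib_left mult.commute)
    have "pi * N l \<le> pi * (ph l (X l) / pi + 2)" using up(2) by (intro mult_left_mono) (auto simp: N_def)
    then have 1: "pi * N l \<le> ph l (X l) + 2 * pi" by (simp add: distrib_left)
    have "pi * (ph l (X l) / pi - M / pi - 3) \<le> pi * N l" using lo by (intro mult_left_mono) auto
    then have 2: "ph l (X l) - M - 3 * pi \<le> pi * N l" by (simp add: right_diff_distrib)
    have split: "(ln (r l) + c) / 2 = ln (r l) / 2 + c / 2" by (rule add_divide_distrib)
    have "f l - h l \<le> pi * N l"
      using 2 abs_le_D2[OF ph] M(1) pi_gt_zero unfolding f_def h_def C_def split by linarith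
    moreover have "pi * N l \<le> f l + h l"
      using 1 abs_le_D1[OF ph] M(1) pi_gt_zero unfolding f_def h_def C_def split by linarith
    ultimately show ?case by blast
  qed
  let ?d = "\<lambda>l::real. sqrt l * ln l / 2"
  have l1: "((\<lambda>l. r l * ln (r l) / ?d l) \<longlongrightarrow> 1) at_top" unfolding r_def by real_asymp
  have l2: "((\<lambda>l. r l / ?d l) \<longlongrightarrow> 0) at_top" unfolding r_def by real_asymp
  have l3: "((\<lambda>l. ln (r l) / ?d l) \<longlongrightarrow> 0) at_top" unfolding r_def by real_asymp
  have l4: "((\<lambda>l. 1 / ?d l) \<longlongrightarrow> 0) at_top" by real_asymp
  have "((\<lambda>l. r l * ln (r l) / ?d l + c * (r l / ?d l)) \<longlongrightarrow> 1 + c * 0) at_top"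
    by (intro tendsto_intros l1 l2)
  moreover have "r l * ln (r l) / ?d l + c * (r l / ?d l) = f l / ?d l" for l
    by (simp add: f_def add_divide_distrib)
  ultimately have lf: "((\<lambda>l. f l / ?d l) \<longlongrightarrow> 1) at_top" by simp
  have "((\<lambda>l. D * (r l / ?d l) + (1/2) * (ln (r l) / ?d l) + (c/2 + C) * (1 / ?d l)) \<longlongrightarrow> D * 0 + (1/2) * 0 + (c/2 + C) * 0) at_top"
    by (intro tendsto_intros l2 l3 l4)
  moreover have "D * (r l / ?d l) + (1/2) * (ln (r l) / ?d l) + (c/2 + C) * (1 / ?d l) = h l / ?d l" for l
  proof -
    have "D * (x / d) + (1/2) * (y / d) + (c/2 + C) * (1 / d) = (D * x + y / 2 + c / 2 + C) / d" for x y d :: real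
      by (simp add: add_divide_distrib)
    then show ?thesis unfolding h_def .
  qed
  ultimately have lh: "((\<lambda>l. h l / ?d l) \<longlongrightarrow> 0) at_top" by simp
  have dpos: "\<forall>\<^sub>F l in at_top. ?d l > 0" by real_asymp
  have "((\<lambda>l. pi * N l / ?d l) \<longlongrightarrow> 1) at_top"
  proof (rule tendsto_sandwich)
    show "\<forall>\<^sub>F l in at_top. f l / ?d l - h l / ?d l \<le> pi * N l / ?d l"
      using ev dpos by eventually_elim (simp only: diff_divide_distrib[symmetric], intro divide_right_mono, auto)
    show "\<forall>\<^sub>F l in at_top. pi * N l / ?d l \<le> f l / ?d l + h l / ?d l"
      using ev dpos by eventually_elim (simp only: add_divide_distrib[symmetric], intro divide_right_mono, auto)
    show "((\<lambda>l. f l / ?d l - h l / ?d l) \<longlongrightarrow> 1) at_top" using tendsto_diff[OF lf lh] by simp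
    show "((\<lambda>l. f l / ?d l + h l / ?d l) \<longlongrightarrow> 1) at_top" using tendsto_add[OF lf lh] by simp
  qed
  then show "((\<lambda>l. pi * real (card (spec l)) / (sqrt l * ln l / 2)) \<longlongrightarrow> 1) at_top"
    by (simp add: N_def)
qed

end

section \<open>Eigenfunctions\<close>

lemma ac_on_half_line_C1:
  fixes f :: "real \<Rightarrow> real"
  assumes d: "\<And>x. a \<le> x \<Longrightarrow> (f has_real_derivative f' x) (at x within {a..})" and c: "continuous_on {a..} f'"
  shows "ac_on a c f"
proof (rule ac_on_C1)
  fix x assume "x \<in> {a..c}"
  then show "(f has_vector_derivative f' x) (at x within {a..c})"
    using DERIV_subset[OF d, of x "{a..c}"] by (auto simp: has_real_derivative_iff_has_vector_derivative)
qed (rule continuous_on_subset[OF c], auto)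

lemma at_within_atLeast_nontrivial: "a \<le> x \<Longrightarrow> at x within {a..} \<noteq> bot" for x :: real
  using trivial_limit_within[of x "{a..}"] islimpt_greaterThanLessThan1[of x "x+1"]
  by (metis atLeast_iff greaterThanLessThan_iff islimpt_subset less_add_one less_imp_le order_trans subsetI)

lemma hl_deriv_eq:
  "a \<le> x \<Longrightarrow> (f has_vector_derivative D) (at x within {a..}) \<Longrightarrow> hl_deriv a f x = D"
  unfolding hl_deriv_def by (rule vector_derivative_within[OF at_within_atLeast_nontrivial])

lemma at_within_atLeast: "(a::real) < x \<Longrightarrow> at x within {a..} = at x"
  by (intro at_within_interior) (simp add: interior_real_atLeast)

context pruefer
begin

text \<open>The system is \<open>p' = q + P p\<close>, \<open>q' = - P q + (\<mu>\<^sup>2 - \<mu> E) p\<close>. In the coordinates \<open>p = R sin \<phi>\<close>,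
  \<open>q = \<mu> R cos \<phi>\<close> it becomes \<open>\<phi>' = F l x \<phi>\<close> and \<open>R' = \<rho> R\<close>.\<close>

definition \<rho> :: "real \<Rightarrow> real \<Rightarrow> real" where
  "\<rho> l x = (\<mu> - E l x / 2) * sin (2 * ph l x) - P x * cos (2 * ph l x)"

definition R :: "real \<Rightarrow> real \<Rightarrow> real" where "R l x = exp (integral {a..x} (\<rho> l))"
definition v :: "real \<Rightarrow> real \<Rightarrow> real" where "v l x = R l x * sin (ph l x)"
definition w :: "real \<Rightarrow> real \<Rightarrow> real" where "w l x = \<mu> * R l x * cos (ph l x)"

lemma cont_\<rho>: "continuous_on {a..} (\<rho> l)"
  unfolding \<rho>_def[abs_def] by (intro continuous_intros contE contP ph_cont) simp

lemma R_pos: "R l x > 0"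
  by (simp add: R_def)

lemma R_deriv: "x \<ge> a \<Longrightarrow> (R l has_real_derivative R l x * \<rho> l x) (at x within {a..})"
  unfolding R_def[abs_def] by (rule DERIV_chain2[OF DERIV_exp half_line_integral_deriv[OF cont_\<rho>]])

lemma v_deriv: "x \<ge> a \<Longrightarrow> (v l has_real_derivative w l x + P x * v l x) (at x within {a..})"
  and w_deriv: "x \<ge> a \<Longrightarrow> (w l has_real_derivative - P x * w l x + (\<mu>\<^sup>2 - \<mu> * E l x) * v l x) (at x within {a..})"
proof -
  assume x: "x \<ge> a"
  define s c where "s = sin (ph l x)" and "c = cos (ph l x)"
  have sc: "s\<^sup>2 + c\<^sup>2 = 1" by (simp add: s_def c_def)
  have r: "\<rho> l x = (\<mu> - E l x / 2) * (2 * s * c) - P x * (c\<^sup>2 - s\<^sup>2)"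
    by (simp add: \<rho>_def s_def c_def sin_double cos_double)
  have f: "F l x (ph l x) = \<mu> * (c\<^sup>2 - s\<^sup>2) + P x * (2 * s * c) + E l x * s\<^sup>2"
    by (simp add: F_def s_def c_def sin_double cos_double)
  have ds: "((\<lambda>x. sin (ph l x)) has_real_derivative c * F l x (ph l x)) (at x within {a..})"
    unfolding c_def by (rule DERIV_chain2[OF DERIV_sin ph_deriv[OF x]])
  have dc: "((\<lambda>x. cos (ph l x)) has_real_derivative - s * F l x (ph l x)) (at x within {a..})"
    unfolding s_def by (rule DERIV_chain2[OF DERIV_cos ph_deriv[OF x]])
  have 1: "\<rho> l x * s + c * F l x (ph l x) = \<mu> * c + P x * s"
  proof -
    have "\<rho> l x * s + c * F l x (ph l x) - (\<mu> * c + P x * s) = (s\<^sup>2 + c\<^sup>2 - 1) * (\<mu> * c + P x * s)"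
      unfolding r f by algebra
    then show ?thesis using sc by simp
  qed
  have 2: "\<rho> l x * c - s * F l x (ph l x) = - P x * c + (\<mu> - E l x) * s"
  proof -
    have "\<rho> l x * c - s * F l x (ph l x) - (- P x * c + (\<mu> - E l x) * s) = (s\<^sup>2 + c\<^sup>2 - 1) * (- P x * c + (\<mu> - E l x) * s)"
      unfolding r f by algebra
    then show ?thesis using sc by simp
  qed
  have "(v l has_real_derivative R l x * \<rho> l x * s + c * F l x (ph l x) * R l x) (at x within {a..})"
    unfolding v_def[abs_def] using DERIV_mult[OF R_deriv[OF x] ds] by (simp add: s_def)
  moreover have "R l x * \<rho> l x * s + c * F l x (ph l x) * R l x = R l x * (\<rho> l x * s + c * F l x (ph l x))"
    by (simp add: algebra_simps)
  moreover have "R l x * (\<mu> * c + P x * s) = w l x + P x * v l x" by (simp add: v_def w_def s_def c_def algebra_simps)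
  ultimately show "(v l has_real_derivative w l x + P x * v l x) (at x within {a..})" unfolding 1 by simp
  have "(w l has_real_derivative \<mu> * (R l x * \<rho> l x * c + - s * F l x (ph l x) * R l x)) (at x within {a..})"
    unfolding w_def[abs_def] using DERIV_cmult[OF DERIV_mult[OF R_deriv[OF x, of l] dc], of \<mu>] by (simp add: c_def mult.assoc)
  moreover have "\<mu> * (R l x * \<rho> l x * c + - s * F l x (ph l x) * R l x) = \<mu> * R l x * (\<rho> l x * c - s * F l x (ph l x))"
    by (simp add: algebra_simps)
  moreover have "\<mu> * R l x * (- P x * c + (\<mu> - E l x) * s) = - P x * w l x + (\<mu>\<^sup>2 - \<mu> * E l x) * v l x"
    by (simp add: v_def w_def s_def c_def algebra_simps power2_eq_square)
  ultimately show "(w l has_real_derivative - P x * w l x + (\<mu>\<^sup>2 - \<mu> * E l x) * v l x) (at x within {a..})" unfolding 2 by (simp only:)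
qed

lemma R_a: "R l a = 1" by (simp add: R_def)
lemma v_a: "v l a = sin \<phi>0" and w_a: "w l a = \<mu> * cos \<phi>0"
  by (simp_all add: v_def w_def R_a ph_a)

text \<open>The Wronskian \<open>p * w - q * v\<close> is constant and vanishes at \<open>a\<close>,
  so the two vectors are parallel at each point; that the factor does not depend on the point
  follows by differentiating it.\<close>

lemma solution_multiple:
  assumes p: "\<And>x. x \<ge> a \<Longrightarrow> (p has_real_derivative q x + P x * p x) (at x within {a..})"
    and q: "\<And>x. x \<ge> a \<Longrightarrow> (q has_real_derivative - P x * q x + (\<mu>\<^sup>2 - \<mu> * E l x) * p x) (at x within {a..})"
    and init: "p a * (\<mu> * cos \<phi>0) = q a * sin \<phi>0"
  shows "\<exists>k. \<forall>x\<ge>a. p x = k * v l x \<and> q x = k * w l x"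
proof -
  have "((\<lambda>x. p x * w l x - q x * v l x) has_real_derivative 0) (at x within {a..})" if x: "x \<ge> a" for x
  proof -
    have e0: "(q x + P x * p x) * w l x + (- P x * w l x + (\<mu>\<^sup>2 - \<mu> * E l x) * v l x) * p x -
      ((- P x * q x + (\<mu>\<^sup>2 - \<mu> * E l x) * p x) * v l x + (w l x + P x * v l x) * q x) = 0"
      by algebra
    show ?thesis
      using DERIV_diff[OF DERIV_mult[OF p[OF x] w_deriv[OF x, of l]] DERIV_mult[OF q[OF x] v_deriv[OF x, of l]]]
      unfolding e0 .
  qed
  from half_line_const[OF this] have W0: "p x * w l x = q x * v l x" if "x \<ge> a" for x
    using that init by (simp add: v_a w_a)
  define k where "k x = (p x * sin (ph l x) + q x * cos (ph l x) / \<mu>) / R l x" for x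
  have rel: "p x = k x * v l x \<and> q x = k x * w l x" if x: "x \<ge> a" for x
  proof -
    define s c where "s = sin (ph l x)" and "c = cos (ph l x)"
    have sc: "s\<^sup>2 + c\<^sup>2 = 1" by (simp add: s_def c_def)
    have "R l x * (p x * \<mu> * c) = R l x * (q x * s)"
      using W0[OF x] by (simp add: v_def w_def s_def c_def algebra_simps)
    then have e: "p x * \<mu> * c = q x * s" using R_pos[of l x] by simp
    have kv: "k x * v l x = (p x * s + q x * c / \<mu>) * s" "k x * w l x = (p x * s + q x * c / \<mu>) * (\<mu> * c)"
      using R_pos[of l x] by (simp_all add: k_def v_def w_def s_def c_def)
    have "q x * s * c / \<mu> = p x * c\<^sup>2" using e \<mu> by (simp add: field_simps power2_eq_square)
    then have "(p x * s + q x * c / \<mu>) * s = p x * (s\<^sup>2 + c\<^sup>2)" by (simp add: algebra_simps power2_eq_square)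
    moreover have "(p x * s + q x * c / \<mu>) * (\<mu> * c) = (p x * \<mu> * c) * s + q x * c\<^sup>2"
      using \<mu> by (simp add: field_simps power2_eq_square)
    then have "(p x * s + q x * c / \<mu>) * (\<mu> * c) = q x * (s\<^sup>2 + c\<^sup>2)"
      unfolding e by (simp add: algebra_simps power2_eq_square)
    ultimately show ?thesis unfolding kv sc by simp
  qed
  have n: "(v l x)\<^sup>2 + (w l x)\<^sup>2 > 0" for x
    using R_pos[of l x] \<mu> sin_zero_abs_cos_one[of "ph l x"]
    by (cases "sin (ph l x) = 0") (auto simp: v_def w_def sum_power2_gt_zero_iff)
  \<comment> \<open>The same factor as \<open>k\<close>, written as a projection onto
    \<open>(v, w)\<close>, so that its derivative follows from the four equations of the
    system.\<close>
  define K where "K x = (p x * v l x + q x * w l x) / ((v l x)\<^sup>2 + (w l x)\<^sup>2)" for x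
  have Kk: "K x = k x" if x: "x \<ge> a" for x
  proof -
    have e: "p x * v l x + q x * w l x = k x * ((v l x)\<^sup>2 + (w l x)\<^sup>2)"
      using rel[OF x] by (simp add: power2_eq_square algebra_simps)
    have "(v l x)\<^sup>2 + (w l x)\<^sup>2 \<noteq> 0" using n[of x] by linarith
    then show ?thesis unfolding K_def e by (rule nonzero_mult_div_cancel_right)
  qed
  have "(K has_real_derivative 0) (at x within {a..})" if x: "x \<ge> a" for x
  proof -
    define v' w' where "v' = w l x + P x * v l x" and "w' = - P x * w l x + (\<mu>\<^sup>2 - \<mu> * E l x) * v l x"
    define n' where "n' = 2 * v l x * v' + 2 * w l x * w'"
    define num' where "num' = (k x * v') * v l x + v' * p x + ((k x * w') * w l x + w' * q x)"
    have p': "(p has_real_derivative k x * v') (at x within {a..})"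
      using p[OF x] rel[OF x] by (simp add: v'_def algebra_simps)
    have q': "(q has_real_derivative k x * w') (at x within {a..})"
      using q[OF x] rel[OF x] by (simp add: w'_def algebra_simps)
    have vd: "(v l has_real_derivative v') (at x within {a..})" unfolding v'_def by (rule v_deriv[OF x])
    have wd: "(w l has_real_derivative w') (at x within {a..})" unfolding w'_def by (rule w_deriv[OF x])
    have dn: "((\<lambda>x. p x * v l x + q x * w l x) has_real_derivative num') (at x within {a..})"
      unfolding num'_def by (intro DERIV_add DERIV_mult p' q' vd wd)
    have dd: "((\<lambda>x. (v l x)\<^sup>2 + (w l x)\<^sup>2) has_real_derivative n') (at x within {a..})"
      unfolding n'_def by (auto intro!: derivative_eq_intros vd wd)
    have n0: "(v l x)\<^sup>2 + (w l x)\<^sup>2 \<noteq> 0" using n[of x] by linarith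
    have e: "num' * ((v l x)\<^sup>2 + (w l x)\<^sup>2) - (p x * v l x + q x * w l x) * n' = 0"
      using rel[OF x] unfolding num'_def n'_def by (auto simp: power2_eq_square algebra_simps)
    show ?thesis
      using DERIV_divide[OF dn dd n0] unfolding K_def[abs_def] e by simp
  qed
  from half_line_const[OF this] have "K x = K a" if "x \<ge> a" for x using that by blast
  then show ?thesis using rel Kk by (intro exI[of _ "K a"]) metis
qed

text \<open>The sine of the doubled angle is at most \<open>- 1/2\<close> there, which gives the
  main part \<open>- \<mu> / 2\<close>; smallness of \<open>P\<close> and \<open>E\<close> costs at
  most half of it.\<close>

lemma \<rho>_decaying:
  assumes "decaying l k"
  shows "\<forall>\<^sub>F x in at_top. \<rho> l x \<le> - \<mu> / 4"
proof -
  obtain X where X: "small \<bar>l\<bar> X" using small_ex by blast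
  show ?thesis
    using assms[unfolded decaying_def] eventually_ge_at_top[of X]
  proof eventually_elim
    case (elim x)
    have sm: "\<bar>P x\<bar> + \<bar>E l x\<bar> \<le> \<mu> / 4" using smallD(2)[OF X _ elim(2)] by simp
    have "(\<mu> - E l x / 2) * sin (2 * ph l x) \<le> (\<mu> - E l x / 2) * (- 1/2)"
      using sectors(5)[OF elim(1)] sm \<mu> by (intro mult_left_mono) auto
    moreover have "\<bar>P x * cos (2 * ph l x)\<bar> \<le> \<bar>P x\<bar> * 1" unfolding abs_mult by (intro mult_left_mono) auto
    moreover have "(\<mu> - E l x / 2) * (- 1/2) = - \<mu> / 2 + E l x / 4" by (simp add: algebra_simps)
    ultimately show ?case using sm \<mu> unfolding \<rho>_def by linarith
  qed
qed

lemma \<rho>_growing: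
  assumes "growing l k"
  shows "\<forall>\<^sub>F x in at_top. \<rho> l x \<ge> \<mu> / 4 \<and> \<bar>sin (ph l x)\<bar> \<ge> 1/2"
proof -
  obtain X where X: "small \<bar>l\<bar> X" using small_ex by blast
  show ?thesis
    using assms[unfolded growing_def] eventually_ge_at_top[of X]
  proof eventually_elim
    case (elim x)
    have sm: "\<bar>P x\<bar> + \<bar>E l x\<bar> \<le> \<mu> / 4" using smallD(2)[OF X _ elim(2)] by simp
    have "(\<mu> - E l x / 2) * sin (2 * ph l x) \<ge> (\<mu> - E l x / 2) * (1/2)"
      using sectors(3)[OF elim(1)] sm \<mu> by (intro mult_left_mono) auto
    moreover have "\<bar>P x * cos (2 * ph l x)\<bar> \<le> \<bar>P x\<bar> * 1" unfolding abs_mult by (intro mult_left_mono) auto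
    moreover have "(\<mu> - E l x / 2) * (1/2) = \<mu> / 2 - E l x / 4" by (simp add: algebra_simps)
    ultimately show ?case using sm \<mu> sectors(4)[OF elim(1)] unfolding \<rho>_def by linarith
  qed
qed

text \<open>Eventually \<open>R l x * exp ((\<mu>/4) * x)\<close> is nonincreasing, and on the
  compact piece before it is bounded by continuity.\<close>

lemma R_decay:
  assumes "decaying l k"
  shows "\<exists>C. \<forall>x\<ge>a. R l x \<le> C * exp (- (\<mu>/4) * x)"
proof -
  obtain X0 where X0: "\<And>x. x \<ge> X0 \<Longrightarrow> \<rho> l x \<le> - \<mu> / 4"
    using \<rho>_decaying[OF assms] unfolding eventually_at_top_linorder by blast
  define X where "X = max a X0"
  let ?g = "\<lambda>x. R l x * exp ((\<mu>/4) * x)"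
  have dg: "(?g has_real_derivative (R l x * \<rho> l x + (\<mu>/4) * R l x) * exp ((\<mu>/4) * x)) (at x within {a..})" if "x \<ge> a" for x
    by (rule DERIV_mult_exp[OF R_deriv[OF that]])
  have "bounded (?g ` {a..X})"
    by (intro compact_imp_bounded compact_continuous_image half_line_continuous_on[OF dg]) auto
  then obtain C where C: "\<And>x. x \<in> {a..X} \<Longrightarrow> ?g x \<le> C"
    unfolding bounded_iff real_norm_def by (meson abs_le_D1 imageI)
  have "?g x \<le> C" if x: "x \<ge> a" for x
  proof (cases "x \<le> X")
    case False
    have "- ?g X \<le> - ?g x"
    proof (rule half_line_nondecreasing[OF DERIV_minus[OF dg]])
      fix y assume "X < y"
      then have "\<rho> l y + \<mu>/4 \<le> 0" using X0[of y] by (simp add: X_def)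
      then have "R l y * (\<rho> l y + \<mu>/4) \<le> 0" using R_pos[of l y] by (simp add: mult_le_0_iff)
      then show "0 \<le> - ((R l y * \<rho> l y + (\<mu>/4) * R l y) * exp ((\<mu>/4) * y))"
        using mult_nonpos_nonneg[of "R l y * \<rho> l y + (\<mu>/4) * R l y" "exp ((\<mu>/4) * y)"]
        by (simp add: distrib_left mult.commute)
    qed (use False in \<open>auto simp: X_def\<close>)
    then show ?thesis using C[of X] by (simp add: X_def)
  qed (use C x in auto)
  note gC = this
  have "R l x \<le> C * exp (- (\<mu>/4) * x)" if "x \<ge> a" for x
  proof -
    have "?g x * exp (- (\<mu>/4) * x) \<le> C * exp (- (\<mu>/4) * x)"
      using gC[OF that] by (rule mult_right_mono) simp
    moreover have "?g x * exp (- (\<mu>/4) * x) = R l x" by (simp add: mult.assoc flip: exp_add)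
    ultimately show ?thesis by (simp only:)
  qed
  then show ?thesis by blast
qed

text \<open>Linear growth of \<open>R\<close> is exactly what survives the division by
  \<open>x\<close> as a positive lower bound, and such a bound already excludes square
  integrability.\<close>

lemma v_growth:
  assumes "growing l k"
  shows "\<exists>c>0. \<forall>\<^sub>F x in at_top. \<bar>v l x / x\<bar> \<ge> c"
proof -
  obtain X0 where X0: "\<And>x. x \<ge> X0 \<Longrightarrow> \<rho> l x \<ge> \<mu> / 4 \<and> \<bar>sin (ph l x)\<bar> \<ge> 1/2"
    using \<rho>_growing[OF assms] unfolding eventually_at_top_linorder by blast
  define X where "X = max a X0"
  have X: "X \<ge> a" "X \<ge> X0" "X > 0" using a by (auto simp: X_def)
  have inc: "R l x \<ge> R l X" if x: "x \<ge> X" for x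
  proof (rule half_line_nondecreasing[OF R_deriv X(1) x])
    fix y assume "X < y"
    then have "\<rho> l y \<ge> 0" using X0[of y] X \<mu> by auto
    then show "R l y * \<rho> l y \<ge> 0" using R_pos[of l y] by simp
  qed
  have gr: "R l x \<ge> R l X + R l X * (\<mu>/4) * (x - X)" if x: "x \<ge> X" for x
  proof (rule half_line_growth[OF R_deriv X(1) x])
    fix y assume "X < y"
    then show "R l X * (\<mu>/4) \<le> R l y * \<rho> l y"
      using X0[of y] X \<mu> inc[of y] R_pos[of l y] by (intro mult_mono) auto
  qed
  \<comment> \<open>The two entries make \<open>c * X \<le> 1\<close> and
    \<open>c * (x - X) \<le> (\<mu>/4) * (x - X)\<close>, so \<open>c * x\<close> stays below the
    linear factor in \<open>gr\<close>.\<close>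
  define c where "c = min (1 / X) (\<mu>/4)"
  have c: "c > 0" using X \<mu> by (simp add: c_def)
  have "\<bar>v l x / x\<bar> \<ge> R l X * c / 2" if x: "x \<ge> X" for x
  proof -
    have "c * X \<le> (1 / X) * X" "c * (x - X) \<le> (\<mu>/4) * (x - X)"
      using X x by (intro mult_right_mono; simp add: c_def)+
    moreover have "(1 / X) * X = 1" using X by simp
    moreover have "c * x = c * X + c * (x - X)" by (simp add: algebra_simps)
    ultimately have "c * x \<le> 1 + (\<mu>/4) * (x - X)" by linarith
    then have "R l X * (c * x) \<le> R l X * (1 + (\<mu>/4) * (x - X))"
      using R_pos[of l X] by (intro mult_left_mono) auto
    also have "\<dots> \<le> R l x" using gr[OF x] by (simp add: algebra_simps)
    finally have "R l X * c * x \<le> R l x" by (simp add: mult.assoc)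
    moreover have "R l x * (1/2) \<le> R l x * \<bar>sin (ph l x)\<bar>"
      using X0[of x] x X R_pos[of l x] by (intro mult_left_mono) auto
    moreover have "\<bar>v l x\<bar> = R l x * \<bar>sin (ph l x)\<bar>" using R_pos[of l x] by (simp add: v_def abs_mult)
    ultimately have "R l X * c / 2 * x \<le> \<bar>v l x\<bar>" by simp
    moreover have "x > 0" using x X by simp
    ultimately show ?thesis by (simp add: abs_divide pos_le_divide_eq)
  qed
  then show ?thesis
    using c R_pos[of l X] unfolding eventually_at_top_linorder
    by (intro exI[of _ "R l X * c / 2"] conjI exI[of _ X]) auto
qed

end

section \<open>The system and the differential expression\<close>

locale sturm_liouville = pruefer +
  fixes V :: "real \<Rightarrow> real" and N :: "real set"
  assumes acP: "\<And>c. c \<ge> a \<Longrightarrow> ac_on a c P"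
    and negN: "negligible N"
    and derP: "\<And>x. x > a \<Longrightarrow> x \<notin> N \<Longrightarrow> (P has_real_derivative V x / x\<^sup>2) (at x)"
begin

text \<open>Here \<open>W\<close> is \<open>x^2 y'\<close>, \<open>p\<close> is \<open>x y\<close>,
  and \<open>q\<close> is \<open>p' - P p\<close>. Off a null set the derivative of \<open>q\<close>
  is the continuous function \<open>G\<close>, since the terms with \<open>V\<close> cancel.
  Subtracting a primitive of \<open>G\<close> leaves an absolutely continuous function with
  derivative 0 almost everywhere, hence a constant; so \<open>q\<close> is differentiable at every
  point.\<close>

lemma real_system:
  fixes y W :: "real \<Rightarrow> real"
  assumes dy: "\<And>x. a \<le> x \<Longrightarrow> (y has_real_derivative W x / x\<^sup>2) (at x within {a..})"
    and acW: "\<And>c. c \<ge> a \<Longrightarrow> ac_on a c W"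
    and negM: "negligible M"
    and dW: "\<And>x. x > a \<Longrightarrow> x \<notin> M \<Longrightarrow> (W has_real_derivative (x\<^sup>2 * \<mu>\<^sup>2 - 1/4 + V x - l) * y x) (at x)"
  defines "p \<equiv> \<lambda>x. x * y x" and "q \<equiv> \<lambda>x. y x + W x / x - P x * (x * y x)"
  assumes x: "x \<ge> a"
  shows "(p has_real_derivative q x + P x * p x) (at x within {a..})"
    and "(q has_real_derivative - P x * q x + (\<mu>\<^sup>2 - \<mu> * E l x) * p x) (at x within {a..})"
proof -
  have x0: "x > 0" using x a by simp
  have "(p has_real_derivative 1 * y x + W x / x\<^sup>2 * x) (at x within {a..})"
    unfolding p_def by (intro DERIV_mult DERIV_ident dy x)
  then show "(p has_real_derivative q x + P x * p x) (at x within {a..})"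
    using x0 by (simp add: q_def p_def power2_eq_square)
  have cy: "continuous_on {a..} y" by (rule half_line_continuous_on[OF dy]) auto
  have "continuous_on {a..b} W" for b
    using ac_on_imp_continuous_on[OF acW[of b]] by (cases "a \<le> b") auto
  then have cW: "continuous_on {a..} W" by (rule continuous_on_atLeastI)
  have cp: "continuous_on {a..} p" unfolding p_def by (intro continuous_intros cy)
  have cq: "continuous_on {a..} q" unfolding q_def using a by (intro continuous_intros cy cW contP) auto
  define G where "G z = - P z * q z + (\<mu>\<^sup>2 - \<mu> * E l z) * p z" for z
  have cG: "continuous_on {a..} G" unfolding G_def by (intro continuous_intros cp cq contP contE)
  define I where "I z = integral {a..z} G" for z
  have dI: "(I has_real_derivative G z) (at z within {a..})" if "a \<le> z" for z
    unfolding I_def[abs_def] by (rule half_line_integral_deriv[OF cG that])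
  have "q z - I z = q a - I a" if z: "z \<ge> a" for z
  proof (rule ac_on_deriv_zero_imp_eq[OF _ z])
    have 1: "ac_on a z y"
      by (rule ac_on_half_line_C1[OF dy]) (use a in \<open>auto intro!: continuous_intros cW\<close>)
    have 2: "ac_on a z (\<lambda>z. 1 / z)"
    proof (rule ac_on_half_line_C1)
      show "((\<lambda>z. 1 / z) has_real_derivative - 1 / t\<^sup>2) (at t within {a..})" if "a \<le> t" for t
        using that a by (auto intro!: derivative_eq_intros simp: power2_eq_square)
      show "continuous_on {a..} (\<lambda>t. - 1 / t\<^sup>2)" using a by (auto intro!: continuous_intros)
    qed
    have "ac_on a z (\<lambda>z. y z + W z * (1 / z) - P z * (z * y z))"
      by (intro ac_on_diff ac_on_add ac_on_mult 1 2 acW acP ac_on_id z)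
    then show "ac_on a z (\<lambda>z. q z - I z)"
      by (intro ac_on_diff ac_on_half_line_C1[OF dI cG]) (simp_all add: q_def)
    show "negligible (N \<union> M)" using negN negM by simp
    fix t assume t: "a < t" "t < z" "t \<notin> N \<union> M"
    have t0: "t > 0" using t a by simp
    have dyt: "(y has_real_derivative W t / t\<^sup>2) (at t)" by (rule half_line_DERIV[OF dy t(1)])
    have dWt: "(W has_real_derivative (t\<^sup>2 * \<mu>\<^sup>2 - 1/4 + V t - l) * y t) (at t)" using dW t by blast
    have dPt: "(P has_real_derivative V t / t\<^sup>2) (at t)" using derP t by blast
    have dIt: "(I has_real_derivative G t) (at t)" by (rule half_line_DERIV[OF dI t(1)])
    have dq: "(q has_real_derivative W t / t\<^sup>2 + ((t\<^sup>2 * \<mu>\<^sup>2 - 1/4 + V t - l) * y t * t - W t * 1) / (t * t)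
         - (V t / t\<^sup>2 * (t * y t) + (1 * y t + W t / t\<^sup>2 * t) * P t)) (at t)"
      unfolding q_def using t0
      by (intro DERIV_diff DERIV_add DERIV_mult DERIV_divide DERIV_ident dyt dWt dPt) auto
    have El: "\<mu> * E l t = (l + 1/4) / t\<^sup>2 + (P t)\<^sup>2" using \<mu> by (simp add: E_def)
    have "W t / t\<^sup>2 + ((t\<^sup>2 * \<mu>\<^sup>2 - 1/4 + V t - l) * y t * t - W t * 1) / (t * t)
         - (V t / t\<^sup>2 * (t * y t) + (1 * y t + W t / t\<^sup>2 * t) * P t) = G t"
      unfolding G_def El q_def p_def using t0 by (simp add: field_simps power2_eq_square)
    with dq have "(q has_real_derivative G t) (at t)" by simp
    from DERIV_diff[OF this dIt] show "((\<lambda>z. q z - I z) has_vector_derivative 0) (at t)"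
      by (simp add: has_real_derivative_iff_has_vector_derivative)
  qed
  then have qI: "q z = I z + (q a - I a)" if "z \<ge> a" for z using that by (simp add: algebra_simps)
  have "((\<lambda>z. I z + (q a - I a)) has_real_derivative G x) (at x within {a..})"
    using DERIV_add[OF dI[OF x] DERIV_const[of "q a - I a"]] by simp
  then have "(q has_real_derivative G x) (at x within {a..})"
  proof (rule has_field_derivative_transform_within[where d = 1])
    show "I z + (q a - I a) = q z" if "z \<in> {a..}" for z
      using that by (intro qI[symmetric]) simp
  qed (use x in auto)
  then show "(q has_real_derivative - P x * q x + (\<mu>\<^sup>2 - \<mu> * E l x) * p x) (at x within {a..})"
    by (simp add: G_def)
qed

text \<open>\<open>x^2\<close> times the derivative of \<open>v / x\<close>, with \<open>v'\<close>
  replaced by \<open>w + P v\<close>: the function whose absolute continuity \<open>H_dom\<close>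
  demands.\<close>

definition W :: "real \<Rightarrow> real \<Rightarrow> real" where "W l x = x * (w l x + P x * v l x) - v l x"

lemma y_deriv: "x \<ge> a \<Longrightarrow> ((\<lambda>x. v l x / x) has_real_derivative W l x / x\<^sup>2) (at x within {a..})"
proof -
  assume x: "x \<ge> a"
  then have "x \<noteq> 0" using a by auto
  from DERIV_divide[OF v_deriv[OF x] DERIV_ident this, of l] show ?thesis
    by (simp add: W_def power2_eq_square mult.commute)
qed

lemma cont_v: "continuous_on {a..} (v l)" and cont_w: "continuous_on {a..} (w l)"
  by (rule half_line_continuous_on[OF v_deriv], auto) (rule half_line_continuous_on[OF w_deriv], auto)

lemma acW: "ac_on a c (W l)" if "c \<ge> a"
proof -
  have "ac_on a c (v l)" "ac_on a c (w l)"
    by (rule ac_on_half_line_C1[OF v_deriv], auto intro!: continuous_intros contP cont_v cont_w)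
       (rule ac_on_half_line_C1[OF w_deriv], auto intro!: continuous_intros contP contE cont_v cont_w)
  then show ?thesis unfolding W_def
    by (intro ac_on_diff ac_on_add ac_on_mult acP ac_on_id that)
qed

lemma W_deriv:
  assumes "x > a" "x \<notin> N"
  shows "(W l has_real_derivative (x\<^sup>2 * \<mu>\<^sup>2 - 1/4 + V x - l) * (v l x / x)) (at x)"
proof -
  have x0: "x > 0" using assms a by simp
  have dv: "(v l has_real_derivative w l x + P x * v l x) (at x)" by (rule half_line_DERIV[OF v_deriv assms(1)])
  have dw: "(w l has_real_derivative - P x * w l x + (\<mu>\<^sup>2 - \<mu> * E l x) * v l x) (at x)" by (rule half_line_DERIV[OF w_deriv assms(1)])
  have "(W l has_real_derivative 1 * (w l x + P x * v l x) +
      (- P x * w l x + (\<mu>\<^sup>2 - \<mu> * E l x) * v l x + (V x / x\<^sup>2 * v l x + (w l x + P x * v l x) * P x)) * x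
      - (w l x + P x * v l x)) (at x)"
    unfolding W_def by (intro DERIV_diff DERIV_mult DERIV_add DERIV_ident dv dw derP assms)
  moreover have El: "\<mu> * E l x = (l + 1/4) / x\<^sup>2 + (P x)\<^sup>2" using \<mu> by (simp add: E_def)
  have "1 * (w l x + P x * v l x) +
      (- P x * w l x + (\<mu>\<^sup>2 - \<mu> * E l x) * v l x + (V x / x\<^sup>2 * v l x + (w l x + P x * v l x) * P x)) * x
      - (w l x + P x * v l x) = (x\<^sup>2 * \<mu>\<^sup>2 - 1/4 + V x - l) * (v l x / x)"
    unfolding El using x0 by (simp add: field_simps power2_eq_square)
  ultimately show ?thesis by simp
qed

end

section \<open>Null sets and square integrability on the half-line\<close>

lemma AE_lebesgue_on_atLeast_iff:
  "(AE x in lebesgue_on {a::real..}. Q x) \<longleftrightarrow> (\<exists>M. negligible M \<and> (\<forall>x\<ge>a. x \<notin> M \<longrightarrow> Q x))"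
proof -
  have "(AE x in lebesgue_on {a..}. Q x) \<longleftrightarrow> (AE x in lebesgue. x \<in> {a..} \<longrightarrow> Q x)"
    by (rule AE_restrict_space_iff) simp
  also have "\<dots> \<longleftrightarrow> (\<exists>M. negligible M \<and> (\<forall>x\<ge>a. x \<notin> M \<longrightarrow> Q x))"
  proof
    assume "AE x in lebesgue. x \<in> {a..} \<longrightarrow> Q x"
    then obtain M where M: "M \<in> null_sets lebesgue" "{x \<in> space lebesgue. \<not> (x \<in> {a..} \<longrightarrow> Q x)} \<subseteq> M"
      unfolding eventually_ae_filter by blast
    then have "\<forall>x\<ge>a. x \<notin> M \<longrightarrow> Q x" by auto
    with M(1) show "\<exists>M. negligible M \<and> (\<forall>x\<ge>a. x \<notin> M \<longrightarrow> Q x)"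
      unfolding negligible_iff_null_sets by blast
  next
    assume "\<exists>M. negligible M \<and> (\<forall>x\<ge>a. x \<notin> M \<longrightarrow> Q x)"
    then obtain M where M: "M \<in> null_sets lebesgue" "\<forall>x\<ge>a. x \<notin> M \<longrightarrow> Q x"
      unfolding negligible_iff_null_sets by blast
    show "AE x in lebesgue. x \<in> {a..} \<longrightarrow> Q x"
      by (rule AE_I'[OF M(1)]) (use M(2) in auto)
  qed
  finally show ?thesis .
qed

lemma L2_half_line_of_exp_bound:
  fixes f :: "real \<Rightarrow> complex"
  assumes c: "continuous_on {a..} f" and k: "k > 0" and b: "\<And>x. x \<ge> a \<Longrightarrow> (norm (f x))\<^sup>2 \<le> C * exp (- k * x)"
  shows "f \<in> L2_half_line a"
proof -
  have m: "f \<in> borel_measurable (lebesgue_on {a..})"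
    by (rule continuous_imp_measurable_on_sets_lebesgue[OF c]) simp
  have "(\<lambda>x. exp (- k * x)) integrable_on {a..}"
    using integrable_on_exp_minus_to_infinity[OF k] .
  then have "(\<lambda>x. exp (- k * x)) absolutely_integrable_on {a..}"
    by (subst absolutely_integrable_on_iff_nonneg) auto
  then have "integrable (lebesgue_on {a..}) (\<lambda>x. C * exp (- k * x))"
    unfolding set_integrable_def by (intro integrable_mult_right) (simp add: integrable_restrict_space)
  then have "integrable (lebesgue_on {a..}) (\<lambda>x. (norm (f x))\<^sup>2)"
  proof (rule Bochner_Integration.integrable_bound)
    show "AE x in lebesgue_on {a..}. norm ((norm (f x))\<^sup>2) \<le> norm (C * exp (- k * x))"
    proof (rule AE_I2)
      fix x assume "x \<in> space (lebesgue_on {a..})"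
      then have "x \<ge> a" by (simp add: space_restrict_space)
      from b[OF this] show "norm ((norm (f x))\<^sup>2) \<le> norm (C * exp (- k * x))" by simp
    qed
  qed (use m in measurable)
  with m show ?thesis by (simp add: L2_half_line_def)
qed

lemma not_L2_half_line_of_lower_bound:
  fixes f :: "real \<Rightarrow> complex"
  assumes c: "c > 0" and ev: "\<forall>\<^sub>F x in at_top. norm (f x) \<ge> c"
  shows "f \<notin> L2_half_line a"
proof
  assume "f \<in> L2_half_line a"
  then have "integrable (lebesgue_on {a..}) (\<lambda>x. (norm (f x))\<^sup>2)" by (simp add: L2_half_line_def)
  then have "(\<lambda>x. (norm (f x))\<^sup>2) absolutely_integrable_on {a..}"
    unfolding set_integrable_def by (simp add: integrable_restrict_space)
  then have h: "(\<lambda>x. (norm (f x))\<^sup>2) integrable_on {a..}" by (simp add: absolutely_integrable_on_def)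
  obtain X0 where X0: "\<And>x. x \<ge> X0 \<Longrightarrow> norm (f x) \<ge> c" using ev by (auto simp: eventually_at_top_linorder)
  define X where "X = max a X0"
  define I where "I = integral {a..} (\<lambda>x. (norm (f x))\<^sup>2)"
  have "c\<^sup>2 * n \<le> I" if n: "n \<ge> 0" for n
  proof -
    have sub: "{X..X+n} \<subseteq> {a..}" by (auto simp: X_def)
    have i: "(\<lambda>x. (norm (f x))\<^sup>2) integrable_on {X..X+n}" by (rule integrable_on_subinterval[OF h sub])
    have "c\<^sup>2 * n = integral {X..X+n} (\<lambda>x. c\<^sup>2)" using n by simp
    also have "\<dots> \<le> integral {X..X+n} (\<lambda>x. (norm (f x))\<^sup>2)"
    proof (rule integral_le[OF _ i])
      fix x assume "x \<in> {X..X+n}"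
      then have "c \<le> norm (f x)" using X0[of x] by (simp add: X_def)
      then show "c\<^sup>2 \<le> (norm (f x))\<^sup>2" using c by (intro power_mono) auto
    qed (rule integrable_const_ivl)
    also have "\<dots> \<le> I" unfolding I_def by (rule integral_subset_le[OF sub i h]) simp
    finally show ?thesis .
  qed
  from this[of "(\<bar>I\<bar> + 1) / c\<^sup>2"] c show False by simp
qed

text \<open>Needed because \<open>H_expr\<close> equals the multiple of the eigenfunction only off a
  null set, on which its values are beyond control.\<close>

lemma L2_half_line_AE_cong:
  assumes f: "f \<in> L2_half_line a" and ae: "AE x in lebesgue_on {a..}. g x = f x"
  shows "g \<in> L2_half_line a"
proof -
  have S: "{a..} \<in> sets lebesgue" by simp
  obtain M where M: "negligible M" "\<And>x. x \<ge> a \<Longrightarrow> x \<notin> M \<Longrightarrow> g x = f x"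
    using ae unfolding AE_lebesgue_on_atLeast_iff by blast
  have "f measurable_on {a..}" using f unfolding measurable_on_iff_borel_measurable[OF S] by (simp add: L2_half_line_def)
  then have "g measurable_on {a..}"
    by (rule measurable_on_spike[OF _ M(1)]) (use M(2) in auto)
  then have gm: "g \<in> borel_measurable (lebesgue_on {a..})" unfolding measurable_on_iff_borel_measurable[OF S] .
  have "integrable (lebesgue_on {a..}) (\<lambda>x. (norm (g x))\<^sup>2) \<longleftrightarrow> integrable (lebesgue_on {a..}) (\<lambda>x. (norm (f x))\<^sup>2)"
  proof (rule integrable_cong_AE)
    show "AE x in lebesgue_on {a..}. (norm (g x))\<^sup>2 = (norm (f x))\<^sup>2" using ae by eventually_elim simp
  qed (use gm f in \<open>auto simp: L2_half_line_def\<close>)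
  with gm f show ?thesis by (simp add: L2_half_line_def)
qed

text \<open>Since \<open>v a = sin \<phi>0\<close> and \<open>w a = \<mu> cos \<phi>0\<close>, the assumption is the boundary condition for \<open>v / x\<close>.\<close>

locale boundary_problem = sturm_liouville +
  fixes \<theta> :: real
  assumes bc: "sin \<theta> * ((\<mu> * cos \<phi>0 + P a * sin \<phi>0) / a - sin \<phi>0 / a\<^sup>2) + cos \<theta> * sin \<phi>0 / a = 0"
begin

text \<open>The value 0 to the left of \<open>a\<close> is the normal form prescribed by
  \<open>H_dom\<close>.\<close>

definition ef :: "real \<Rightarrow> real \<Rightarrow> complex" where
  "ef l x = (if x < a then 0 else of_real (v l x / x))"

lemma ef_deriv:
  assumes "x \<ge> a"
  shows "((\<lambda>x. k * ef l x) has_vector_derivative k * of_real (W l x / x\<^sup>2)) (at x within {a..})"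
proof -
  have "((\<lambda>x. v l x / x) has_vector_derivative W l x / x\<^sup>2) (at x within {a..})"
    using y_deriv[OF assms] by (simp add: has_real_derivative_iff_has_vector_derivative)
  then have "((\<lambda>x. complex_of_real (v l x / x)) has_vector_derivative of_real (W l x / x\<^sup>2)) (at x within {a..})"
    by (rule bounded_linear.has_vector_derivative[OF bounded_linear_of_real])
  then have "((\<lambda>x. k * complex_of_real (v l x / x)) has_vector_derivative k * of_real (W l x / x\<^sup>2)) (at x within {a..})"
    by (rule has_vector_derivative_mult_right)
  then show ?thesis
    by (rule has_vector_derivative_transform[rotated -1]) (use assms in \<open>auto simp: ef_def\<close>)
qed

lemma hl_deriv_ef: "x \<ge> a \<Longrightarrow> hl_deriv a (\<lambda>x. k * ef l x) x = k * of_real (W l x / x\<^sup>2)"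
  by (rule hl_deriv_eq[OF _ ef_deriv])

lemma quasi_deriv_ef:
  "x \<ge> a \<Longrightarrow> of_real (x\<^sup>2) * hl_deriv a (\<lambda>x. k * ef l x) x = k * of_real (W l x)"
  using a by (simp add: hl_deriv_ef)

lemma H_expr_ef:
  assumes "x > a" "x \<notin> N"
  shows "H_expr a \<mu> V (\<lambda>x. k * ef l x) x = of_real l * (k * ef l x)"
proof -
  have "(W l has_vector_derivative (x\<^sup>2 * \<mu>\<^sup>2 - 1/4 + V x - l) * (v l x / x)) (at x within {a..})"
    using W_deriv[OF assms] at_within_atLeast[OF assms(1)] by (simp add: has_real_derivative_iff_has_vector_derivative)
  then have "((\<lambda>x. k * complex_of_real (W l x)) has_vector_derivative
      k * of_real ((x\<^sup>2 * \<mu>\<^sup>2 - 1/4 + V x - l) * (v l x / x))) (at x within {a..})"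
    by (intro has_vector_derivative_mult_right bounded_linear.has_vector_derivative[OF bounded_linear_of_real])
  then have "((\<lambda>t. of_real (t\<^sup>2) * hl_deriv a (\<lambda>x. k * ef l x) t) has_vector_derivative
      k * of_real ((x\<^sup>2 * \<mu>\<^sup>2 - 1/4 + V x - l) * (v l x / x))) (at x within {a..})"
    by (rule has_vector_derivative_transform[rotated -1]) (use assms quasi_deriv_ef in auto)
  note d = hl_deriv_eq[OF less_imp_le[OF assms(1)] this]
  have ef: "ef l x = of_real (v l x / x)" using assms by (simp add: ef_def)
  have "- (k * of_real ((b - l) * r)) + of_real b * (k * of_real r) = of_real l * (k * of_real r)" for b r :: real
    by (simp add: algebra_simps)
  then show ?thesis unfolding H_expr_def d ef .
qed

lemma R_bc_ef: "R_bc a \<theta> (\<lambda>x. k * ef l x) = 0"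
proof -
  have "W l a / a\<^sup>2 = (\<mu> * cos \<phi>0 + P a * sin \<phi>0) / a - sin \<phi>0 / a\<^sup>2"
    unfolding W_def v_a w_a using a by (simp add: field_simps power2_eq_square)
  then have e: "sin \<theta> * (W l a / a\<^sup>2) + cos \<theta> * (v l a / a) = 0" using bc by (simp add: v_a)
  have "R_bc a \<theta> (\<lambda>x. k * ef l x) = k * of_real (sin \<theta> * (W l a / a\<^sup>2) + cos \<theta> * (v l a / a))"
  proof -
    have ef: "ef l a = of_real (v l a / a)" by (simp add: ef_def)
    have "of_real s * (k * of_real p) + of_real c * (k * of_real q) = k * of_real (s * p + c * q)" for s c p q :: real
      by (simp add: algebra_simps)
    then show ?thesis unfolding R_bc_def hl_deriv_ef[OF order_refl] ef .
  qed
  then show ?thesis unfolding e by simp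
qed

text \<open>The arbitrary complex factor yields the whole line spanned by \<open>ef l\<close> at
  once, which is what the multiplicity requires.\<close>

lemma ef_in_eigenspace:
  assumes "decaying l j"
  shows "(\<lambda>x. k * ef l x) \<in> H_eigenspace a \<mu> V \<theta> (of_real l)"
proof -
  let ?f = "\<lambda>x. k * ef l x"
  have AE: "AE x in lebesgue_on {a..}. H_expr a \<mu> V ?f x = of_real l * ?f x"
    unfolding AE_lebesgue_on_atLeast_iff
  proof (intro exI conjI allI impI)
    show "negligible (N \<union> {a})" using negN by simp
    fix x assume "a \<le> x" "x \<notin> N \<union> {a}"
    then show "H_expr a \<mu> V ?f x = of_real l * ?f x" by (intro H_expr_ef) auto
  qed
  obtain C where C: "\<And>x. x \<ge> a \<Longrightarrow> R l x \<le> C * exp (- (\<mu>/4) * x)" using R_decay[OF assms] by blast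
  \<comment> \<open>Stated for every factor: \<open>k\<close> gives the function itself,
    \<open>l * k\<close> gives \<open>H_expr\<close> of it.\<close>
  have L2: "(\<lambda>x. k' * ef l x) \<in> L2_half_line a" for k'
  proof (rule L2_half_line_of_exp_bound)
    show "continuous_on {a..} (\<lambda>x. k' * ef l x)"
      unfolding continuous_on_eq_continuous_within
      using ef_deriv has_vector_derivative_continuous by blast
    show "\<mu>/2 > 0" using \<mu> by simp
    fix x assume x: "x \<ge> a"
    have "\<bar>v l x\<bar> \<le> R l x * 1" unfolding v_def abs_mult using R_pos[of l x] by (intro mult_mono) auto
    then have "\<bar>v l x\<bar> \<le> C * exp (- (\<mu>/4) * x)" using C[OF x] by simp
    then have "(v l x)\<^sup>2 \<le> (C * exp (- (\<mu>/4) * x))\<^sup>2" by (metis abs_ge_zero power2_abs power_mono)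
    also have "\<dots> = C\<^sup>2 * exp (- (\<mu>/2) * x)" by (simp add: power_mult_distrib power2_eq_square flip: exp_add)
    finally have "(v l x)\<^sup>2 / x\<^sup>2 \<le> C\<^sup>2 * exp (- (\<mu>/2) * x) / a\<^sup>2"
      using x a by (intro frac_le power_mono) auto
    then have "(norm k')\<^sup>2 * ((v l x)\<^sup>2 / x\<^sup>2) \<le> (norm k')\<^sup>2 * (C\<^sup>2 * exp (- (\<mu>/2) * x) / a\<^sup>2)"
      by (rule mult_left_mono) simp
    moreover have "(norm (k' * ef l x))\<^sup>2 = (norm k')\<^sup>2 * ((v l x)\<^sup>2 / x\<^sup>2)"
      using x by (simp add: ef_def norm_mult power_mult_distrib power_divide norm_divide)
    ultimately show "(norm (k' * ef l x))\<^sup>2 \<le> ((norm k')\<^sup>2 * C\<^sup>2 / a\<^sup>2) * exp (- (\<mu>/2) * x)"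
      by simp
  qed
  have L2H: "H_expr a \<mu> V ?f \<in> L2_half_line a"
  proof (rule L2_half_line_AE_cong[OF L2[of "of_real l * k"]])
    show "AE x in lebesgue_on {a..}. H_expr a \<mu> V ?f x = of_real l * k * ef l x"
      using AE by eventually_elim simp
  qed
  have ac: "loc_abs_cont a (\<lambda>x. of_real (x\<^sup>2) * hl_deriv a ?f x)"
    unfolding loc_abs_cont_def abs_cont_on_Icc_eq_ac_on
  proof (intro allI impI)
    fix c assume c: "c \<ge> a"
    have "ac_on a c (\<lambda>x. k * complex_of_real (W l x))"
      by (intro ac_on_bounded_linear[OF bounded_linear_mult_right] ac_on_bounded_linear[OF bounded_linear_of_real] acW c)
    \<comment> \<open>Comparison with constant 1 acts as a congruence rule here, since the two
      functions are known to agree only on \<open>{a..c}\<close>.\<close>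
    then show "ac_on a c (\<lambda>x. of_real (x\<^sup>2) * hl_deriv a ?f x)"
      by (rule ac_on_comparison[OF _ ac_on_id, of _ _ _ _ 1 0]) (simp add: quasi_deriv_ef del: of_real_power)
  qed
  have "?f differentiable (at x within {a..})" if "x \<ge> a" for x
    using ef_deriv[OF that] by (rule differentiableI_vector)
  moreover have "?f x = 0" if "x < a" for x using that by (simp add: ef_def)
  ultimately have "?f \<in> H_dom a \<mu> V \<theta>"
    unfolding H_dom_def using ac L2 L2H R_bc_ef by simp
  with AE show ?thesis by (simp add: H_eigenspace_def)
qed

text \<open>\<open>T\<close> stands for the real or the imaginary part. The equation and the
  boundary condition have real coefficients, so \<open>T\<close> carries them over to a real
  solution of the system.\<close>

lemma real_part_multiple:
  fixes f :: "real \<Rightarrow> complex" and T :: "complex \<Rightarrow> real"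
  assumes f: "f \<in> H_eigenspace a \<mu> V \<theta> (of_real l)"
    and T: "bounded_linear T" "\<And>r z. T (of_real r * z) = r * T z"
  shows "\<exists>k. \<forall>x\<ge>a. T (f x) = k * (v l x / x)"
proof -
  define Wf where "Wf x = of_real (x\<^sup>2) * hl_deriv a f x" for x
  have dom: "f \<in> H_dom a \<mu> V \<theta>" using f by (simp add: H_eigenspace_def)
  have df: "(f has_vector_derivative hl_deriv a f x) (at x within {a..})" if "x \<ge> a" for x
    using dom that unfolding H_dom_def hl_deriv_def by (auto simp: vector_derivative_works)
  have dy: "((\<lambda>x. T (f x)) has_real_derivative T (Wf x) / x\<^sup>2) (at x within {a..})" if x: "a \<le> x" for x
  proof -
    have "x\<^sup>2 \<noteq> 0" using x a by simp
    then have "T (hl_deriv a f x) = T (Wf x) / x\<^sup>2" unfolding Wf_def T(2) by simp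
    with bounded_linear.has_vector_derivative[OF T(1) df[OF x]] show ?thesis
      by (simp add: has_real_derivative_iff_has_vector_derivative)
  qed
  have acf: "ac_on a c Wf" if "c \<ge> a" for c
    using dom that unfolding H_dom_def loc_abs_cont_def abs_cont_on_Icc_eq_ac_on Wf_def[abs_def] by simp
  obtain M0 where M0: "negligible M0" "\<And>x. x \<ge> a \<Longrightarrow> x \<notin> M0 \<Longrightarrow> H_expr a \<mu> V f x = of_real l * f x"
    using f unfolding H_eigenspace_def AE_lebesgue_on_atLeast_iff by blast
  \<comment> \<open>Differentiability almost everywhere was obtained on bounded intervals; these
    exhaust the half-line.\<close>
  define A where "A n = {x \<in> {a<..<a + real n}. \<not> Wf differentiable (at x)}" for n :: nat
  define M where "M = M0 \<union> (\<Union>n. A n)"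
  have "negligible (A n)" for n
    unfolding A_def by (rule ac_on_complex_differentiable_ae[OF acf]) simp
  then have "negligible (\<Union>n. A n)" by (intro negligible_countable_Union) auto
  then have negM: "negligible M" unfolding M_def using M0(1) by (rule negligible_Un[rotated])
  have dW: "((\<lambda>x. T (Wf x)) has_real_derivative (x\<^sup>2 * \<mu>\<^sup>2 - 1/4 + V x - l) * T (f x)) (at x)"
    if x: "x > a" "x \<notin> M" for x
  proof -
    obtain n where "x - a < real n" using reals_Archimedean2 by blast
    then have "x \<in> {a<..<a + real n}" using x by simp
    then have "Wf differentiable (at x)" using x(2) by (auto simp: M_def A_def)
    then have d: "(Wf has_vector_derivative vector_derivative Wf (at x)) (at x)" by (simp add: vector_derivative_works)
    then have "hl_deriv a Wf x = vector_derivative Wf (at x)"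
      using hl_deriv_eq[of a x Wf] x at_within_atLeast[OF x(1)] by simp
    then have "- vector_derivative Wf (at x) + of_real (x\<^sup>2 * \<mu>\<^sup>2 - 1/4 + V x) * f x = of_real l * f x"
      using M0(2)[of x] x unfolding H_expr_def Wf_def[abs_def] M_def by simp
    then have e: "vector_derivative Wf (at x) = of_real (x\<^sup>2 * \<mu>\<^sup>2 - 1/4 + V x - l) * f x"
      by (simp add: algebra_simps)
    show ?thesis
      using bounded_linear.has_vector_derivative[OF T(1) d] unfolding e T(2)
      by (simp add: has_real_derivative_iff_has_vector_derivative)
  qed
  have acT: "ac_on a c (\<lambda>x. T (Wf x))" if "c \<ge> a" for c by (rule ac_on_bounded_linear[OF T(1) acf[OF that]])
  note sys = real_system[OF dy acT negM dW]
  have bcf: "sin \<theta> * (T (Wf a) / a\<^sup>2) + cos \<theta> * T (f a) = 0"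
  proof -
    have "T (of_real (sin \<theta>) * hl_deriv a f a + of_real (cos \<theta>) * f a) = T 0"
      using dom unfolding H_dom_def R_bc_def by simp
    moreover have "T 0 = 0" by (simp add: T(1) bounded_linear.linear linear_0)
    ultimately have "sin \<theta> * T (hl_deriv a f a) + cos \<theta> * T (f a) = 0"
      by (simp add: bounded_linear.linear[OF T(1)] linear_add T(2))
    moreover have "T (hl_deriv a f a) = T (Wf a) / a\<^sup>2" unfolding Wf_def T(2) using a by simp
    ultimately show ?thesis by simp
  qed
  have init: "(a * T (f a)) * (\<mu> * cos \<phi>0) = (T (f a) + T (Wf a) / a - P a * (a * T (f a))) * sin \<phi>0"
  proof -
    define s c where "s = sin \<phi>0" and "c = \<mu> * cos \<phi>0"
    define Y Z where "Y = T (f a)" and "Z = T (Wf a) / a"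
    have b1: "sin \<theta> * (c * a + P a * s * a - s) + cos \<theta> * s * a = 0"
    proof -
      have "sin \<theta> * (c * a + P a * s * a - s) + cos \<theta> * s * a =
          a\<^sup>2 * (sin \<theta> * ((c + P a * s) / a - s / a\<^sup>2) + cos \<theta> * s / a)"
        using a by (simp add: field_simps power2_eq_square)
      also have "\<dots> = 0" using bc by (simp add: s_def c_def)
      finally show ?thesis .
    qed
    have b2: "sin \<theta> * Z + cos \<theta> * Y * a = 0"
    proof -
      have "sin \<theta> * Z + cos \<theta> * Y * a = a * (sin \<theta> * (T (Wf a) / a\<^sup>2) + cos \<theta> * T (f a))"
        using a by (simp add: Y_def Z_def field_simps power2_eq_square)
      then show ?thesis unfolding bcf by simp
    qed
    \<comment> \<open>By \<open>b1\<close> and \<open>b2\<close> two vectors are annihilated by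
      \<open>(sin \<theta>, cos \<theta>)\<close>, so their determinant vanishes: it does so after
      multiplication by either entry, and the entries are not both 0.\<close>
    have "sin \<theta> * (a * Y * c - (Y + Z - P a * (a * Y)) * s) = 0"
      using b1 b2 by algebra
    moreover have "cos \<theta> * (a * Y * c - (Y + Z - P a * (a * Y)) * s) = 0"
    proof (cases "sin \<theta> = 0")
      case True
      then have "cos \<theta> \<noteq> 0" using sin_zero_abs_cos_one[of \<theta>] by fastforce
      then have "s = 0" "Y = 0" using b1 b2 True a by auto
      then show ?thesis by simp
    next
      case False
      with calculation show ?thesis by simp
    qed
    moreover have "sin \<theta> \<noteq> 0 \<or> cos \<theta> \<noteq> 0" using sin_zero_abs_cos_one[of \<theta>] by fastforce
    ultimately have "a * Y * c - (Y + Z - P a * (a * Y)) * s = 0" by auto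
    then show ?thesis by (simp add: s_def c_def Y_def Z_def)
  qed
  obtain k where "\<And>x. x \<ge> a \<Longrightarrow> x * T (f x) = k * v l x"
    using solution_multiple[OF sys init] by blast
  then have "T (f x) = k * (v l x / x)" if "x \<ge> a" for x
    using that a by (simp add: field_simps)
  then show ?thesis by blast
qed

lemma eigenspace_multiple:
  assumes f: "f \<in> H_eigenspace a \<mu> V \<theta> (of_real l)"
  shows "\<exists>k. f = (\<lambda>x. k * ef l x)"
proof -
  obtain k1 where k1: "\<And>x. x \<ge> a \<Longrightarrow> Re (f x) = k1 * (v l x / x)"
    using real_part_multiple[OF f bounded_linear_Re] by auto
  obtain k2 where k2: "\<And>x. x \<ge> a \<Longrightarrow> Im (f x) = k2 * (v l x / x)"
    using real_part_multiple[OF f bounded_linear_Im] by auto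
  have "f x = Complex k1 k2 * ef l x" for x
  proof (cases "x < a")
    case True
    then show ?thesis using f by (simp add: H_eigenspace_def H_dom_def ef_def)
  next
    case False
    then show ?thesis using k1[of x] k2[of x] by (simp add: ef_def complex_eq_iff)
  qed
  then show ?thesis by blast
qed

text \<open>If \<open>v\<close> vanished identically, so would its derivative and hence
  \<open>w\<close>, but sine and cosine of the angle have no common zero.\<close>

lemma ef_nonzero: "ef l \<noteq> (\<lambda>_. 0)"
proof
  assume z: "ef l = (\<lambda>_. 0)"
  have v0: "v l x = 0" if "x \<ge> a" for x
    using fun_cong[OF z, of x] that a by (simp add: ef_def split: if_splits)
  have s0: "sin (ph l x) = 0" if "x \<ge> a" for x using v0[OF that] R_pos[of l x] by (simp add: v_def)
  have y: "a < a + 1" by simp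
  have "(v l has_real_derivative w l (a+1) + P (a+1) * v l (a+1)) (at (a+1))" by (rule half_line_DERIV[OF v_deriv y])
  moreover have "(v l has_real_derivative 0) (at (a+1))"
  proof (rule has_field_derivative_transform_within_open[of "\<lambda>_. 0" _ _ "{a<..}"])
    show "\<And>u. u \<in> {a<..} \<Longrightarrow> 0 = v l u" using v0 by simp
  qed auto
  ultimately have "w l (a+1) + P (a+1) * v l (a+1) = 0" by (rule DERIV_unique)
  then have "cos (ph l (a+1)) = 0" using v0[of "a+1"] R_pos[of l "a+1"] \<mu> by (simp add: w_def)
  then show False using s0[of "a+1"] sin_cos_squared_add[of "ph l (a+1)"] by simp
qed

text \<open>Without decay the solution is growing, so every nonzero multiple of \<open>v / x\<close>
  stays away from 0 near infinity and is not square integrable.\<close>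

lemma eigenvalue_iff: "H_eigenvalue a \<mu> V \<theta> (of_real l) \<longleftrightarrow> (\<exists>j. decaying l j)"
proof
  assume "\<exists>j. decaying l j"
  then obtain j where "decaying l j" by blast
  from ef_in_eigenspace[OF this, of 1] ef_nonzero[of l]
  show "H_eigenvalue a \<mu> V \<theta> (of_real l)" unfolding H_eigenvalue_def by auto
next
  assume "H_eigenvalue a \<mu> V \<theta> (of_real l)"
  then obtain f where f: "f \<in> H_eigenspace a \<mu> V \<theta> (of_real l)" "f \<noteq> (\<lambda>_. 0)" unfolding H_eigenvalue_def by blast
  obtain k where k: "f = (\<lambda>x. k * ef l x)" using eigenspace_multiple[OF f(1)] by blast
  have k0: "k \<noteq> 0" using f(2) k by auto
  have L2: "f \<in> L2_half_line a" using f(1) by (simp add: H_eigenspace_def H_dom_def)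
  show "\<exists>j. decaying l j"
  proof (rule ccontr)
    assume "\<not> (\<exists>j. decaying l j)"
    then obtain j where "growing l j" using trichotomy by blast
    then obtain c where c: "c > 0" "\<forall>\<^sub>F x in at_top. \<bar>v l x / x\<bar> \<ge> c" using v_growth by blast
    have "\<forall>\<^sub>F x in at_top. norm (f x) \<ge> norm k * c"
      using c(2) eventually_ge_at_top[of a]
    proof eventually_elim
      case (elim x)
      have e: "norm (f x) = norm k * \<bar>v l x / x\<bar>" using elim(2) unfolding k by (simp add: ef_def norm_mult flip: of_real_divide)
      show ?case unfolding e using elim(1) by (rule mult_left_mono) simp
    qed
    then show False using not_L2_half_line_of_lower_bound[of "norm k * c" f a] L2 k0 c(1) by simp
  qed
qed

lemma multiplicity_one:
  assumes "decaying l j"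
  shows "H_multiplicity a \<mu> V \<theta> (of_real l) = 1"
proof -
  have "H_eigenspace a \<mu> V \<theta> (of_real l) = fun_vs.span {ef l}"
    unfolding fun_vs.span_singleton using eigenspace_multiple ef_in_eigenspace[OF assms] by blast
  then have "H_multiplicity a \<mu> V \<theta> (of_real l) = fun_vs.dim {ef l}"
    by (simp add: H_multiplicity_def fun_vs.dim_span)
  also have "\<dots> = card {ef l}"
  proof (rule fun_vs.dim_eq_card_independent)
    show "fun_vs.independent {ef l}"
      using ef_nonzero[of l] by (simp add: fun_vs.dependent_single zero_fun_def)
  qed
  finally show ?thesis by simp
qed

lemma counting_eq:
  "H_counting a \<mu> V \<theta> l = card (spec l)"
proof -
  have "H_counting a \<mu> V \<theta> l = (\<Sum>\<nu> | \<nu> \<le> l \<and> (\<exists>j. decaying \<nu> j). H_multiplicity a \<mu> V \<theta> (of_real \<nu>))"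
    unfolding H_counting_def eigenvalue_iff ..
  also have "\<dots> = (\<Sum>\<nu> | \<nu> \<le> l \<and> (\<exists>j. decaying \<nu> j). 1)"
    by (rule sum.cong) (auto simp: multiplicity_one)
  finally show ?thesis by (simp add: spec_def)
qed

lemma counting_asymp_equiv:
  "(\<lambda>l. real (H_counting a \<mu> V \<theta> l)) \<sim>[at_top] (\<lambda>l. sqrt l * ln l / (2 * (Gamma (1/2))\<^sup>2))"
proof (rule asymp_equivI')
  have "(Gamma (1/2 :: real))\<^sup>2 = pi" by (simp add: Gamma_one_half_real)
  then have "real (H_counting a \<mu> V \<theta> l) / (sqrt l * ln l / (2 * (Gamma (1/2))\<^sup>2)) =
      pi * real (card (spec l)) / (sqrt l * ln l / 2)" for l
    by (simp add: counting_eq)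
  then show "((\<lambda>l. real (H_counting a \<mu> V \<theta> l) / (sqrt l * ln l / (2 * (Gamma (1/2))\<^sup>2))) \<longlongrightarrow> 1) at_top"
    using counting_asymptotics by (simp only:)
qed

end

section \<open>From the potential to a boundary problem\<close>

lemma boundary_angle_exists:
  fixes A B :: real
  shows "\<exists>\<phi>. 0 \<le> \<phi> \<and> \<phi> \<le> 2 * pi \<and> A * sin \<phi> + B * cos \<phi> = 0"
proof -
  \<comment> \<open>The values at 0 and at pi are \<open>B\<close> and \<open>- B\<close>, of
    opposite sign.\<close>
  let ?h = "\<lambda>\<phi>. A * sin \<phi> + B * cos \<phi>"
  have c: "continuous_on {0..pi} ?h" by (intro continuous_intros)
  have "\<exists>\<phi>\<ge>0. \<phi> \<le> pi \<and> ?h \<phi> = 0"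
  proof (cases "B \<le> 0")
    case True
    then show ?thesis using IVT'[of ?h 0 0 pi] c by auto
  next
    case False
    then show ?thesis using IVT2'[of ?h pi 0 0] c by auto
  qed
  then obtain \<phi> where "\<phi> \<ge> 0" "\<phi> \<le> pi" "?h \<phi> = 0" by blast
  then show ?thesis using pi_gt_zero by (intro exI[of _ \<phi>]) linarith
qed

lemma integral_atLeast_limit:
  fixes U :: "real \<Rightarrow> real"
  assumes "U integrable_on {a..}"
  shows "((\<lambda>x. integral {a..x} U) \<longlongrightarrow> integral {a..} U) at_top"
proof (rule tendstoI)
  fix e :: real assume "e > 0"
  have "(U has_integral integral {a..} U) {a..}" using assms by (rule integrable_integral)
  then obtain B where B: "B > 0" "\<And>c d. ball 0 B \<subseteq> cbox c d \<Longrightarrow>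
      \<exists>z. ((\<lambda>x. if x \<in> {a..} then U x else 0) has_integral z) (cbox c d) \<and> norm (z - integral {a..} U) < e"
    unfolding has_integral'[of U] using \<open>e > 0\<close> by blast
  show "\<forall>\<^sub>F x in at_top. dist (integral {a..x} U) (integral {a..} U) < e"
    using eventually_ge_at_top[of "max B \<bar>a\<bar>"]
  proof eventually_elim
    case (elim x)
    \<comment> \<open>The integral over an unbounded set is a limit over boxes containing large
      balls; for \<open>x \<ge> \<bar>a\<bar>\<close> the symmetric box cuts \<open>{a..x}\<close>
      out of the half-line.\<close>
    have "ball 0 B \<subseteq> cbox (-x) x" using elim by (auto simp: dist_real_def)
    then obtain z where z: "((\<lambda>x. if x \<in> {a..} then U x else 0) has_integral z) (cbox (-x) x)" "norm (z - integral {a..} U) < e"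
      using B(2) by blast
    have "z = integral (cbox (-x) x \<inter> {a..}) U"
      using integral_unique[OF z(1)] unfolding integral_restrict_Int by (simp only: Int_commute)
    also have "cbox (-x) x \<inter> {a..} = {a..x}" using elim by auto
    finally show ?case using z(2) by (simp add: dist_real_def)
  qed
qed

text \<open>The quotient is \<open>x powr (\<gamma> - 2)\<close> times an integrable function, and
  for \<open>\<gamma> < 2\<close> this power is bounded on \<open>{a..}\<close> because
  \<open>a > 0\<close>.\<close>

lemma XpowL1_imp_potential:
  assumes a: "a > 0" and \<gamma>: "\<gamma> < 2" and V: "V \<in> XpowL1 \<gamma> a"
  shows "(\<lambda>x. V x / x\<^sup>2) absolutely_integrable_on {a..}"
proof -
  obtain g where g: "g absolutely_integrable_on {a..}" "\<And>x. x \<ge> a \<Longrightarrow> V x = x powr \<gamma> * g x"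
    using V by (auto simp: XpowL1_def)
  have "(\<lambda>x. x powr (\<gamma> - 2) * g x) absolutely_integrable_on {a..}"
  proof (rule absolutely_integrable_bounded_measurable_product_real[OF _ _ _ g(1)])
    have "continuous_on {a..} (\<lambda>x. x powr (\<gamma> - 2))" using a by (intro continuous_intros) auto
    then show "(\<lambda>x. x powr (\<gamma> - 2)) \<in> borel_measurable (lebesgue_on {a..})"
      by (rule continuous_imp_measurable_on_sets_lebesgue) simp
    show "bounded ((\<lambda>x. x powr (\<gamma> - 2)) ` {a..})"
      unfolding bounded_iff
    proof (intro exI ballI)
      fix z assume "z \<in> (\<lambda>x. x powr (\<gamma> - 2)) ` {a..}"
      then obtain x where "x \<ge> a" "z = x powr (\<gamma> - 2)" by auto
      moreover have "x powr (\<gamma> - 2) \<le> a powr (\<gamma> - 2)"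
        using \<open>x \<ge> a\<close> a \<gamma> by (intro powr_mono2') auto
      ultimately show "norm z \<le> a powr (\<gamma> - 2)" by simp
    qed
  qed simp
  moreover have "x powr (\<gamma> - 2) * g x = V x / x\<^sup>2" if "x \<in> {a..}" for x
    using that a g(2)[of x] by (simp add: powr_diff)
  then have "(\<lambda>x. x powr (\<gamma> - 2) * g x) absolutely_integrable_on {a..} \<longleftrightarrow> (\<lambda>x. V x / x\<^sup>2) absolutely_integrable_on {a..}"
    by (intro set_integrable_cong) auto
  ultimately show ?thesis by blast
qed

theorem mainTheorem3:
  fixes a \<mu> \<gamma> \<theta> :: real and V :: "real \<Rightarrow> real"
  assumes "a > 0" and "\<mu> > 0" and "\<gamma> < 2" and "V \<in> XpowL1 \<gamma> a"
    and "0 \<le> \<theta>" and "\<theta> < pi"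
  shows "(\<lambda>l. real (H_counting a \<mu> V \<theta> l)) \<sim>[at_top]
         (\<lambda>l. sqrt l * ln l / (2 * (Gamma (1/2))\<^sup>2))"
proof -
  define U where "U x = V x / x\<^sup>2" for x
  have Ua: "U absolutely_integrable_on {a..}"
    unfolding U_def[abs_def] by (rule XpowL1_imp_potential[OF assms(1,3,4)])
  then have Ui: "U integrable_on {a..}" by (simp add: absolutely_integrable_on_def)
  have Uac: "U absolutely_integrable_on {a..c}" for c
    using Ua by (rule set_integrable_subset) auto
  define P where "P x = integral {a..x} U - integral {a..} U" for x
  define A where "A n = {x \<in> {a<..<a + real n}. \<not> ((\<lambda>x. integral {a..x} U) has_real_derivative U x) (at x)}" for n :: nat
  define N where "N = (\<Union>n. A n)"
  have acI: "ac_on a c (\<lambda>x. integral {a..x} U)" for c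
    by (rule ac_on_indefinite_integral[OF Uac])
  have acP: "ac_on a c P" for c
    by (rule ac_on_comparison[OF acI acI, where L = 1 and M = 0]) (simp add: P_def)
  have contP: "continuous_on {a..} P"
    by (intro continuous_on_atLeastI ac_on_imp_continuous_on acP)
  have limP: "(P \<longlongrightarrow> 0) at_top"
    using tendsto_diff[OF integral_atLeast_limit[OF Ui] tendsto_const[of "integral {a..} U"]]
    by (simp add: P_def[abs_def])
  have "negligible (A n)" for n
    unfolding A_def using Uac[of "a + real n"]
    by (intro indefinite_integral_DERIV_ae) (simp add: absolutely_integrable_on_def)
  then have negN: "negligible N" unfolding N_def by (intro negligible_countable_Union) auto
  have derP: "(P has_real_derivative V x / x\<^sup>2) (at x)" if x: "x > a" "x \<notin> N" for x
  proof -
    obtain n where "x - a < real n" using reals_Archimedean2 by blast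
    then have "x \<in> {a<..<a + real n}" using x by simp
    then have "((\<lambda>x. integral {a..x} U) has_real_derivative U x) (at x)" using x(2) by (auto simp: N_def A_def)
    from DERIV_diff[OF this DERIV_const[of "integral {a..} U"]] show ?thesis
      by (simp add: P_def[abs_def] U_def)
  qed
  \<comment> \<open>The boundary condition for \<open>v / x\<close>, collected by the sine and the
    cosine of the initial angle.\<close>
  obtain \<phi>0 where \<phi>0: "0 \<le> \<phi>0" "\<phi>0 \<le> 2 * pi"
    and eq: "(sin \<theta> * (P a / a - 1 / a\<^sup>2) + cos \<theta> / a) * sin \<phi>0 + (sin \<theta> * \<mu> / a) * cos \<phi>0 = 0"
    using boundary_angle_exists by blast
  interpret boundary_problem a \<mu> \<phi>0 P V N \<theta>
  proof
    show "sin \<theta> * ((\<mu> * cos \<phi>0 + P a * sin \<phi>0) / a - sin \<phi>0 / a\<^sup>2) + cos \<theta> * sin \<phi>0 / a = 0"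
      using eq by (simp add: algebra_simps add_divide_distrib)
  qed (use assms \<phi>0 contP limP acP negN derP in auto)
  show ?thesis by (rule counting_asymp_equiv)
qed

end
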